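(* Let $G$ be a bipartite graph with $m$ left vertices and let $k_1,\dots,k_m$ be nonnegative integers. Suppose that $Q_G(k_1,\dots,k_m)$ is $d$-dimensional. Then its surface volume is $$\operatorname{SVol}\bigl(Q_G(k_1,\dots,k_m)\bigr)=2^d\sum_{\substack{\boldsymbol a\in D(G)\\|\boldsymbol a|=d-1}}\frac{k_1^{a_1}\cdots k_m^{a_m}}{a_1!\cdots a_m!}.$$
   Context: $G$ is a bipartite graph with left vertices $\ell_1,\dots,\ell_m$ and right vertices $r_1,\dots,r_n$; $I_j=\{i\in[n]\mid\ell_j\text{ is adjacent to }r_i\}$ for $j\in[m]$. A $G$-draconian sequence is a sequence $\boldsymbol a=(a_1,\dots,a_m)$ of nonnegative integers such that $\sum_{i\in J}a_i\le|\bigcup_{i\in J}I_i|$ for every nonempty $J\subset[m]$; $D(G)$ is the set of all of them; $|\boldsymbol a|=a_1+\cdots+a_m$. Convention: $0^0=1$. For nonempty $I\subset[n]$, $\diamondsuit_I=\operatorname{conv}(\pm\boldsymbol e_i\mid i\in I)\subset\mathbb R^n$, and $\diamondsuit_\varnothing=\{\boldsymbol 0\}$. $Q_G(k_1,\dots,k_m)=k_1\diamondsuit_{I_1}+\cdots+k_m\diamondsuit_{I_m}$ (Minkowski sum). For a lattice polytope $P\subset\mathbb R^n$, $\operatorname{Vol}(P)$ is the volume of $P$ with respect to the lattice of integer points in the affine span $\operatorname{aff}(P)$ (a fundamental parallelepiped of that lattice has volume 1; a point has volume 1). The surface volume $\operatorname{SVol}(P)$ is the sum of $\operatorname{Vol}(F)$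 over all facets $F$ of $P$, i.e. nonempty faces of dimension $\dim(P)-1$, each volume being taken relative to the lattice in $\operatorname{aff}(F)$. *)

theory Defs
  imports "HOL-Analysis.Analysis"
begin

section \<open>Bipartite graphs and draconian sequences\<close>

text \<open>
  A bipartite graph with left vertices \<open>1, \<dots>, m\<close> and right vertices the elements of a finite
  type \<open>'n\<close> is given by its set of edges \<open>G \<subseteq> {1..m} \<times> UNIV\<close>.
\<close>

definition nbhd :: "(nat \<times> 'n) set \<Rightarrow> nat \<Rightarrow> 'n set" where
  "nbhd G j = {i. (j, i) \<in> G}"

text \<open>
  Sequences indexed by \<open>{1..m}\<close> are extensional functions, so that each of them is
  represented exactly once.
\<close>

definition draconian_seqs :: "nat \<Rightarrow> (nat \<times> 'n) set \<Rightarrow> (nat \<Rightarrow> nat) set" where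
  "draconian_seqs m G =
     {a \<in> {1..m} \<rightarrow>\<^sub>E UNIV.
        \<forall>J. J \<noteq> {} \<and> J \<subseteq> {1..m} \<longrightarrow> (\<Sum>j\<in>J. a j) \<le> card (\<Union>j\<in>J. nbhd G j)}"

section \<open>Minkowski sums of cross-polytopes\<close>

definition cross_polytope :: "'n::finite set \<Rightarrow> (real ^ 'n) set" where
  "cross_polytope I =
     (if I = {} then {0} else convex hull (\<Union>i\<in>I. {axis i 1, - axis i 1}))"

text \<open>The sum is the Minkowski sum of sets, as set up in \<open>HOL-Library.Set_Algebras\<close>.\<close>

definition Q_poly :: "nat \<Rightarrow> (nat \<times> 'n) set \<Rightarrow> (nat \<Rightarrow> nat) \<Rightarrow> (real ^ 'n::finite) set" where
  "Q_poly m G k = (\<Sum>j\<in>{1..m}. (\<lambda>x. real (k j) *\<^sub>R x) ` cross_polytope (nbhd G j))"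

section \<open>Lattice volume and surface volume\<close>

definition integer_points :: "(real ^ 'n) set" where
  "integer_points = {x. \<forall>i. x $ i \<in> \<int>}"

definition affine_param ::
    "nat \<Rightarrow> (real ^ 'n) \<Rightarrow> (nat \<Rightarrow> real ^ 'n) \<Rightarrow> (nat \<Rightarrow> real) \<Rightarrow> real ^ 'n" where
  "affine_param d p b c = p + (\<Sum>i<d. c i *\<^sub>R b i)"

text \<open>
  \<open>p\<close> and \<open>b 0, \<dots>, b (d - 1)\<close> form a lattice frame of \<open>P\<close> if they are affine coordinates on the
  affine span of \<open>P\<close> in which the points of the lattice are precisely the points of
  \<open>\<int>\<^sup>d\<close>. In other words, \<open>p\<close> is a lattice point and the \<open>b i\<close> span a fundamental parallelepiped.
  Every nonempty lattice polytope has such a frame, with \<open>d\<close> its dimension.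
\<close>

definition lattice_frame ::
    "(real ^ 'n) set \<Rightarrow> nat \<Rightarrow> (real ^ 'n) \<Rightarrow> (nat \<Rightarrow> real ^ 'n) \<Rightarrow> bool" where
  "lattice_frame P d p b \<longleftrightarrow>
     bij_betw (affine_param d p b) ({..<d} \<rightarrow>\<^sub>E UNIV) (affine hull P) \<and>
     bij_betw (affine_param d p b) ({..<d} \<rightarrow>\<^sub>E \<int>) (affine hull P \<inter> integer_points)"

text \<open>
  The volume is the \<open>d\<close>-dimensional Lebesgue measure in the coordinates of a lattice frame, where
  \<open>d\<close> is the dimension of \<open>P\<close>. Two frames differ by an element of \<open>GL\<^sub>d(\<int>)\<close> and an integer
  translation, so the choice of the frame is irrelevant. For \<open>d = 0\<close> the product measure
  is the unit mass at a point. The definition is meaningful for nonempty lattice polytopes only.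
\<close>

definition lattice_vol :: "(real ^ 'n::finite) set \<Rightarrow> real" where
  "lattice_vol P =
     (let d = nat (aff_dim P);
          (p, b) = (SOME (p, b). lattice_frame P d p b)
      in measure (Pi\<^sub>M {..<d} (\<lambda>_. lborel)) {c \<in> {..<d} \<rightarrow>\<^sub>E UNIV. affine_param d p b c \<in> P})"

definition surface_vol :: "(real ^ 'n::finite) set \<Rightarrow> real" where
  "surface_vol P = (\<Sum>F\<in>{F. F facet_of P}. lattice_vol F)"

end

theory Submission
  imports Defs
begin

text \<open>
  Let \<open>D\<close> be the set of right vertices that lie in a summand with \<open>k\<^sub>j > 0\<close>. The polytope \<open>Q\<close> is cut out
  by the inequalities \<open>(\<Sum>i\<in>A. \<bar>x\<^sub>i\<bar>) \<le> f A\<close>, where \<open>f A\<close> is the sum of the \<open>k\<^sub>j\<close> with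
  \<open>I\<^sub>j \<inter> A \<noteq> {}\<close>, so it consists of \<open>2\<^sup>d\<close> reflected copies of a polymatroid \<open>T\<close>. Let \<open>F\<^sub>I\<close> be the face
  of \<open>T\<close> on which the inequality of \<open>I\<close> is tight. The surface volume of \<open>Q\<close> is \<open>2\<^sup>d\<close> times the sum of
  the lattice volumes of the \<open>F\<^sub>I\<close>, and these volumes are determined by three relations:

  \<^item> \<open>F\<^sub>I\<close> is the product of a base polytope on \<open>I\<close> and a polymatroid on \<open>D - I\<close>;
  \<^item> deleting the coordinate \<open>i\<close> maps the faces \<open>F\<^sub>I\<close> with \<open>i \<in> I\<close> onto a dissection of the
    polymatroid on \<open>D - {i}\<close>;
  \<^item> \<open>d\<close> times the volume of \<open>T\<close> is the sum of \<open>f I\<close> times the volume of \<open>F\<^sub>I\<close> (integrate the coordinate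
    \<open>x\<^sub>i\<close> over the faces with \<open>i \<in> I\<close> and sum over \<open>i\<close>).

  The sums of \<open>\<Prod>j. k\<^sub>j ^ a\<^sub>j / a\<^sub>j!\<close> over draconian sequences satisfy the same relations: a sequence with
  \<open>\<bar>a\<bar> = d - 1\<close> belongs to the \<open>I\<close> that is the complement of the neighbourhood of the largest
  set on which the draconian inequality is tight.
\<close>

section \<open>Unimodular maps preserve Lebesgue measure\<close>

text \<open>The rule that assigns a set \<open>I\<close> to a sequence of sum \<open>d - 1\<close>
  is suggested by differentiation: as \<open>k j\<close> grows, exactly those faces move whose
  \<open>I\<close> meets \<open>N j\<close>, while on monomials the derivative lowers entry
  \<open>j\<close>. So \<open>I\<close> should meet \<open>N j\<close> exactly when entry
  \<open>j\<close> can be raised, which means that \<open>j\<close> lies in no tight set. Two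
  obstacles shape the proof. The lattice volume of a facet refers to an arbitrary lattice frame,
  whereas each relation needs coordinates of its own. They are reconciled by one fact: an affine
  bijection that matches the integer points preserves Lebesgue measure. A tiling argument and the
  uniqueness of Haar measure prove it, without determinants. The other obstacle is that an
  inequality may be redundant, with a tight face of too small a dimension. Which inequalities define
  facets is never decided combinatorially: in the coordinates of its hyperplane such a face has
  measure 0, so the sums run over all nonempty \<open>I\<close>.\<close>

abbreviation PiL :: "'a set \<Rightarrow> ('a \<Rightarrow> real) measure" where
  "PiL A \<equiv> Pi\<^sub>M A (\<lambda>_. lborel)"

interpretation PiL: product_sigma_finite "\<lambda>_. lborel :: real measure"
  by unfold_locales

lemma PiL_translation:
  assumes "finite A"
  shows "distr (PiL A) (PiL A) (\<lambda>x. \<lambda>i\<in>A. x i + v i) = PiL A"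
proof (rule PiL.PiM_eqI[OF assms])
  fix E :: "'a \<Rightarrow> real set"
  assume "\<And>i. i \<in> A \<Longrightarrow> E i \<in> sets lborel"
  then have E: "\<And>i. i \<in> A \<Longrightarrow> E i \<in> sets borel" by simp
  have m: "(\<lambda>x. \<lambda>i\<in>A. x i + v i) \<in> PiL A \<rightarrow>\<^sub>M PiL A"
    by (rule measurable_restrict) simp
  have pre: "(\<lambda>x. \<lambda>i\<in>A. x i + v i) -` Pi\<^sub>E A E \<inter> space (PiL A)
      = Pi\<^sub>E A (\<lambda>i. ((+) (v i)) -` E i)"
    by (auto simp: space_PiM PiE_iff add.commute)
  have mE: "((+) (v i)) -` E i \<in> sets borel" if "i \<in> A" for i
    using measurable_sets[of "(+) (v i)" borel borel "E i"] E[OF that] by simp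
  have e: "emeasure lborel (((+) (v i)) -` E i) = emeasure lborel (E i)" if "i \<in> A" for i
  proof -
    have "emeasure lborel (E i) = emeasure (distr lborel borel ((+) (v i))) (E i)"
      by (simp add: lborel_distr_plus)
    also have "\<dots> = emeasure lborel (((+) (v i)) -` E i)"
      using E[OF that] by (subst emeasure_distr) auto
    finally show ?thesis by simp
  qed
  have "emeasure (distr (PiL A) (PiL A) (\<lambda>x. \<lambda>i\<in>A. x i + v i)) (Pi\<^sub>E A E)
      = emeasure (PiL A) (Pi\<^sub>E A (\<lambda>i. ((+) (v i)) -` E i))"
    using E assms by (subst emeasure_distr[OF m]) (auto simp: pre intro!: sets_PiM_I_finite)
  also have "\<dots> = (\<Prod>i\<in>A. emeasure lborel (((+) (v i)) -` E i))"
    using assms mE by (intro PiL.emeasure_PiM) auto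
  also have "\<dots> = (\<Prod>i\<in>A. emeasure lborel (E i))"
    by (intro prod.cong) (auto simp: e)
  finally show "emeasure (distr (PiL A) (PiL A) (\<lambda>x. \<lambda>i\<in>A. x i + v i)) (Pi\<^sub>E A E)
      = (\<Prod>i\<in>A. emeasure lborel (E i))" .
qed simp

lemma nn_integral_PiL_translation:
  assumes "finite A" "f \<in> borel_measurable (PiL A)"
  shows "(\<integral>\<^sup>+x. f (\<lambda>i\<in>A. x i + v i) \<partial>PiL A) = (\<integral>\<^sup>+x. f x \<partial>PiL A)"
proof -
  have m: "(\<lambda>x. \<lambda>i\<in>A. x i + v i) \<in> PiL A \<rightarrow>\<^sub>M PiL A"
    by (rule measurable_restrict) simp
  have "(\<integral>\<^sup>+x. f x \<partial>PiL A) = (\<integral>\<^sup>+x. f x \<partial>distr (PiL A) (PiL A) (\<lambda>x. \<lambda>i\<in>A. x i + v i))"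
    by (simp only: PiL_translation[OF assms(1)])
  also have "\<dots> = (\<integral>\<^sup>+x. f (\<lambda>i\<in>A. x i + v i) \<partial>PiL A)"
    using assms(2) by (subst nn_integral_distr[OF m]) auto
  finally show ?thesis by simp
qed

lemma emeasure_PiL_translation:
  assumes "finite A" "X \<in> sets (PiL A)"
  shows "emeasure (PiL A) {x \<in> A \<rightarrow>\<^sub>E UNIV. (\<lambda>i\<in>A. x i + v i) \<in> X} = emeasure (PiL A) X"
proof -
  have m: "(\<lambda>x. \<lambda>i\<in>A. x i + v i) \<in> PiL A \<rightarrow>\<^sub>M PiL A"
    by (rule measurable_restrict) simp
  have "emeasure (PiL A) X = emeasure (distr (PiL A) (PiL A) (\<lambda>x. \<lambda>i\<in>A. x i + v i)) X"
    by (simp only: PiL_translation[OF assms(1)])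
  also have "\<dots> = emeasure (PiL A) ((\<lambda>x. \<lambda>i\<in>A. x i + v i) -` X \<inter> space (PiL A))"
    by (rule emeasure_distr[OF m assms(2)])
  also have "(\<lambda>x. \<lambda>i\<in>A. x i + v i) -` X \<inter> space (PiL A)
      = {x \<in> A \<rightarrow>\<^sub>E UNIV. (\<lambda>i\<in>A. x i + v i) \<in> X}"
    by (auto simp: space_PiM)
  finally show ?thesis by simp
qed

lemma countable_PiE_Ints: "finite A \<Longrightarrow> countable (A \<rightarrow>\<^sub>E (\<int> :: real set))"
proof (rule countable_PiE)
  show "countable (\<int> :: real set)" unfolding Ints_def by simp
qed

lemma floor_unique_Ints:
  fixes t z :: real
  assumes "z \<in> \<int>" "t - z \<in> {0..<1}"
  shows "z = of_int \<lfloor>t\<rfloor>"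
proof -
  obtain n where n: "z = of_int n" using assms(1) by (auto elim: Ints_cases)
  have "\<lfloor>t\<rfloor> = n" using assms(2) unfolding n by (intro floor_unique) auto
  then show ?thesis using n by simp
qed

text \<open>Two fundamental domains of one lattice have the same measure. The preimage of the
  half-open unit cube of \<open>B\<close> is cut along the integer cubes of \<open>A\<close>.
  Translation by \<open>- z\<close> moves the piece \<open>S z\<close> into the unit cube of
  \<open>A\<close>, where it becomes \<open>S' z\<close>; the sets \<open>S' z\<close> tile that
  cube because \<open>L z\<close> runs over every integer point of the target exactly once.\<close>

lemma unimodular_unit_cube:
  fixes L :: "('a \<Rightarrow> real) \<Rightarrow> ('b \<Rightarrow> real)"
  assumes fin: "finite A" "finite B"
    and meas: "L \<in> PiL A \<rightarrow>\<^sub>M PiL B"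
    and add: "\<And>x y. x \<in> A \<rightarrow>\<^sub>E UNIV \<Longrightarrow> y \<in> A \<rightarrow>\<^sub>E UNIV \<Longrightarrow>
                L (\<lambda>i\<in>A. x i + y i) = (\<lambda>i\<in>B. L x i + L y i)"
    and ints: "bij_betw L (A \<rightarrow>\<^sub>E \<int>) (B \<rightarrow>\<^sub>E \<int>)"
  shows "emeasure (PiL A) {x \<in> A \<rightarrow>\<^sub>E UNIV. L x \<in> B \<rightarrow>\<^sub>E {0..<1}} = 1"
proof -
  let ?ZA = "A \<rightarrow>\<^sub>E (\<int> :: real set)"
  define S where "S z = {x \<in> A \<rightarrow>\<^sub>E UNIV. L x \<in> B \<rightarrow>\<^sub>E {0..<1} \<and> (\<forall>i\<in>A. x i - z i \<in> {0..<1})}"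
    for z :: "'a \<Rightarrow> real"
  define S' where "S' z = {x \<in> A \<rightarrow>\<^sub>E {0..<1}. \<forall>i\<in>B. L x i + L z i \<in> {0..<1}}"
    for z :: "'a \<Rightarrow> real"
  have [measurable (raw)]: "(\<lambda>x. L x i) \<in> borel_measurable (PiL A)" if "i \<in> B" for i
    using measurable_compose[OF meas measurable_component_singleton[OF that]] by simp
  have [measurable (raw)]: "(\<lambda>x. x i) \<in> borel_measurable (PiL A)" if "i \<in> A" for i
    using measurable_component_singleton[OF that, of "\<lambda>_. lborel"] by simp
  have LB: "L x \<in> B \<rightarrow>\<^sub>E UNIV" if "x \<in> A \<rightarrow>\<^sub>E UNIV" for x
    using measurable_space[OF meas, of x] that by (simp add: space_PiM)
  have S[measurable]: "S z \<in> sets (PiL A)" for z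
  proof -
    have "S z = {x \<in> space (PiL A). (\<forall>i\<in>B. L x i \<in> {0..<1}) \<and> (\<forall>i\<in>A. x i - z i \<in> {0..<1})}"
      using LB by (auto simp: S_def space_PiM PiE_iff)
    also have "\<dots> \<in> sets (PiL A)"
      using fin by measurable
    finally show ?thesis .
  qed
  have S'[measurable]: "S' z \<in> sets (PiL A)" for z
  proof -
    have "S' z = {x \<in> space (PiL A). (\<forall>i\<in>B. L x i + L z i \<in> {0..<1}) \<and> (\<forall>i\<in>A. x i \<in> {0..<1})}"
      by (auto simp: S'_def space_PiM PiE_iff)
    also have "\<dots> \<in> sets (PiL A)"
      using fin by measurable
    finally show ?thesis .
  qed
  have "emeasure (PiL A) (S' z) = emeasure (PiL A) (S z)" if "z \<in> ?ZA" for z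
  proof -
    have z: "z \<in> A \<rightarrow>\<^sub>E UNIV" using that by auto
    have "{x \<in> A \<rightarrow>\<^sub>E UNIV. (\<lambda>i\<in>A. x i + z i) \<in> S z} = S' z"
      using z LB by (auto simp: S_def S'_def PiE_iff add)
    then show ?thesis using emeasure_PiL_translation[OF fin(1) S, of z z] by simp
  qed note eq = this
  have disjS: "disjoint_family_on S ?ZA"
  proof (unfold disjoint_family_on_def, intro ballI impI)
    fix z z' assume zz: "z \<in> ?ZA" "z' \<in> ?ZA" "z \<noteq> z'"
    have False if "x \<in> S z" "x \<in> S z'" for x
    proof -
      have "z i = z' i" if "i \<in> A" for i
        using floor_unique_Ints[of "z i" "x i"] floor_unique_Ints[of "z' i" "x i"]
          zz \<open>x \<in> S z\<close> \<open>x \<in> S z'\<close> that by (auto simp: S_def PiE_iff)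
      then have "z = z'" using zz(1,2) by (intro PiE_ext) auto
      then show False using zz by simp
    qed
    then show "S z \<inter> S z' = {}" by auto
  qed
  have disjS': "disjoint_family_on S' ?ZA"
  proof (unfold disjoint_family_on_def, intro ballI impI)
    fix z z' assume zz: "z \<in> ?ZA" "z' \<in> ?ZA" "z \<noteq> z'"
    have LZ: "L z \<in> B \<rightarrow>\<^sub>E \<int>" "L z' \<in> B \<rightarrow>\<^sub>E \<int>"
      using ints zz by (auto simp: bij_betw_def)
    have False if "x \<in> S' z" "x \<in> S' z'" for x
    proof -
      have "L z i = L z' i" if "i \<in> B" for i
      proof -
        have "- L z i \<in> \<int>" "- L z' i \<in> \<int>" using LZ that by auto
        moreover have "L x i - (- L z i) \<in> {0..<1}" "L x i - (- L z' i) \<in> {0..<1}"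
          using \<open>x \<in> S' z\<close> \<open>x \<in> S' z'\<close> that by (auto simp: S'_def)
        ultimately have "- L z i = - L z' i"
          using floor_unique_Ints by metis
        then show ?thesis by simp
      qed
      then have "L z = L z'" using LZ by (intro PiE_ext[of _ B "\<lambda>_. \<int>"]) auto
      then have "z = z'" using ints zz by (auto simp: bij_betw_def inj_on_def)
      then show False using zz by simp
    qed
    then show "S' z \<inter> S' z' = {}" by auto
  qed
  have US: "{x \<in> A \<rightarrow>\<^sub>E UNIV. L x \<in> B \<rightarrow>\<^sub>E {0..<1}} = (\<Union>z\<in>?ZA. S z)"
  proof (intro equalityI subsetI)
    fix x assume x: "x \<in> {x \<in> A \<rightarrow>\<^sub>E UNIV. L x \<in> B \<rightarrow>\<^sub>E {0..<1}}"
    have "x \<in> S (\<lambda>i\<in>A. of_int \<lfloor>x i\<rfloor>)"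
    proof -
      have "x i - of_int \<lfloor>x i\<rfloor> \<in> {0..<1}" for i using frac_ge_0 frac_lt_1 by (simp add: frac_def)
      then show ?thesis using x by (auto simp: S_def)
    qed
    moreover have "(\<lambda>i\<in>A. of_int \<lfloor>x i\<rfloor>) \<in> ?ZA" by auto
    ultimately show "x \<in> (\<Union>z\<in>?ZA. S z)" by blast
  qed (auto simp: S_def)
  have US': "A \<rightarrow>\<^sub>E {0..<1} = (\<Union>z\<in>?ZA. S' z)"
  proof (intro equalityI subsetI)
    fix x :: "'a \<Rightarrow> real" assume x: "x \<in> A \<rightarrow>\<^sub>E {0..<1}"
    \<comment> \<open>Surjectivity on integer points supplies the lattice vector whose image cancels
      the integer parts of \<open>L x\<close>.\<close>
    have "(\<lambda>i\<in>B. - of_int \<lfloor>L x i\<rfloor>) \<in> L ` ?ZA"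
      unfolding bij_betw_imp_surj_on[OF ints] by auto
    then obtain z where z: "z \<in> ?ZA" "L z = (\<lambda>i\<in>B. - of_int \<lfloor>L x i\<rfloor>)"
      by (elim imageE) simp
    have "L x i - of_int \<lfloor>L x i\<rfloor> \<in> {0..<1}" for i using frac_ge_0 frac_lt_1 by (simp add: frac_def)
    then have "x \<in> S' z" using x z(2) by (auto simp: S'_def)
    then show "x \<in> (\<Union>z\<in>?ZA. S' z)" using z by blast
  qed (auto simp: S'_def)
  have "emeasure (PiL A) (\<Union>z\<in>?ZA. S z) = (\<integral>\<^sup>+z. emeasure (PiL A) (S z) \<partial>count_space ?ZA)"
    by (rule emeasure_UN_countable) (auto simp: disjS countable_PiE_Ints fin)
  also have "\<dots> = (\<integral>\<^sup>+z. emeasure (PiL A) (S' z) \<partial>count_space ?ZA)"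
    by (rule nn_integral_cong) (simp add: eq)
  also have "\<dots> = emeasure (PiL A) (\<Union>z\<in>?ZA. S' z)"
    by (rule emeasure_UN_countable[symmetric]) (auto simp: disjS' countable_PiE_Ints fin)
  also have "\<dots> = emeasure (PiL A) (A \<rightarrow>\<^sub>E {0..<1})" using US' by simp
  also have "\<dots> = 1" using fin by (subst PiL.emeasure_PiM) auto
  finally show ?thesis using US by simp
qed

text \<open>Uniqueness of Haar measure, normalised by the unit cube.\<close>
lemma distr_unimodular_linear:
  fixes L :: "('a \<Rightarrow> real) \<Rightarrow> ('b \<Rightarrow> real)"
  assumes fin: "finite A" "finite B"
    and meas: "L \<in> PiL A \<rightarrow>\<^sub>M PiL B"
    and add: "\<And>x y. x \<in> A \<rightarrow>\<^sub>E UNIV \<Longrightarrow> y \<in> A \<rightarrow>\<^sub>E UNIV \<Longrightarrow>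
                L (\<lambda>i\<in>A. x i + y i) = (\<lambda>i\<in>B. L x i + L y i)"
    and surj: "L ` (A \<rightarrow>\<^sub>E UNIV) = B \<rightarrow>\<^sub>E UNIV"
    and ints: "bij_betw L (A \<rightarrow>\<^sub>E \<int>) (B \<rightarrow>\<^sub>E \<int>)"
  shows "distr (PiL A) (PiL B) L = PiL B"
proof -
  define \<nu> where "\<nu> = distr (PiL A) (PiL B) L"
  have sets_nu[measurable_cong, simp]: "sets \<nu> = sets (PiL B)" by (simp add: \<nu>_def)
  have space_nu[simp]: "space \<nu> = B \<rightarrow>\<^sub>E UNIV" by (simp add: \<nu>_def space_PiM)
  have trans: "(\<integral>\<^sup>+y. f (\<lambda>i\<in>B. y i + v i) \<partial>\<nu>) = (\<integral>\<^sup>+y. f y \<partial>\<nu>)"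
    if f[measurable]: "f \<in> borel_measurable (PiL B)" for f and v :: "'b \<Rightarrow> real"
  proof -
    have "(\<lambda>i\<in>B. v i) \<in> L ` (A \<rightarrow>\<^sub>E UNIV)" unfolding surj by auto
    then obtain u where u: "u \<in> A \<rightarrow>\<^sub>E UNIV" "L u = (\<lambda>i\<in>B. v i)"
      by (elim imageE) simp
    have m[measurable]: "(\<lambda>y. \<lambda>i\<in>B. y i + v i) \<in> PiL B \<rightarrow>\<^sub>M PiL B"
      by (rule measurable_restrict) simp
    have "(\<integral>\<^sup>+y. f (\<lambda>i\<in>B. y i + v i) \<partial>\<nu>) = (\<integral>\<^sup>+x. f (\<lambda>i\<in>B. L x i + v i) \<partial>PiL A)"
      unfolding \<nu>_def by (subst nn_integral_distr[OF meas]) auto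
    also have "\<dots> = (\<integral>\<^sup>+x. f (L (\<lambda>i\<in>A. x i + u i)) \<partial>PiL A)"
    proof (rule nn_integral_cong)
      fix x assume "x \<in> space (PiL A)"
      then have "L (\<lambda>i\<in>A. x i + u i) = (\<lambda>i\<in>B. L x i + v i)"
        using u by (subst add) (auto simp: space_PiM)
      then show "f (\<lambda>i\<in>B. L x i + v i) = f (L (\<lambda>i\<in>A. x i + u i))" by simp
    qed
    also have "\<dots> = (\<integral>\<^sup>+x. f (L x) \<partial>PiL A)"
      by (rule nn_integral_PiL_translation[OF fin(1) measurable_compose[OF meas f]])
    also have "\<dots> = (\<integral>\<^sup>+y. f y \<partial>\<nu>)"
      unfolding \<nu>_def by (subst nn_integral_distr[OF meas]) auto
    finally show ?thesis .
  qed
  define C where "C = (B \<rightarrow>\<^sub>E {0..<1::real})"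
  have C[measurable]: "C \<in> sets (PiL B)"
    unfolding C_def using fin by (intro sets_PiM_I_finite) auto
  have nuC: "emeasure \<nu> C = 1"
  proof -
    have "L -` C \<inter> space (PiL A) = {x \<in> A \<rightarrow>\<^sub>E UNIV. L x \<in> B \<rightarrow>\<^sub>E {0..<1}}"
      by (auto simp: C_def space_PiM)
    then have "emeasure \<nu> C = emeasure (PiL A) {x \<in> A \<rightarrow>\<^sub>E UNIV. L x \<in> B \<rightarrow>\<^sub>E {0..<1}}"
      unfolding \<nu>_def emeasure_distr[OF meas C] by (rule arg_cong)
    also have "\<dots> = 1"
    proof (rule unimodular_unit_cube[OF fin meas])
      show "L (\<lambda>i\<in>A. x i + y i) = (\<lambda>i\<in>B. L x i + L y i)"
        if "x \<in> A \<rightarrow>\<^sub>E UNIV" "y \<in> A \<rightarrow>\<^sub>E UNIV" for x y by (rule add[OF that])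
    qed (rule ints)
    finally show ?thesis .
  qed
  define Cz where "Cz z = {y \<in> B \<rightarrow>\<^sub>E UNIV. (\<lambda>i\<in>B. y i + z i) \<in> C}" for z :: "'b \<Rightarrow> real"
  have mtr[measurable]: "(\<lambda>y. \<lambda>i\<in>B. y i + v i) \<in> PiL B \<rightarrow>\<^sub>M PiL B" for v :: "'b \<Rightarrow> real"
    by (rule measurable_restrict) simp
  have Cz[measurable]: "Cz z \<in> sets (PiL B)" for z
  proof -
    have "(\<lambda>y. \<lambda>i\<in>B. y i + z i) -` C \<inter> space (PiL B) = Cz z"
      unfolding Cz_def space_PiM by auto
    then show ?thesis using measurable_sets[OF mtr C, of z] by simp
  qed
  have nuCz: "emeasure \<nu> (Cz z) = 1" for z
  proof -
    have "emeasure \<nu> (Cz z) = (\<integral>\<^sup>+y. indicator (Cz z) y \<partial>\<nu>)" by simp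
    also have "\<dots> = (\<integral>\<^sup>+y. indicator C (\<lambda>i\<in>B. y i + z i) \<partial>\<nu>)"
      by (rule nn_integral_cong) (auto simp: Cz_def indicator_def)
    also have "\<dots> = (\<integral>\<^sup>+y. indicator C y \<partial>\<nu>)" by (rule trans) simp
    also have "\<dots> = 1" using nuC by simp
    finally show ?thesis .
  qed
  \<comment> \<open>The integer translates of the cube \<open>C\<close> cover the space and have
    measure 1 under \<nu>. The exchange of integrals below rests on this.\<close>
  interpret nu: sigma_finite_measure \<nu>
  proof
    let ?F = "Cz ` (B \<rightarrow>\<^sub>E \<int>)"
    have "\<Union>?F = space \<nu>"
    proof (intro equalityI subsetI)
      fix y assume y: "y \<in> space \<nu>"
      have "y i - of_int \<lfloor>y i\<rfloor> \<in> {0..<1}" for i using frac_ge_0 frac_lt_1 by (simp add: frac_def)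
      then have "y \<in> Cz (\<lambda>i\<in>B. - of_int \<lfloor>y i\<rfloor>)" using y by (auto simp: Cz_def C_def)
      moreover have "(\<lambda>i\<in>B. - of_int \<lfloor>y i\<rfloor>) \<in> B \<rightarrow>\<^sub>E (\<int> :: real set)" by auto
      ultimately show "y \<in> \<Union>?F" by blast
    qed (auto simp: Cz_def)
    moreover have "countable ?F" using countable_PiE_Ints[OF fin(2)] by simp
    moreover have "?F \<subseteq> sets \<nu>" by auto
    moreover have "\<forall>a\<in>?F. emeasure \<nu> a \<noteq> \<infinity>" using nuCz by auto
    ultimately show "\<exists>F. countable F \<and> F \<subseteq> sets \<nu> \<and> \<Union>F = space \<nu> \<and> (\<forall>a\<in>F. emeasure \<nu> a \<noteq> \<infinity>)"
      by blast
  qed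
  interpret mu: sigma_finite_measure "PiL B" by (rule PiL.sigma_finite[OF fin(2)])
  interpret pair: pair_sigma_finite "PiL B" \<nu> ..
  show ?thesis
  proof (rule measure_eqI)
    fix X assume "X \<in> sets (distr (PiL A) (PiL B) L)"
    then have X[measurable]: "X \<in> sets (PiL B)" by simp
    have mp[measurable]: "(\<lambda>p. \<lambda>i\<in>B. fst p i + snd p i) \<in> PiL B \<Otimes>\<^sub>M PiL B \<rightarrow>\<^sub>M PiL B"
      by (rule measurable_restrict) measurable
    have mm[measurable]: "(\<lambda>p. \<lambda>i\<in>B. snd p i - fst p i) \<in> PiL B \<Otimes>\<^sub>M PiL B \<rightarrow>\<^sub>M PiL B"
      by (rule measurable_restrict) measurable
    have sp: "sets (PiL B \<Otimes>\<^sub>M \<nu>) = sets (PiL B \<Otimes>\<^sub>M PiL B)"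
      by (rule sets_pair_measure_cong) auto
    \<comment> \<open>The double integral of the indicator of \<open>X\<close> at
      \<open>x + y\<close> times the indicator of \<open>C\<close> at \<open>y\<close> is evaluated
      in both orders. Invariance of Lebesgue measure yields the measure of \<open>X\<close> times
      that of \<open>C\<close> under \<nu>; invariance of \<nu> yields the \<nu>-measure of
      \<open>X\<close> times the Lebesgue measure of a reflected translate of \<open>C\<close>. Both
      cube factors are 1.\<close>
    have "emeasure (PiL B) X = (\<integral>\<^sup>+y. indicator C y * emeasure (PiL B) X \<partial>\<nu>)"
      using nuC by (subst nn_integral_multc) auto
    also have "\<dots> = (\<integral>\<^sup>+y. (\<integral>\<^sup>+x. indicator X (\<lambda>i\<in>B. x i + y i) * indicator C y \<partial>PiL B) \<partial>\<nu>)"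
    proof (rule nn_integral_cong)
      fix y
      have "emeasure (PiL B) X = (\<integral>\<^sup>+x. indicator X x \<partial>PiL B)" by simp
      also have "\<dots> = (\<integral>\<^sup>+x. indicator X (\<lambda>i\<in>B. x i + y i) \<partial>PiL B)"
        by (rule nn_integral_PiL_translation[symmetric]) (use fin in auto)
      finally show "indicator C y * emeasure (PiL B) X
          = (\<integral>\<^sup>+x. indicator X (\<lambda>i\<in>B. x i + y i) * indicator C y \<partial>PiL B)"
        by (subst nn_integral_multc) (auto simp: mult.commute)
    qed
    also have "\<dots> = (\<integral>\<^sup>+x. (\<integral>\<^sup>+y. indicator X (\<lambda>i\<in>B. x i + y i) * indicator C y \<partial>\<nu>) \<partial>PiL B)"
    proof (rule pair.Fubini')
      have "(\<lambda>p. indicator X (\<lambda>i\<in>B. fst p i + snd p i) * indicator C (snd p) :: ennreal)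
          \<in> borel_measurable (PiL B \<Otimes>\<^sub>M PiL B)" by measurable
      then show "(\<lambda>(x, y). indicator X (\<lambda>i\<in>B. x i + y i) * indicator C y :: ennreal)
          \<in> borel_measurable (PiL B \<Otimes>\<^sub>M \<nu>)"
        by (simp add: case_prod_beta' measurable_cong_sets[OF sp refl])
    qed
    also have "\<dots> = (\<integral>\<^sup>+x. (\<integral>\<^sup>+y. indicator X y * indicator C (\<lambda>i\<in>B. y i - x i) \<partial>\<nu>) \<partial>PiL B)"
    proof (rule nn_integral_cong)
      fix x assume x: "x \<in> space (PiL B)"
      have [measurable]: "(\<lambda>y. \<lambda>i\<in>B. y i - x i) \<in> PiL B \<rightarrow>\<^sub>M PiL B"
        by (rule measurable_restrict) simp
      have "(\<integral>\<^sup>+y. indicator X y * indicator C (\<lambda>i\<in>B. y i - x i) \<partial>\<nu>)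
         = (\<integral>\<^sup>+y. indicator X (\<lambda>i\<in>B. y i + x i) * indicator C (\<lambda>i\<in>B. (\<lambda>i\<in>B. y i + x i) i - x i) \<partial>\<nu>)"
        by (rule trans[symmetric]) measurable
      also have "\<dots> = (\<integral>\<^sup>+y. indicator X (\<lambda>i\<in>B. x i + y i) * indicator C y \<partial>\<nu>)"
      proof (rule nn_integral_cong)
        fix y assume "y \<in> space \<nu>"
        then have "(\<lambda>i\<in>B. (\<lambda>i\<in>B. y i + x i) i - x i) = y"
          by (auto simp: fun_eq_iff PiE_iff extensional_def)
        moreover have "(\<lambda>i\<in>B. x i + y i) = (\<lambda>i\<in>B. y i + x i)" by (simp add: add.commute)
        ultimately show "indicator X (\<lambda>i\<in>B. y i + x i) * indicator C (\<lambda>i\<in>B. (\<lambda>i\<in>B. y i + x i) i - x i)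
          = (indicator X (\<lambda>i\<in>B. x i + y i) * indicator C y :: ennreal)" by (simp only:)
      qed
      finally show "(\<integral>\<^sup>+y. indicator X (\<lambda>i\<in>B. x i + y i) * indicator C y \<partial>\<nu>)
        = (\<integral>\<^sup>+y. indicator X y * indicator C (\<lambda>i\<in>B. y i - x i) \<partial>\<nu>)" by simp
    qed
    also have "\<dots> = (\<integral>\<^sup>+y. (\<integral>\<^sup>+x. indicator X y * indicator C (\<lambda>i\<in>B. y i - x i) \<partial>PiL B) \<partial>\<nu>)"
    proof (rule pair.Fubini'[symmetric])
      have "(\<lambda>p. indicator X (snd p) * indicator C (\<lambda>i\<in>B. snd p i - fst p i) :: ennreal)
          \<in> borel_measurable (PiL B \<Otimes>\<^sub>M PiL B)" by measurable
      then show "(\<lambda>(x, y). indicator X y * indicator C (\<lambda>i\<in>B. y i - x i) :: ennreal)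
          \<in> borel_measurable (PiL B \<Otimes>\<^sub>M \<nu>)"
        by (simp add: case_prod_beta' measurable_cong_sets[OF sp refl])
    qed
    also have "\<dots> = (\<integral>\<^sup>+y. indicator X y \<partial>\<nu>)"
    proof (rule nn_integral_cong)
      fix y assume y: "y \<in> space \<nu>"
      have [measurable]: "(\<lambda>x. \<lambda>i\<in>B. y i - x i) \<in> PiL B \<rightarrow>\<^sub>M PiL B"
        by (rule measurable_restrict) simp
      have box: "(B \<rightarrow>\<^sub>E UNIV) \<inter> (\<lambda>x. \<lambda>i\<in>B. y i - x i) -` C = (\<Pi>\<^sub>E i\<in>B. {y i - 1<..y i})"
      proof -
        have "y i - t \<in> {0..<1} \<longleftrightarrow> t \<in> {y i - 1<..y i}" for i t by auto
        then show ?thesis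
          by (auto simp: C_def PiE_iff simp del: atLeastLessThan_iff greaterThanAtMost_iff)
      qed
      have "(\<integral>\<^sup>+x. indicator C (\<lambda>i\<in>B. y i - x i) \<partial>PiL B)
          = (\<integral>\<^sup>+x. indicator (\<Pi>\<^sub>E i\<in>B. {y i - 1<..y i}) x \<partial>PiL B)"
        by (rule nn_integral_cong) (auto simp: box[symmetric] indicator_def space_PiM)
      also have "\<dots> = emeasure (PiL B) (\<Pi>\<^sub>E i\<in>B. {y i - 1<..y i})"
        using fin by (intro nn_integral_indicator sets_PiM_I_finite) auto
      also have "\<dots> = 1" using fin by (subst PiL.emeasure_PiM) auto
      finally show "(\<integral>\<^sup>+x. indicator X y * indicator C (\<lambda>i\<in>B. y i - x i) \<partial>PiL B) = indicator X y"
        by (subst nn_integral_cmult) auto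
    qed
    also have "\<dots> = emeasure \<nu> X" by simp
    finally show "emeasure (distr (PiL A) (PiL B) L) X = emeasure (PiL B) X"
      by (simp add: \<nu>_def)
  qed simp
qed

text \<open>The affine hypothesis compares values of \<open>\<phi>\<close> only, so that no linear
  part has to be named. The image of the origin is an integer point; subtracting it keeps the
  bijection of integer points and leaves the linear case.\<close>

lemma distr_unimodular:
  fixes \<phi> :: "('a \<Rightarrow> real) \<Rightarrow> ('b \<Rightarrow> real)"
  assumes fin: "finite A" "finite B"
    and meas: "\<phi> \<in> PiL A \<rightarrow>\<^sub>M PiL B"
    and affine: "\<And>x y i. x \<in> A \<rightarrow>\<^sub>E UNIV \<Longrightarrow> y \<in> A \<rightarrow>\<^sub>E UNIV \<Longrightarrow> i \<in> B \<Longrightarrow>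
                \<phi> (\<lambda>i\<in>A. x i + y i) i + \<phi> (\<lambda>i\<in>A. 0) i = \<phi> x i + \<phi> y i"
    and surj: "\<phi> ` (A \<rightarrow>\<^sub>E UNIV) = B \<rightarrow>\<^sub>E UNIV"
    and ints: "bij_betw \<phi> (A \<rightarrow>\<^sub>E \<int>) (B \<rightarrow>\<^sub>E \<int>)"
  shows "distr (PiL A) (PiL B) \<phi> = PiL B"
proof -
  define p where "p = \<phi> (\<lambda>i\<in>A. 0)"
  have "(\<lambda>i\<in>A. 0) \<in> A \<rightarrow>\<^sub>E (\<int> :: real set)" by auto
  then have p: "p \<in> B \<rightarrow>\<^sub>E \<int>" using ints unfolding p_def bij_betw_def by blast
  define \<tau> where "\<tau> s x = (\<lambda>i\<in>B. x i + s * p i)" for s and x :: "'b \<Rightarrow> real"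
  define L where "L = \<tau> (- 1) \<circ> \<phi>"
  have \<tau>m[measurable]: "\<tau> s \<in> PiL B \<rightarrow>\<^sub>M PiL B" for s
    unfolding \<tau>_def by (rule measurable_restrict) simp
  have \<tau>inv: "\<tau> 1 (\<tau> (-1) x) = x" "\<tau> (-1) (\<tau> 1 x) = x" if "x \<in> B \<rightarrow>\<^sub>E UNIV" for x
    using that by (auto simp: \<tau>_def fun_eq_iff PiE_iff extensional_def)
  have \<tau>U: "bij_betw (\<tau> (-1)) (B \<rightarrow>\<^sub>E UNIV) (B \<rightarrow>\<^sub>E UNIV)"
    by (rule bij_betw_byWitness[of _ "\<tau> 1"]) (auto simp: \<tau>inv, auto simp: \<tau>_def)
  have ZU: "x \<in> B \<rightarrow>\<^sub>E UNIV" if "x \<in> B \<rightarrow>\<^sub>E \<int>" for x :: "'b \<Rightarrow> real" using that by auto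
  have \<tau>Z: "bij_betw (\<tau> (-1)) (B \<rightarrow>\<^sub>E \<int>) (B \<rightarrow>\<^sub>E \<int>)"
    using p
    by (intro bij_betw_byWitness[of _ "\<tau> 1"])
      (use \<tau>inv ZU in blast, use \<tau>inv ZU in blast, auto simp: \<tau>_def PiE_iff)
  have "distr (PiL A) (PiL B) L = PiL B"
  proof (rule distr_unimodular_linear[OF fin])
    show "L \<in> PiL A \<rightarrow>\<^sub>M PiL B" unfolding L_def using meas by (rule measurable_comp) simp
    show "L ` (A \<rightarrow>\<^sub>E UNIV) = B \<rightarrow>\<^sub>E UNIV"
      using \<tau>U surj unfolding L_def image_comp[symmetric] by (simp add: bij_betw_def)
    show "bij_betw L (A \<rightarrow>\<^sub>E \<int>) (B \<rightarrow>\<^sub>E \<int>)"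
      unfolding L_def by (rule bij_betw_trans[OF ints \<tau>Z])
    show "L (\<lambda>i\<in>A. x i + y i) = (\<lambda>i\<in>B. L x i + L y i)"
      if "x \<in> A \<rightarrow>\<^sub>E UNIV" "y \<in> A \<rightarrow>\<^sub>E UNIV" for x y
      using affine[OF that] by (auto simp: L_def \<tau>_def p_def fun_eq_iff algebra_simps)
  qed
  then have "PiL B = distr (distr (PiL A) (PiL B) L) (PiL B) (\<tau> 1)"
    using PiL_translation[OF fin(2), of p] by (simp add: \<tau>_def[abs_def])
  also have "\<dots> = distr (PiL A) (PiL B) (\<tau> 1 \<circ> L)"
    unfolding L_def using meas by (intro distr_distr) auto
  also have "\<dots> = distr (PiL A) (PiL B) \<phi>"
  proof (rule distr_cong)
    fix x assume "x \<in> space (PiL A)"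
    then have "\<phi> x \<in> B \<rightarrow>\<^sub>E UNIV" using surj by (auto simp: space_PiM)
    then show "(\<tau> 1 \<circ> L) x = \<phi> x" by (simp add: L_def \<tau>inv)
  qed auto
  finally show ?thesis by simp
qed

lemma emeasure_unimodular:
  fixes \<phi> :: "('a \<Rightarrow> real) \<Rightarrow> ('b \<Rightarrow> real)"
  assumes "distr (PiL A) (PiL B) \<phi> = PiL B" "\<phi> \<in> PiL A \<rightarrow>\<^sub>M PiL B" "X \<in> sets (PiL B)"
  shows "emeasure (PiL A) {x \<in> A \<rightarrow>\<^sub>E UNIV. \<phi> x \<in> X} = emeasure (PiL B) X"
proof -
  have "emeasure (PiL B) X = emeasure (distr (PiL A) (PiL B) \<phi>) X" using assms(1) by simp
  also have "\<dots> = emeasure (PiL A) (\<phi> -` X \<inter> space (PiL A))"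
    by (rule emeasure_distr[OF assms(2,3)])
  also have "\<phi> -` X \<inter> space (PiL A) = {x \<in> A \<rightarrow>\<^sub>E UNIV. \<phi> x \<in> X}"
    by (auto simp: space_PiM)
  finally show ?thesis by simp
qed

text \<open>A line in direction \<open>l\<close> meets the hyperplane in at most one point, because
  the coefficient of \<open>l\<close> is nonzero; Fubini in that direction gives measure 0.\<close>

lemma null_hyperplane_PiL:
  assumes fin: "finite A" and l: "l \<in> A" "\<alpha> l \<noteq> 0"
  shows "{x \<in> A \<rightarrow>\<^sub>E UNIV. (\<Sum>i\<in>A. \<alpha> i * x i) = \<beta>} \<in> null_sets (PiL A)"
proof -
  let ?H = "{x \<in> A \<rightarrow>\<^sub>E UNIV. (\<Sum>i\<in>A. \<alpha> i * x i) = \<beta>}"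
  define A' where "A' = A - {l}"
  have A: "A = insert l A'" "l \<notin> A'" "finite A'" using fin l by (auto simp: A'_def)
  have H: "?H \<in> sets (PiL A)"
  proof -
    have "?H = {x \<in> space (PiL A). (\<Sum>i\<in>A. \<alpha> i * x i) = \<beta>}" by (auto simp: space_PiM)
    also have "\<dots> \<in> sets (PiL A)" by measurable
    finally show ?thesis .
  qed
  have "emeasure (PiL A) ?H = (\<integral>\<^sup>+x. indicator ?H x \<partial>PiL A)" using H by simp
  also have "\<dots> = (\<integral>\<^sup>+x. (\<integral>\<^sup>+t. indicator ?H (x(l := t)) \<partial>lborel) \<partial>PiL A')"
    unfolding A(1) using A H by (intro PiL.product_nn_integral_insert) (auto simp: A(1)[symmetric])
  also have "\<dots> = (\<integral>\<^sup>+x. 0 \<partial>PiL A')"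
  proof (rule nn_integral_cong)
    fix x :: "'a \<Rightarrow> real"
    have s: "(\<Sum>i\<in>A. \<alpha> i * (x(l := t)) i) = \<alpha> l * t + (\<Sum>i\<in>A'. \<alpha> i * x i)" for t
      using A by (simp add: A(1)) (auto intro!: sum.cong)
    have "t = (\<beta> - (\<Sum>i\<in>A'. \<alpha> i * x i)) / \<alpha> l" if "x(l := t) \<in> ?H" for t
      using that s[of t] l(2) by (simp add: field_simps)
    then have "(\<integral>\<^sup>+t. indicator ?H (x(l := t)) \<partial>lborel)
        \<le> (\<integral>\<^sup>+t. indicator {(\<beta> - (\<Sum>i\<in>A'. \<alpha> i * x i)) / \<alpha> l} t \<partial>lborel)"
      by (intro nn_integral_mono) (metis (no_types, lifting) indicator_simps(1) indicator_simps(2) le_zero_eq linear singletonI)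
    also have "\<dots> = 0" by simp
    finally show "(\<integral>\<^sup>+t. indicator ?H (x(l := t)) \<partial>lborel) = 0" by simp
  qed
  finally show ?thesis using H by (auto simp: null_sets_def)
qed

section \<open>Draconian sequences and tight sets\<close>

locale hypergraph =
  fixes N :: "'j \<Rightarrow> 'n set" and k :: "'j \<Rightarrow> nat"
begin

text \<open>Sequences are 0 off \<open>L\<close>, not \<open>undefined\<close>, so that a sequence
  on a subfamily of the hyperedges can be added to one on \<open>L\<close>. Neighbourhoods are cut
  down to \<open>D\<close>, so that deleting vertices and contracting sets of them stay within one
  definition.\<close>

definition drac :: "'j set \<Rightarrow> 'n set \<Rightarrow> ('j \<Rightarrow> nat) set" where
  "drac L D = {a. (\<forall>j. j \<notin> L \<longrightarrow> a j = 0) \<and> (\<forall>J\<subseteq>L. sum a J \<le> card (D \<inter> \<Union>(N ` J)))}"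

definition full :: "'j set \<Rightarrow> 'n set \<Rightarrow> ('j \<Rightarrow> nat) set" where
  "full L D = {a \<in> drac L D. sum a L = card D}"

definition near_full :: "'j set \<Rightarrow> 'n set \<Rightarrow> ('j \<Rightarrow> nat) set" where
  "near_full L D = {a \<in> drac L D. sum a L + 1 = card D}"

text \<open>The hyperedges that survive the contraction of \<open>I\<close>. Their ranks are the
  increments of \<open>rank\<close> over \<open>I\<close>, which bound the coordinates outside
  \<open>I\<close> once the inequality of \<open>I\<close> is tight.\<close>

definition avoid :: "'j set \<Rightarrow> 'n set \<Rightarrow> 'j set" where
  "avoid L I = {j \<in> L. N j \<inter> I = {}}"

text \<open>The complement of \<open>I\<close> in \<open>D\<close> is covered by the largest set \<open>J\<close> for which the
  draconian inequality is an equality.\<close>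
definition split_at :: "'j set \<Rightarrow> 'n set \<Rightarrow> 'n set \<Rightarrow> ('j \<Rightarrow> nat) set" where
  "split_at L D I = {a \<in> near_full L D. sum a (avoid L I) = card (D - I) \<and>
     (\<forall>J\<subseteq>L. sum a J = card (D \<inter> \<Union>(N ` J)) \<longrightarrow> \<Union>(N ` J) \<inter> I = {})}"

definition rank :: "'j set \<Rightarrow> 'n set \<Rightarrow> real" where
  "rank L A = (\<Sum>j\<in>{j \<in> L. N j \<inter> A \<noteq> {}}. real (k j))"

definition weight :: "'j set \<Rightarrow> ('j \<Rightarrow> nat) \<Rightarrow> real" where
  "weight L a = (\<Prod>j\<in>L. real (k j) ^ a j / fact (a j))"

lemma dracD:
  assumes "a \<in> drac L D"
  shows "j \<notin> L \<Longrightarrow> a j = 0" "J \<subseteq> L \<Longrightarrow> sum a J \<le> card (D \<inter> \<Union>(N ` J))"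
  using assms by (auto simp: drac_def)

lemma split_atD:
  assumes "a \<in> split_at L D I"
  shows "a \<in> drac L D" "sum a L + 1 = card D" "sum a (avoid L I) = card (D - I)"
    and "\<And>J. J \<subseteq> L \<Longrightarrow> sum a J = card (D \<inter> \<Union>(N ` J)) \<Longrightarrow> \<Union>(N ` J) \<inter> I = {}"
  using assms by (auto simp: split_at_def near_full_def)

lemma finite_drac:
  assumes "finite L" "finite D"
  shows "finite (drac L D)"
proof (rule finite_subset)
  show "drac L D \<subseteq> {a. \<forall>j. (j \<in> L \<longrightarrow> a j \<in> {..card D}) \<and> (j \<notin> L \<longrightarrow> a j = 0)}"
  proof (intro subsetI CollectI allI conjI impI)
    fix a j assume a: "a \<in> drac L D"
    show "a j = 0" if "j \<notin> L" by (rule dracD(1)[OF a that])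
    assume "j \<in> L"
    then have "a j \<le> card (D \<inter> N j)" using dracD(2)[OF a, of "{j}"] by simp
    also have "\<dots> \<le> card D" using assms by (intro card_mono) auto
    finally show "a j \<in> {..card D}" by simp
  qed
  show "finite {a. \<forall>j. (j \<in> L \<longrightarrow> a j \<in> {..card D}) \<and> (j \<notin> L \<longrightarrow> a j = 0)}"
    using assms by (intro finite_set_of_finite_funs) auto
qed

lemma finite_full: "finite L \<Longrightarrow> finite D \<Longrightarrow> finite (full L D)"
  using finite_drac by (simp add: full_def)

lemma finite_near_full: "finite L \<Longrightarrow> finite D \<Longrightarrow> finite (near_full L D)"
  using finite_drac by (simp add: near_full_def)

lemma finite_split_at: "finite L \<Longrightarrow> finite D \<Longrightarrow> finite (split_at L D I)"
  using finite_near_full by (simp add: split_at_def)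

lemma weight_nonneg: "0 \<le> weight L a"
  by (auto simp: weight_def intro!: prod_nonneg)

section \<open>Uncrossing of tight sets and the set that belongs to a sequence\<close>

lemma avoid_subset: "avoid L I \<subseteq> L"
  by (auto simp: avoid_def)

text \<open>The number of covered vertices is submodular in the set of hyperedges, while
  \<open>sum a\<close> is modular. Two equalities and the inequality for the intersection therefore
  force equality for the union.\<close>

lemma tight_Un:
  assumes "finite L" "finite D" "a \<in> drac L D" "J \<subseteq> L" "K \<subseteq> L"
    and "sum a J = card (D \<inter> \<Union>(N ` J))" "sum a K = card (D \<inter> \<Union>(N ` K))"
  shows "sum a (J \<union> K) = card (D \<inter> \<Union>(N ` (J \<union> K)))"
proof -
  have fin: "finite J" "finite K" using assms finite_subset by blast+
  have "card (D \<inter> \<Union>(N ` (J \<union> K))) + card (D \<inter> \<Union>(N ` (J \<inter> K)))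
      \<le> card ((D \<inter> \<Union>(N ` J)) \<union> (D \<inter> \<Union>(N ` K))) + card ((D \<inter> \<Union>(N ` J)) \<inter> (D \<inter> \<Union>(N ` K)))"
    using assms(2) by (intro add_mono card_mono) auto
  also have "\<dots> = card (D \<inter> \<Union>(N ` J)) + card (D \<inter> \<Union>(N ` K))"
    using assms(2) by (intro card_Un_Int[symmetric]) auto
  also have "\<dots> = sum a (J \<union> K) + sum a (J \<inter> K)"
    using sum.union_inter[OF fin, of a] assms(6,7) by simp
  also have "sum a (J \<inter> K) \<le> card (D \<inter> \<Union>(N ` (J \<inter> K)))"
    using assms by (intro dracD(2)[OF assms(3)]) auto
  finally have "card (D \<inter> \<Union>(N ` (J \<union> K))) \<le> sum a (J \<union> K)" by simp
  moreover have "sum a (J \<union> K) \<le> card (D \<inter> \<Union>(N ` (J \<union> K)))"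
    using assms by (intro dracD(2)[OF assms(3)]) auto
  ultimately show ?thesis by simp
qed

text \<open>The empty set is tight and unions preserve tightness, so the union of all tight sets is
  itself tight.\<close>

lemma largest_tight:
  assumes "finite L" "finite D" "a \<in> drac L D"
  obtains K where "K \<subseteq> L" "sum a K = card (D \<inter> \<Union>(N ` K))"
    "\<And>J. J \<subseteq> L \<Longrightarrow> sum a J = card (D \<inter> \<Union>(N ` J)) \<Longrightarrow> J \<subseteq> K"
proof -
  define T where "T = {J. J \<subseteq> L \<and> sum a J = card (D \<inter> \<Union>(N ` J))}"
  have "finite T" using assms(1) by (simp add: T_def)
  have Tun: "\<Union>F \<in> T" if "finite F" "F \<subseteq> T" for F
    using that
  proof (induction F rule: finite_induct)
    case empty
    then show ?case by (simp add: T_def)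
  next
    case (insert J F)
    then show ?case
      using tight_Un[OF assms, of J "\<Union>F"] by (auto simp: T_def)
  qed
  from Tun[OF \<open>finite T\<close>] have "\<Union>T \<in> T" by simp
  then show ?thesis by (intro that[of "\<Union>T"]) (auto simp: T_def)
qed

text \<open>Counting upgrades the equality of numbers in \<open>split_at\<close> to an equality of
  sets: hyperedges avoiding \<open>I\<close> cover vertices of \<open>D - I\<close> only, and the
  draconian inequality makes them cover at least \<open>card (D - I)\<close> of them.\<close>

lemma split_at_cover:
  assumes "finite D" "a \<in> split_at L D I" "I \<subseteq> D"
  shows "D \<inter> \<Union>(N ` avoid L I) = D - I"
proof (rule card_subset_eq)
  show "finite (D - I)" using assms by simp
  show sub: "D \<inter> \<Union>(N ` avoid L I) \<subseteq> D - I" by (auto simp: avoid_def)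
  have "card (D - I) = sum a (avoid L I)" using assms by (simp add: split_at_def)
  also have "\<dots> \<le> card (D \<inter> \<Union>(N ` avoid L I))"
    using assms by (intro dracD(2)) (auto simp: split_at_def near_full_def avoid_def)
  finally show "card (D \<inter> \<Union>(N ` avoid L I)) = card (D - I)"
    using card_mono[OF \<open>finite (D - I)\<close> sub] by simp
qed

lemma split_at_tight:
  assumes "finite D" "a \<in> split_at L D I" "I \<subseteq> D"
  shows "sum a (avoid L I) = card (D \<inter> \<Union>(N ` avoid L I))"
  using split_at_cover[OF assms] assms by (simp add: split_at_def)

text \<open>The tight set \<open>avoid L I\<close> covers all of \<open>D - I\<close> and, by the
  last clause of \<open>split_at\<close> for \<open>I'\<close>, misses \<open>I'\<close>. Hence
  \<open>I' \<subseteq> I\<close>, and the roles can be exchanged.\<close>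

lemma split_at_unique:
  assumes "finite D" "a \<in> split_at L D I" "I \<subseteq> D" "a \<in> split_at L D I'" "I' \<subseteq> D"
  shows "I = I'"
proof -
  have "I' \<subseteq> I" if a: "a \<in> split_at L D I" "I \<subseteq> D" "a \<in> split_at L D I'" "I' \<subseteq> D" for I I'
  proof -
    have "\<Union>(N ` avoid L I) \<inter> I' = {}"
      by (rule split_atD(4)[OF a(3) avoid_subset split_at_tight[OF assms(1) a(1,2)]])
    then show ?thesis using split_at_cover[OF assms(1) a(1,2)] a(4) by blast
  qed
  then show ?thesis using assms by blast
qed

lemma split_at_exists:
  assumes "finite L" "finite D" "a \<in> near_full L D"
  obtains I where "I \<subseteq> D" "I \<noteq> {}" "a \<in> split_at L D I"
proof -
  have a: "a \<in> drac L D" "sum a L + 1 = card D" using assms by (auto simp: near_full_def)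
  obtain K where K: "K \<subseteq> L" "sum a K = card (D \<inter> \<Union>(N ` K))"
    "\<And>J. J \<subseteq> L \<Longrightarrow> sum a J = card (D \<inter> \<Union>(N ` J)) \<Longrightarrow> J \<subseteq> K"
    using largest_tight[OF assms(1,2) a(1)] by blast
  have finK: "finite K" using K assms finite_subset by blast
  define I where "I = D - \<Union>(N ` K)"
  have DI: "D - I = D \<inter> \<Union>(N ` K)" by (auto simp: I_def)
  \<comment> \<open>Maximality of \<open>K\<close> is used here: a hyperedge that avoids
    \<open>I\<close> covers nothing new, so adding it to \<open>K\<close> preserves
    tightness.\<close>
  have av: "avoid L I = K"
  proof
    show "K \<subseteq> avoid L I" using K(1) by (auto simp: avoid_def I_def)
    show "avoid L I \<subseteq> K"
    proof
      fix j assume j: "j \<in> avoid L I"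
      then have jL: "insert j K \<subseteq> L" using K by (auto simp: avoid_def)
      have "D \<inter> \<Union>(N ` insert j K) = D \<inter> \<Union>(N ` K)" using j by (auto simp: avoid_def I_def)
      moreover have "sum a (insert j K) \<le> card (D \<inter> \<Union>(N ` insert j K))"
        by (rule dracD(2)[OF a(1) jL])
      moreover have "sum a K \<le> sum a (insert j K)"
        using finK by (intro sum_mono2) auto
      ultimately have "sum a (insert j K) = card (D \<inter> \<Union>(N ` insert j K))" using K(2) by simp
      from K(3)[OF jL this] show "j \<in> K" by simp
    qed
  qed
  \<comment> \<open>\<open>I\<close> is nonempty: a tight set covering \<open>D\<close> would have
    sum \<open>card D\<close>, one more than the sum of all entries.\<close>
  have "sum a K \<le> sum a L" using K assms by (intro sum_mono2) auto
  then have "I \<noteq> {}" using K(2) a(2) DI by (metis Diff_empty Suc_eq_plus1 Suc_n_not_le_n)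
  moreover have "a \<in> split_at L D I"
  proof -
    have "\<Union>(N ` J) \<inter> I = {}" if "J \<subseteq> L" "sum a J = card (D \<inter> \<Union>(N ` J))" for J
      using K(3)[OF that] by (auto simp: I_def)
    then show ?thesis using assms(3) by (simp add: split_at_def av K(2) DI)
  qed
  moreover have "I \<subseteq> D" by (auto simp: I_def)
  ultimately show ?thesis using that by blast
qed

lemma near_full_eq_UN_split_at:
  assumes "finite L" "finite D"
  shows "near_full L D = (\<Union>I\<in>{I. I \<subseteq> D \<and> I \<noteq> {}}. split_at L D I)"
proof
  show "near_full L D \<subseteq> (\<Union>I\<in>{I. I \<subseteq> D \<and> I \<noteq> {}}. split_at L D I)"
    by (rule subsetI, erule split_at_exists[OF assms]) blast
qed (auto simp: split_at_def)

text \<open>Deleting \<open>i\<close> lowers the right-hand side by one exactly for the sets that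
  cover \<open>i\<close>. The inequalities survive when none of these sets is tight, that is, when
  \<open>i\<close> belongs to the set \<open>I\<close> of the sequence. This mirrors the projection
  of the faces with \<open>i \<in> I\<close>.\<close>

lemma full_Diff_eq_UN_split_at:
  assumes "finite L" "finite D" "i \<in> D"
  shows "full L (D - {i}) = (\<Union>I\<in>{I. I \<subseteq> D \<and> i \<in> I}. split_at L D I)"
proof (intro equalityI subsetI)
  fix a assume a: "a \<in> full L (D - {i})"
  then have a': "a \<in> drac L (D - {i})" and s: "sum a L = card (D - {i})"
    by (auto simp: full_def)
  have c: "card (D - {i}) + 1 = card D"
    using assms card_Suc_Diff1[of D i] by simp
  have le: "sum a J \<le> card ((D - {i}) \<inter> \<Union>(N ` J))" if "J \<subseteq> L" for J
    using dracD(2)[OF a' that] .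
  have "a \<in> drac L D"
  proof -
    have "card ((D - {i}) \<inter> \<Union>(N ` J)) \<le> card (D \<inter> \<Union>(N ` J))" for J
      using assms by (intro card_mono) auto
    then show ?thesis using a' le by (auto simp: drac_def intro: order_trans)
  qed
  then have nf: "a \<in> near_full L D" using s c by (simp add: near_full_def)
  obtain I where I: "I \<subseteq> D" "I \<noteq> {}" "a \<in> split_at L D I"
    by (rule split_at_exists[OF assms(1,2) nf])
  have "i \<in> I"
  proof (rule ccontr)
    assume "i \<notin> I"
    then have "(D - {i}) \<inter> \<Union>(N ` avoid L I) \<subset> D \<inter> \<Union>(N ` avoid L I)"
      using split_at_cover[OF assms(2) I(3,1)] assms(3) by auto
    then have "card ((D - {i}) \<inter> \<Union>(N ` avoid L I)) < card (D \<inter> \<Union>(N ` avoid L I))"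
      using assms(2) by (intro psubset_card_mono) auto
    then show False
      using le[OF avoid_subset, of I] split_at_tight[OF assms(2) I(3,1)] by simp
  qed
  then show "a \<in> (\<Union>I\<in>{I. I \<subseteq> D \<and> i \<in> I}. split_at L D I)" using I by blast
next
  fix a assume "a \<in> (\<Union>I\<in>{I. I \<subseteq> D \<and> i \<in> I}. split_at L D I)"
  then obtain I where I: "I \<subseteq> D" "i \<in> I" "a \<in> split_at L D I" by blast
  then have a: "a \<in> drac L D" "sum a L + 1 = card D" by (auto simp: split_at_def near_full_def)
  have c: "card (D - {i}) + 1 = card D"
    using assms card_Suc_Diff1[of D i] by simp
  have "sum a J \<le> card ((D - {i}) \<inter> \<Union>(N ` J))" if J: "J \<subseteq> L" for J
  proof (cases "i \<in> \<Union>(N ` J)")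
    case True
    then have "sum a J \<noteq> card (D \<inter> \<Union>(N ` J))" using split_atD(4)[OF I(3) J] I(2) by blast
    then have "sum a J + 1 \<le> card (D \<inter> \<Union>(N ` J))" using dracD(2)[OF a(1) J] by simp
    also have "D \<inter> \<Union>(N ` J) = insert i ((D - {i}) \<inter> \<Union>(N ` J))" using True assms(3) by auto
    also have "card \<dots> = card ((D - {i}) \<inter> \<Union>(N ` J)) + 1" using assms(2) by simp
    finally show ?thesis by simp
  next
    case False
    then have "(D - {i}) \<inter> \<Union>(N ` J) = D \<inter> \<Union>(N ` J)" by auto
    then show ?thesis using dracD(2)[OF a(1) J] by simp
  qed
  then have "a \<in> drac L (D - {i})" using a(1) by (simp add: drac_def)
  then show "a \<in> full L (D - {i})" using a(2) c by (simp add: full_def)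
qed

lemma sum_UN_split_at:
  assumes "finite L" "finite D" "\<And>I. I \<in> S \<Longrightarrow> I \<subseteq> D"
  shows "(\<Sum>a\<in>(\<Union>I\<in>S. split_at L D I). g a) = (\<Sum>I\<in>S. \<Sum>a\<in>split_at L D I. g a)"
proof (rule sum.UNION_disjoint)
  have "S \<subseteq> Pow D" using assms by auto
  then show "finite S" using assms(2) finite_subset by blast
  show "\<forall>I\<in>S. finite (split_at L D I)" using assms finite_split_at by blast
  show "\<forall>I\<in>S. \<forall>I'\<in>S. I \<noteq> I' \<longrightarrow> split_at L D I \<inter> split_at L D I' = {}"
    using split_at_unique[OF assms(2)] assms(3) by blast
qed

section \<open>Product structure of the sequences that belong to one set\<close>

lemma weight_avoid:
  assumes "finite L"
  shows "weight L a = weight (avoid L I) a * (\<Prod>j\<in>L - avoid L I. real (k j) ^ a j / fact (a j))"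
  using prod.subset_diff[OF avoid_subset[of L I] assms, of "\<lambda>j. real (k j) ^ a j / fact (a j)"]
  by (simp add: weight_def mult.commute)

lemma split_at_zero_on_avoid:
  assumes "a \<in> split_at L I I" "j \<in> avoid L I"
  shows "a j = 0"
proof -
  have "I \<inter> N j = {}" using assms(2) by (auto simp: avoid_def)
  moreover have "sum a {j} \<le> card (I \<inter> \<Union>(N ` {j}))"
    using assms by (intro dracD(2)) (auto simp: split_at_def near_full_def avoid_def)
  ultimately show ?thesis by simp
qed

text \<open>Entries at hyperedges that meet \<open>I\<close> and entries at hyperedges that avoid it
  do not interact. The inequality of \<open>J \<union> avoid L I\<close> for \<open>a\<close> on
  \<open>D\<close> is the inequality of \<open>J\<close> for the first part on \<open>I\<close>,
  with \<open>card (D - I)\<close> added to both sides.\<close>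

lemma split_at_restrict:
  assumes "finite L" "finite D" "I \<subseteq> D" "I \<noteq> {}" and a: "a \<in> split_at L D I"
  shows "(\<lambda>j. if j \<in> avoid L I then 0 else a j) \<in> split_at L I I" (is "?a1 \<in> _")
    and "(\<lambda>j. if j \<in> avoid L I then a j else 0) \<in> full (avoid L I) (D - I)" (is "?a2 \<in> _")
proof -
  let ?A = "avoid L I"
  have finI: "finite I" "finite ?A"
    using finite_subset[OF assms(3,2)] finite_subset[OF avoid_subset assms(1)] .
  have d: "a \<in> drac L D" "sum a L + 1 = card D" "sum a ?A = card (D - I)"
    using a by (auto simp: split_at_def near_full_def)
  have tight: "\<Union>(N ` J) \<inter> I = {}" if "J \<subseteq> L" "sum a J = card (D \<inter> \<Union>(N ` J))" for J
    by (rule split_atD(4)[OF a that])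
  note cov = split_at_cover[OF assms(2) a assms(3)]
  have cD: "card D = card I + card (D - I)"
    using assms finI card_Diff_subset[of I D] card_mono[of D I] by simp
  have s1: "sum ?a1 J = sum a (J - ?A)" if "finite J" for J
    using that by (intro sum.mono_neutral_cong_right) auto
  have key: "sum ?a1 J + card (D - I) = sum a (J \<union> ?A)"
    "card (D \<inter> \<Union>(N ` (J \<union> ?A))) = card (I \<inter> \<Union>(N ` J)) + card (D - I)" if "J \<subseteq> L" for J
  proof -
    have "finite J" using that assms(1) finite_subset by blast
    have "J \<union> ?A = (J - ?A) \<union> ?A" by auto
    then have "sum a (J \<union> ?A) = sum a (J - ?A) + sum a ?A"
      using \<open>finite J\<close> finI sum.union_disjoint[of "J - ?A" ?A a] by auto
    then show "sum ?a1 J + card (D - I) = sum a (J \<union> ?A)"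
      using s1[OF \<open>finite J\<close>] d by simp
    have "D \<inter> \<Union>(N ` (J \<union> ?A)) = (I \<inter> \<Union>(N ` J)) \<union> (D - I)"
      using cov assms(3) by blast
    then show "card (D \<inter> \<Union>(N ` (J \<union> ?A))) = card (I \<inter> \<Union>(N ` J)) + card (D - I)"
      using finI assms by (simp add: card_Un_disjoint Diff_eq disjoint_iff)
  qed
  have JA: "J \<union> ?A \<subseteq> L" if "J \<subseteq> L" for J using that avoid_subset by auto
  have "sum ?a1 J \<le> card (I \<inter> \<Union>(N ` J))" if "J \<subseteq> L" for J
    using key[OF that] dracD(2)[OF d(1) JA[OF that]] by simp
  then have "?a1 \<in> drac L I" using d(1) by (auto simp: drac_def)
  moreover have "sum ?a1 L + 1 = card I"
  proof -
    have "L \<union> ?A = L" using avoid_subset by auto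
    then show ?thesis using key(1)[of L] d(2) cD by simp
  qed
  moreover have "\<Union>(N ` J) \<inter> I = {}" if "J \<subseteq> L" "sum ?a1 J = card (I \<inter> \<Union>(N ` J))" for J
    using tight[OF JA[OF that(1)]] key[OF that(1)] that(2) by auto
  moreover have "sum ?a1 ?A = 0" by simp
  ultimately show "?a1 \<in> split_at L I I" by (simp add: split_at_def near_full_def)
  have "sum ?a2 J \<le> card ((D - I) \<inter> \<Union>(N ` J))" if "J \<subseteq> ?A" for J
  proof -
    have "sum ?a2 J = sum a J" using that by (intro sum.cong) auto
    moreover have "(D - I) \<inter> \<Union>(N ` J) = D \<inter> \<Union>(N ` J)" using that by (auto simp: avoid_def)
    ultimately show ?thesis using dracD(2)[OF d(1), of J] that avoid_subset by fastforce
  qed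
  then show "?a2 \<in> full ?A (D - I)" using d(3) by (auto simp: full_def drac_def)
qed

text \<open>Since the inequalities hold for each summand separately, a set that is tight for the sum
  is tight for \<open>a1\<close>; so the last clause of \<open>split_at\<close> is inherited from
  \<open>a1\<close>.\<close>

lemma split_at_combine:
  assumes "finite L" "finite D" "I \<subseteq> D" "I \<noteq> {}"
    and a1: "a1 \<in> split_at L I I" and a2: "a2 \<in> full (avoid L I) (D - I)"
  shows "(\<lambda>j. a1 j + a2 j) \<in> split_at L D I"
proof -
  let ?A = "avoid L I" and ?a = "\<lambda>j. a1 j + a2 j"
  have finI: "finite I" "finite ?A"
    using finite_subset[OF assms(3,2)] finite_subset[OF avoid_subset assms(1)] .
  have cD: "card D = card I + card (D - I)"
    using assms finI card_Diff_subset[of I D] card_mono[of D I] by simp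
  have d1: "a1 \<in> drac L I" "sum a1 L + 1 = card I" using a1 by (auto simp: split_at_def near_full_def)
  have d2: "a2 \<in> drac ?A (D - I)" "sum a2 ?A = card (D - I)" using a2 by (auto simp: full_def)
  have s2: "sum a2 J = sum a2 (J \<inter> ?A)" if "J \<subseteq> L" for J
    using that assms(1) finite_subset[OF that] dracD(1)[OF d2(1)]
    by (intro sum.mono_neutral_right) auto
  have le2: "sum a2 J \<le> card ((D - I) \<inter> \<Union>(N ` J))" if "J \<subseteq> L" for J
  proof -
    have "sum a2 J \<le> card ((D - I) \<inter> \<Union>(N ` (J \<inter> ?A)))"
      unfolding s2[OF that] by (rule dracD(2)[OF d2(1)]) auto
    also have "\<dots> \<le> card ((D - I) \<inter> \<Union>(N ` J))"
      using assms(2) by (intro card_mono) auto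
    finally show ?thesis .
  qed
  have le1: "sum a1 J \<le> card (I \<inter> \<Union>(N ` J))" if "J \<subseteq> L" for J
    by (rule dracD(2)[OF d1(1) that])
  have c: "card (D \<inter> \<Union>(N ` J)) = card (I \<inter> \<Union>(N ` J)) + card ((D - I) \<inter> \<Union>(N ` J))" for J
  proof -
    have "D \<inter> \<Union>(N ` J) = (I \<inter> \<Union>(N ` J)) \<union> ((D - I) \<inter> \<Union>(N ` J))" using assms(3) by auto
    moreover have "finite (I \<inter> \<Union>(N ` J))" "finite ((D - I) \<inter> \<Union>(N ` J))" using finI assms(2) by auto
    ultimately show ?thesis by (metis (no_types, lifting) card_Un_disjoint Diff_disjoint inf.assoc inf_bot_right inf_commute)
  qed
  have s: "sum ?a J = sum a1 J + sum a2 J" for J by (simp add: sum.distrib)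
  have sL: "sum ?a L + 1 = card D"
  proof -
    have "L \<inter> ?A = ?A" using avoid_subset by auto
    then show ?thesis using s[of L] s2[of L] d1 d2 cD by simp
  qed
  have "sum ?a J \<le> card (D \<inter> \<Union>(N ` J))" if "J \<subseteq> L" for J
    using s[of J] c[of J] le1[OF that] le2[OF that] by simp
  moreover have "?a j = 0" if "j \<notin> L" for j
    using that dracD(1)[OF d1(1)] dracD(1)[OF d2(1)] avoid_subset[of L I] by auto
  ultimately have dr: "?a \<in> drac L D" by (simp add: drac_def)
  have "sum a1 ?A = 0" using split_at_zero_on_avoid[OF a1] by simp
  then have sA: "sum ?a ?A = card (D - I)" using s[of ?A] d2 by simp
  have "\<Union>(N ` J) \<inter> I = {}" if "J \<subseteq> L" "sum ?a J = card (D \<inter> \<Union>(N ` J))" for J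
  proof -
    have "sum a1 J = card (I \<inter> \<Union>(N ` J))"
      using s[of J] c[of J] le1[OF that(1)] le2[OF that(1)] that(2) by simp
    then show ?thesis by (rule split_atD(4)[OF a1 that(1)])
  qed
  then show ?thesis using dr sL sA by (simp add: split_at_def near_full_def)
qed

text \<open>Combinatorial counterpart of the product structure of a face. The two parts live on
  disjoint sets of hyperedges and an entry 0 contributes the factor 1, so the weights
  multiply.\<close>

lemma sum_weight_split_at:
  assumes "finite L" "finite D" "I \<subseteq> D" "I \<noteq> {}"
  shows "(\<Sum>a\<in>split_at L D I. weight L a)
    = (\<Sum>a\<in>split_at L I I. weight L a) * (\<Sum>a\<in>full (avoid L I) (D - I). weight (avoid L I) a)"
proof -
  let ?A = "avoid L I"
  have "(\<Sum>a\<in>split_at L D I. weight L a)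
    = (\<Sum>p\<in>split_at L I I \<times> full ?A (D - I). weight L (fst p) * weight ?A (snd p))"
  proof (rule sum.reindex_bij_witness[where i = "\<lambda>p j. fst p j + snd p j"
        and j = "\<lambda>a. (\<lambda>j. if j \<in> ?A then 0 else a j, \<lambda>j. if j \<in> ?A then a j else 0)"])
    fix a assume a: "a \<in> split_at L D I"
    show "(\<lambda>j. if j \<in> ?A then 0 else a j, \<lambda>j. if j \<in> ?A then a j else 0)
        \<in> split_at L I I \<times> full ?A (D - I)"
      using split_at_restrict[OF assms a] by simp
    show "weight L (fst (\<lambda>j. if j \<in> ?A then 0 else a j, \<lambda>j. if j \<in> ?A then a j else 0)) *
        weight ?A (snd (\<lambda>j. if j \<in> ?A then 0 else a j, \<lambda>j. if j \<in> ?A then a j else 0)) = weight L a"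
      using weight_avoid[OF assms(1), of a I]
        weight_avoid[OF assms(1), of "\<lambda>j. if j \<in> ?A then 0 else a j" I]
      by (simp add: weight_def)
  next
    fix p assume p: "p \<in> split_at L I I \<times> full ?A (D - I)"
    then show "(\<lambda>j. fst p j + snd p j) \<in> split_at L D I"
      using split_at_combine[OF assms, of "fst p" "snd p"] by auto
    have "fst p j = 0" if "j \<in> ?A" for j using split_at_zero_on_avoid[OF _ that] p by auto
    moreover have "snd p j = 0" if "j \<notin> ?A" for j using dracD(1)[OF _ that] p by (auto simp: full_def)
    ultimately show "(\<lambda>j. if j \<in> ?A then 0 else fst p j + snd p j,
        \<lambda>j. if j \<in> ?A then fst p j + snd p j else 0) = p"
      by (auto simp: prod_eq_iff fun_eq_iff)
  qed auto
  then show ?thesis by (simp add: sum_product sum.cartesian_product case_prod_beta')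
qed

text \<open>An entry can be raised by one iff its index lies in no tight set, and
  \<open>avoid L I\<close> is a tight set containing all the others. The indices that can be raised
  are thus those counted by \<open>rank L I\<close>, which is how a rank becomes the coefficient in
  the Euler relation.\<close>

lemma split_at_increment:
  assumes "finite L" "finite D" "I \<subseteq> D" "a \<in> split_at L D I" "j \<in> L"
  shows "N j \<inter> I \<noteq> {} \<longleftrightarrow> a(j := a j + 1) \<in> drac L D"
proof -
  let ?b = "a(j := a j + 1)"
  have a: "a \<in> drac L D" using assms by (auto simp: split_at_def near_full_def)
  have s: "sum ?b J = sum a J + 1" if "J \<subseteq> L" "j \<in> J" for J
  proof -
    have "finite J" using that assms(1) finite_subset by blast
    have "sum ?b (J - {j}) = sum a (J - {j})" by (intro sum.cong) auto
    then show ?thesis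
      using sum.remove[OF \<open>finite J\<close> that(2), of ?b] sum.remove[OF \<open>finite J\<close> that(2), of a] by simp
  qed
  have s': "sum ?b J = sum a J" if "j \<notin> J" for J using that by (intro sum.cong) auto
  show ?thesis
  proof
    assume ne: "N j \<inter> I \<noteq> {}"
    have "sum ?b J \<le> card (D \<inter> \<Union>(N ` J))" if J: "J \<subseteq> L" for J
    proof (cases "j \<in> J")
      case True
      then have "sum a J \<noteq> card (D \<inter> \<Union>(N ` J))" using split_atD(4)[OF assms(4) J] ne by blast
      then show ?thesis using s[OF J True] dracD(2)[OF a J] by simp
    next
      case False
      then show ?thesis using s' dracD(2)[OF a J] by simp
    qed
    then show "?b \<in> drac L D" using a assms(5) by (auto simp: drac_def)
  next
    assume b: "?b \<in> drac L D"
    show "N j \<inter> I \<noteq> {}"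
    proof
      assume "N j \<inter> I = {}"
      then have "j \<in> avoid L I" using assms(5) by (simp add: avoid_def)
      then show False
        using s[OF avoid_subset] dracD(2)[OF b avoid_subset, of I] split_at_tight[OF assms(2,4,3)]
        by simp
    qed
  qed
qed

text \<open>The derivative of the raised weight in the variable \<open>k j\<close> is the weight of
  \<open>a\<close>; multiplying a monomial's derivative by \<open>k j\<close> returns the monomial
  times its exponent.\<close>

lemma weight_increment:
  assumes "finite L" "j \<in> L"
  shows "real (a j + 1) * weight L (a(j := a j + 1)) = real (k j) * weight L a"
proof -
  let ?b = "a(j := a j + 1)" and ?w = "\<lambda>a j. real (k j) ^ a j / fact (a j)"
  have "prod (?w ?b) (L - {j}) = prod (?w a) (L - {j})" by (intro prod.cong) auto
  then have e1: "weight L ?b = real (k j) ^ (a j + 1) / fact (a j + 1) * prod (?w a) (L - {j})"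
    unfolding weight_def using prod.remove[OF assms, of "?w ?b"] by simp
  have e2: "weight L a = real (k j) ^ a j / fact (a j) * prod (?w a) (L - {j})"
    unfolding weight_def using prod.remove[OF assms, of "?w a"] by simp
  have e3: "real (a j + 1) * (real (k j) ^ (a j + 1) / fact (a j + 1))
      = real (k j) * (real (k j) ^ a j / fact (a j))"
    by (simp add: field_simps del: of_nat_Suc)
  show ?thesis by (simp only: e1 e2 e3 mult.assoc[symmetric])
qed

text \<open>Euler's relation for the homogeneous polynomial on the left.\<close>
lemma card_mult_sum_weight_full:
  assumes "finite L" "finite D" "D \<noteq> {}"
  shows "real (card D) * (\<Sum>a\<in>full L D. weight L a)
    = (\<Sum>I\<in>{I. I \<subseteq> D \<and> I \<noteq> {}}. rank L I * (\<Sum>a\<in>split_at L D I. weight L a))"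
proof -
  let ?P = "\<lambda>a. {j \<in> L. a(j := a j + 1) \<in> drac L D}"
  have "(\<Sum>I\<in>{I. I \<subseteq> D \<and> I \<noteq> {}}. rank L I * (\<Sum>a\<in>split_at L D I. weight L a))
    = (\<Sum>I\<in>{I. I \<subseteq> D \<and> I \<noteq> {}}. \<Sum>a\<in>split_at L D I. \<Sum>j\<in>?P a. real (k j) * weight L a)"
    unfolding sum_distrib_left
  proof (intro sum.cong refl)
    fix I a assume I: "I \<in> {I. I \<subseteq> D \<and> I \<noteq> {}}" and a: "a \<in> split_at L D I"
    have "{j \<in> L. N j \<inter> I \<noteq> {}} = ?P a"
      using split_at_increment[OF assms(1,2) _ a] I by blast
    then show "rank L I * weight L a = (\<Sum>j\<in>?P a. real (k j) * weight L a)"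
      by (simp add: rank_def sum_distrib_right)
  qed
  also have "\<dots> = (\<Sum>a\<in>near_full L D. \<Sum>j\<in>?P a. real (k j) * weight L a)"
    unfolding near_full_eq_UN_split_at[OF assms(1,2)]
    by (rule sum_UN_split_at[symmetric]) (use assms in auto)
  also have "\<dots> = (\<Sum>(a, j)\<in>Sigma (near_full L D) ?P. real (k j) * weight L a)"
    using assms finite_near_full by (intro sum.Sigma) auto
  \<comment> \<open>Pairs of a sequence and an entry that can be raised correspond to pairs of a
    full sequence and a nonzero entry. Every pair of the second kind occurs, because lowering an
    entry violates no inequality.\<close>
  also have "\<dots> = (\<Sum>(b, j)\<in>Sigma (full L D) (\<lambda>b. {j \<in> L. b j \<noteq> 0}). real (b j) * weight L b)"
  proof (rule sum.reindex_bij_witness[where j = "\<lambda>(a, j). (a(j := a j + 1), j)"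
        and i = "\<lambda>(b, j). (b(j := b j - 1), j)"])
    fix p assume "p \<in> Sigma (near_full L D) ?P"
    then obtain a j where p: "p = (a, j)" "a \<in> near_full L D" "j \<in> L" "a(j := a j + 1) \<in> drac L D"
      by auto
    show "(case case p of (a, j) \<Rightarrow> (a(j := a j + 1), j) of (b, j) \<Rightarrow> (b(j := b j - 1), j)) = p"
      by (simp add: p)
    have "sum (a(j := a j + 1)) L = sum a L + 1"
      using sum.remove[OF assms(1) p(3), of "a(j := a j + 1)"] sum.remove[OF assms(1) p(3), of a]
        sum.cong[of "L - {j}" "L - {j}" "a(j := a j + 1)" a] by simp
    then show "(case p of (a, j) \<Rightarrow> (a(j := a j + 1), j)) \<in> Sigma (full L D) (\<lambda>b. {j \<in> L. b j \<noteq> 0})"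
      using p by (auto simp: full_def near_full_def)
    show "(case case p of (a, j) \<Rightarrow> (a(j := a j + 1), j) of (b, j) \<Rightarrow> real (b j) * weight L b)
        = (case p of (a, j) \<Rightarrow> real (k j) * weight L a)"
      using weight_increment[OF assms(1) p(3), of a] by (simp add: p)
  next
    fix p assume "p \<in> Sigma (full L D) (\<lambda>b. {j \<in> L. b j \<noteq> 0})"
    then obtain b j where p: "p = (b, j)" "b \<in> full L D" "j \<in> L" "b j \<noteq> 0" by auto
    show "(case case p of (b, j) \<Rightarrow> (b(j := b j - 1), j) of (a, j) \<Rightarrow> (a(j := a j + 1), j)) = p"
      using p by auto
    have b: "b \<in> drac L D" "sum b L = card D" using p by (auto simp: full_def)
    have "sum (b(j := b j - 1)) L + 1 = sum b L"
      using sum.remove[OF assms(1) p(3), of "b(j := b j - 1)"] sum.remove[OF assms(1) p(3), of b]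
        sum.cong[of "L - {j}" "L - {j}" "b(j := b j - 1)" b] p(4) by simp
    moreover have "b(j := b j - 1) \<in> drac L D"
    proof -
      have "sum (b(j := b j - 1)) J \<le> sum b J" for J by (intro sum_mono) auto
      then show ?thesis using b(1) p(3) by (auto simp: drac_def intro: order_trans)
    qed
    ultimately show "(case p of (b, j) \<Rightarrow> (b(j := b j - 1), j)) \<in> Sigma (near_full L D) ?P"
      using p b by (auto simp: near_full_def)
  qed
  also have "\<dots> = (\<Sum>b\<in>full L D. \<Sum>j\<in>{j \<in> L. b j \<noteq> 0}. real (b j) * weight L b)"
    using assms finite_full by (intro sum.Sigma[symmetric]) auto
  also have "\<dots> = (\<Sum>b\<in>full L D. real (card D) * weight L b)"
  proof (rule sum.cong[OF refl])
    fix b assume "b \<in> full L D"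
    then have "sum b L = card D" by (simp add: full_def)
    moreover have "(\<Sum>j\<in>{j \<in> L. b j \<noteq> 0}. real (b j)) = (\<Sum>j\<in>L. real (b j))"
      using assms(1) by (intro sum.mono_neutral_left) auto
    ultimately have "(\<Sum>j\<in>{j \<in> L. b j \<noteq> 0}. real (b j)) = real (card D)" by (simp flip: of_nat_sum)
    then show "(\<Sum>j\<in>{j \<in> L. b j \<noteq> 0}. real (b j) * weight L b) = real (card D) * weight L b"
      by (simp flip: sum_distrib_right)
  qed
  finally show ?thesis by (simp add: sum_distrib_left)
qed

end

section \<open>Volumes of polymatroids and their faces\<close>

lemma PiL_component_measurable [measurable (raw)]:
  "i \<in> A \<Longrightarrow> (\<lambda>x. x i) \<in> borel_measurable (PiL A)"
  using measurable_component_singleton[of i A "\<lambda>_. lborel"] by simp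

lemma PiL_sum_measurable [measurable (raw)]:
  "B \<subseteq> A \<Longrightarrow> (\<lambda>x. sum x B) \<in> borel_measurable (PiL A)"
  by (intro borel_measurable_sum PiL_component_measurable) auto

lemma space_PiL: "space (PiL A) = A \<rightarrow>\<^sub>E UNIV"
  by (simp add: space_PiM)

lemma sum_fun_upd_notin: "i \<notin> A \<Longrightarrow> sum (x(i := t)) A = sum x A"
  by (intro sum.cong) auto

lemma sum_fun_upd_in: "finite A \<Longrightarrow> i \<in> A \<Longrightarrow> sum (x(i := t)) A = t + sum x (A - {i})"
  by (subst sum.remove[of A i]) (auto simp: sum_fun_upd_notin)

context hypergraph
begin

definition polymatroid :: "'j set \<Rightarrow> 'n set \<Rightarrow> ('n \<Rightarrow> real) set" where
  "polymatroid L D = {x \<in> D \<rightarrow>\<^sub>E UNIV. (\<forall>i\<in>D. 0 \<le> x i) \<and> (\<forall>A\<subseteq>D. sum x A \<le> rank L A)}"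

text \<open>The face on which the inequality of \<open>I\<close> is tight is parametrised by the coordinates
  other than \<open>i \<in> I\<close>.\<close>
definition lift :: "'j set \<Rightarrow> 'n set \<Rightarrow> 'n \<Rightarrow> ('n \<Rightarrow> real) \<Rightarrow> 'n \<Rightarrow> real" where
  "lift L I i x = x(i := rank L I - sum x (I - {i}))"

text \<open>For \<open>i \<in> I\<close> the forgotten coordinate is an integer affine function of
  the others. Lebesgue measure of this projection is therefore the lattice volume of the face in
  dimension \<open>card D - 1\<close>, whichever \<open>i\<close> is taken; it is 0 if the face has
  smaller dimension.\<close>

definition face_proj :: "'j set \<Rightarrow> 'n set \<Rightarrow> 'n set \<Rightarrow> 'n \<Rightarrow> ('n \<Rightarrow> real) set" where
  "face_proj L D I i = {x \<in> (D - {i}) \<rightarrow>\<^sub>E UNIV. lift L I i x \<in> polymatroid L D}"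

section \<open>The rank function, its contractions and the product structure of a face\<close>

lemma rank_empty [simp]: "rank L {} = 0"
  by (simp add: rank_def)

lemma rank_nonneg: "0 \<le> rank L A"
  by (simp add: rank_def sum_nonneg)

lemma rank_mono: "finite L \<Longrightarrow> A \<subseteq> B \<Longrightarrow> rank L A \<le> rank L B"
  unfolding rank_def by (intro sum_mono2) auto

lemma rank_indicator:
  "finite L \<Longrightarrow> rank L A = (\<Sum>j\<in>L. if N j \<inter> A = {} then 0 else real (k j))"
  unfolding rank_def by (subst sum.inter_filter) (auto intro!: sum.cong)

lemma rank_submodular:
  "finite L \<Longrightarrow> rank L (A \<union> B) + rank L (A \<inter> B) \<le> rank L A + rank L B"
  by (auto simp: rank_indicator sum.distrib[symmetric] intro!: sum_mono)

text \<open>A hyperedge counted for \<open>A \<union> I\<close> but not for \<open>I\<close> avoids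
  \<open>I\<close> and meets \<open>A\<close>. Passing to \<open>avoid L I\<close> is thus the
  contraction of \<open>I\<close>.\<close>

lemma rank_avoid:
  assumes "finite L"
  shows "rank (avoid L I) A = rank L (A \<union> I) - rank L I"
proof -
  have fin: "finite (avoid L I)" using finite_subset[OF avoid_subset assms] .
  have "rank (avoid L I) A = (\<Sum>j\<in>L. if N j \<inter> I = {} \<and> N j \<inter> A \<noteq> {} then real (k j) else 0)"
    unfolding rank_indicator[OF fin] using assms avoid_subset
    by (intro sum.mono_neutral_cong_left) (auto simp: avoid_def)
  also have "\<dots> = rank L (A \<union> I) - rank L I"
    unfolding rank_indicator[OF assms] sum_subtractf[symmetric] by (intro sum.cong) auto
  finally show ?thesis .
qed

lemma polymatroid_measurable [measurable]:
  assumes "finite D"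
  shows "polymatroid L D \<in> sets (PiL D)"
proof -
  have "polymatroid L D = {x \<in> space (PiL D). (\<forall>i\<in>D. 0 \<le> x i) \<and> (\<forall>A\<in>Pow D. sum x A \<le> rank L A)}"
    by (auto simp: polymatroid_def space_PiL)
  also have "\<dots> \<in> sets (PiL D)"
    using assms by (intro sets.sets_Collect_conj sets.sets_Collect_finite_All borel_measurable_le
        PiL_component_measurable PiL_sum_measurable) auto
  finally show ?thesis .
qed

lemma lift_extensional:
  assumes "i \<in> D" "x \<in> (D - {i}) \<rightarrow>\<^sub>E UNIV"
  shows "lift L I i x \<in> D \<rightarrow>\<^sub>E UNIV"
  using assms by (auto simp: lift_def PiE_iff extensional_def)

lemma lift_measurable [measurable]:
  assumes "finite D" "i \<in> I" "I \<subseteq> D"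
  shows "lift L I i \<in> PiL (D - {i}) \<rightarrow>\<^sub>M PiL D"
proof -
  have "(\<lambda>x. \<lambda>l\<in>D. if l = i then rank L I - sum x (I - {i}) else x l) \<in> PiL (D - {i}) \<rightarrow>\<^sub>M PiL D"
  proof (rule measurable_restrict)
    fix l assume l: "l \<in> D"
    show "(\<lambda>x. if l = i then rank L I - sum x (I - {i}) else x l) \<in> PiL (D - {i}) \<rightarrow>\<^sub>M lborel"
    proof (cases "l = i")
      case True
      have "(\<lambda>x. rank L I - sum x (I - {i})) \<in> borel_measurable (PiL (D - {i}))"
        using assms by (intro borel_measurable_diff PiL_sum_measurable) auto
      then show ?thesis using True by simp
    next
      case False
      then show ?thesis using l PiL_component_measurable[of l "D - {i}"] by simp
    qed
  qed
  also have "?this \<longleftrightarrow> ?thesis"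
    using assms by (intro measurable_cong)
      (auto simp: space_PiL lift_def fun_eq_iff PiE_iff extensional_def)
  finally show ?thesis .
qed

lemma face_proj_measurable [measurable]:
  assumes "finite D" "i \<in> I" "I \<subseteq> D"
  shows "face_proj L D I i \<in> sets (PiL (D - {i}))"
proof -
  have "face_proj L D I i = lift L I i -` polymatroid L D \<inter> space (PiL (D - {i}))"
    by (auto simp: face_proj_def space_PiL)
  then show ?thesis
    using measurable_sets[OF lift_measurable[OF assms] polymatroid_measurable[OF assms(1)]] by simp
qed

lemma sum_lift:
  assumes "finite I" "i \<in> I"
  shows "sum (lift L I i x) I = rank L I"
  unfolding lift_def sum_fun_upd_in[OF assms] by simp

text \<open>Subtracting the tight equality of \<open>I\<close> from the inequality of
  \<open>A \<union> I\<close> gives the inequality of the contraction. Conversely the inequality of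
  \<open>A\<close> is assembled from those of \<open>A \<inter> I\<close> and \<open>A - I\<close>,
  and submodularity of \<open>rank\<close> covers the difference.\<close>

lemma polymatroid_tight_split:
  assumes "finite L" "finite D" "I \<subseteq> D" "z \<in> D \<rightarrow>\<^sub>E UNIV" "sum z I = rank L I"
  shows "z \<in> polymatroid L D \<longleftrightarrow>
    restrict z I \<in> polymatroid L I \<and> restrict z (D - I) \<in> polymatroid (avoid L I) (D - I)"
    (is "_ \<longleftrightarrow> ?l \<and> ?r")
proof -
  have finI: "finite I" using finite_subset[OF assms(3,2)] .
  have rs: "restrict z B \<in> polymatroid L' B \<longleftrightarrow> (\<forall>i\<in>B. 0 \<le> z i) \<and> (\<forall>A\<subseteq>B. sum z A \<le> rank L' A)"
    for B L'
  proof -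
    have "sum (restrict z B) A = sum z A" if "A \<subseteq> B" for A
      using that by (intro sum.cong) auto
    then show ?thesis by (simp add: polymatroid_def)
  qed
  show ?thesis
  proof
    assume z: "z \<in> polymatroid L D"
    have ?l using z assms(3) unfolding rs by (auto simp: polymatroid_def)
    moreover have "sum z A \<le> rank (avoid L I) A" if A: "A \<subseteq> D - I" for A
    proof -
      have "sum z A + sum z I = sum z (A \<union> I)"
        using A finI finite_subset[OF A] assms(2) by (intro sum.union_disjoint[symmetric]) auto
      also have "\<dots> \<le> rank L (A \<union> I)"
      proof -
        have "A \<union> I \<subseteq> D" using A assms(3) by auto
        then show ?thesis using z unfolding polymatroid_def by blast
      qed
      finally show ?thesis using assms(5) by (simp add: rank_avoid[OF assms(1)])
    qed
    then have ?r using z assms(3) unfolding rs by (auto simp: polymatroid_def)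
    ultimately show "?l \<and> ?r" by simp
  next
    assume lr: "?l \<and> ?r"
    have "sum z A \<le> rank L A" if A: "A \<subseteq> D" for A
    proof -
      have "finite A" using finite_subset[OF A assms(2)] .
      have "sum z A = sum z (A \<inter> I) + sum z (A - I)"
        using sum.Int_Diff[OF \<open>finite A\<close>] .
      also have "sum z (A \<inter> I) \<le> rank L (A \<inter> I)"
        using lr unfolding rs by auto
      also have "sum z (A - I) \<le> rank (avoid L I) (A - I)"
      proof -
        have "A - I \<subseteq> D - I" using A by auto
        then show ?thesis using lr unfolding rs by blast
      qed
      also have "rank L (A \<inter> I) + rank (avoid L I) (A - I) = rank L (A \<inter> I) + rank L (A \<union> I) - rank L I"
        by (simp add: rank_avoid[OF assms(1)])
      also have "\<dots> \<le> rank L A" using rank_submodular[OF assms(1), of A I] by simp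
      finally show ?thesis by simp
    qed
    moreover have "0 \<le> z i" if "i \<in> D" for i
      using lr that unfolding rs by (cases "i \<in> I") auto
    ultimately show "z \<in> polymatroid L D" using assms(4) by (simp add: polymatroid_def)
  qed
qed

text \<open>The eliminated coordinate belongs to \<open>I\<close>, so it affects the first factor
  only. The tight equality decouples the two blocks of coordinates, and Fubini gives the
  product.\<close>

lemma emeasure_face_proj:
  assumes "finite L" "finite D" "i \<in> I" "I \<subseteq> D"
  shows "emeasure (PiL (D - {i})) (face_proj L D I i)
    = emeasure (PiL (I - {i})) (face_proj L I I i)
      * emeasure (PiL (D - I)) (polymatroid (avoid L I) (D - I))"
proof -
  have finI: "finite I" using finite_subset[OF assms(4,2)] .
  have D: "D - {i} = (I - {i}) \<union> (D - I)" and disj: "(I - {i}) \<inter> (D - I) = {}"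
    using assms by auto
  have mem: "merge (I - {i}) (D - I) (x, y) \<in> face_proj L D I i \<longleftrightarrow>
      x \<in> face_proj L I I i \<and> y \<in> polymatroid (avoid L I) (D - I)"
    if x: "x \<in> (I - {i}) \<rightarrow>\<^sub>E UNIV" and y: "y \<in> (D - I) \<rightarrow>\<^sub>E UNIV" for x y
  proof -
    let ?m = "merge (I - {i}) (D - I) (x, y)"
    have m: "?m \<in> (D - {i}) \<rightarrow>\<^sub>E UNIV"
      using D by (auto simp: merge_def PiE_iff extensional_def)
    have s: "sum ?m (I - {i}) = sum x (I - {i})" by (intro sum.cong) (auto simp: merge_def)
    have "restrict (lift L I i ?m) I = lift L I i x"
    proof
      fix l
      show "restrict (lift L I i ?m) I l = lift L I i x l"
      proof (cases "l = i")
        case True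
        then show ?thesis using assms(3) by (simp add: lift_def s)
      next
        case False
        then show ?thesis
          using PiE_arb[OF x, of l] by (cases "l \<in> I") (auto simp: lift_def merge_def)
      qed
    qed
    moreover have "restrict (lift L I i ?m) (D - I) = y"
    proof
      fix l
      show "restrict (lift L I i ?m) (D - I) l = y l"
        using PiE_arb[OF y, of l] assms(3) by (cases "l \<in> D - I") (auto simp: lift_def merge_def)
    qed
    moreover have "i \<in> D" using assms by auto
    ultimately show ?thesis
      using polymatroid_tight_split[OF assms(1,2,4) lift_extensional[OF \<open>i \<in> D\<close> m] sum_lift[OF finI assms(3)]]
        m x by (simp add: face_proj_def)
  qed
  have [measurable]: "face_proj L D I i \<in> sets (PiL ((I - {i}) \<union> (D - I)))"
    "face_proj L I I i \<in> sets (PiL (I - {i}))"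
    "polymatroid (avoid L I) (D - I) \<in> sets (PiL (D - I))"
    using face_proj_measurable[OF assms(2,3,4), of L] face_proj_measurable[OF finI assms(3), of L]
      polymatroid_measurable[of "D - I" "avoid L I"] assms(2) by (auto simp: D)
  have "emeasure (PiL (D - {i})) (face_proj L D I i)
      = (\<integral>\<^sup>+z. indicator (face_proj L D I i) z \<partial>PiL ((I - {i}) \<union> (D - I)))"
    by (simp add: D)
  also have "\<dots> = (\<integral>\<^sup>+x. (\<integral>\<^sup>+y. indicator (face_proj L D I i) (merge (I - {i}) (D - I) (x, y))
      \<partial>PiL (D - I)) \<partial>PiL (I - {i}))"
    using finI assms(2) disj by (intro PiL.product_nn_integral_fold) auto
  also have "\<dots> = (\<integral>\<^sup>+x. (\<integral>\<^sup>+y. indicator (face_proj L I I i) x *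
      indicator (polymatroid (avoid L I) (D - I)) y \<partial>PiL (D - I)) \<partial>PiL (I - {i}))"
    by (intro nn_integral_cong) (auto simp: mem space_PiL indicator_def)
  also have "\<dots> = emeasure (PiL (I - {i})) (face_proj L I I i)
      * emeasure (PiL (D - I)) (polymatroid (avoid L I) (D - I))"
    by (simp add: nn_integral_cmult nn_integral_multc)
  finally show ?thesis .
qed

section \<open>Fibres over a deleted coordinate\<close>

text \<open>The inequalities of the sets containing \<open>i\<close> bound coordinate
  \<open>i\<close> from above, and the minimum is the upper end of the fibre over \<open>x\<close>.
  The set that attains it tells on which face this end lies.\<close>

definition top_coord :: "'j set \<Rightarrow> 'n set \<Rightarrow> 'n \<Rightarrow> ('n \<Rightarrow> real) \<Rightarrow> real" where
  "top_coord L D i x = Min ((\<lambda>I. rank L I - sum x (I - {i})) ` {I. I \<subseteq> D \<and> i \<in> I})"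

lemma finite_Pow_in: "finite D \<Longrightarrow> finite {I. I \<subseteq> D \<and> i \<in> I}"
  by (rule finite_subset[of _ "Pow D"]) auto

lemma le_top_coord_iff:
  assumes "finite D" "i \<in> D"
  shows "t \<le> top_coord L D i x \<longleftrightarrow> (\<forall>I. I \<subseteq> D \<and> i \<in> I \<longrightarrow> t \<le> rank L I - sum x (I - {i}))"
proof -
  have "D \<in> {I. I \<subseteq> D \<and> i \<in> I}" using assms by simp
  then show ?thesis unfolding top_coord_def
    using finite_Pow_in[OF assms(1), of i] by (subst Min_ge_iff) auto
qed

lemma top_coord_attained:
  assumes "finite D" "i \<in> D"
  obtains I where "I \<subseteq> D" "i \<in> I" "top_coord L D i x = rank L I - sum x (I - {i})"
proof -
  have "(\<lambda>I. rank L I - sum x (I - {i})) ` {I. I \<subseteq> D \<and> i \<in> I} \<noteq> {}" using assms by auto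
  then have "top_coord L D i x \<in> (\<lambda>I. rank L I - sum x (I - {i})) ` {I. I \<subseteq> D \<and> i \<in> I}"
    unfolding top_coord_def using finite_Pow_in[OF assms(1), of i] by (intro Min_in) auto
  then show ?thesis using that by auto
qed

text \<open>Monotonicity of the rank makes every fibre over the polymatroid of
  \<open>D - {i}\<close> nonempty, so this polymatroid is the full projection and not merely a
  superset of it.\<close>

lemma top_coord_nonneg:
  assumes "finite L" "finite D" "i \<in> D" "x \<in> polymatroid L (D - {i})"
  shows "0 \<le> top_coord L D i x"
proof -
  have "sum x (I - {i}) \<le> rank L I" if "I \<subseteq> D" for I
  proof -
    have "I - {i} \<subseteq> D - {i}" using that by auto
    then have "sum x (I - {i}) \<le> rank L (I - {i})" using assms(4) by (simp add: polymatroid_def)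
    also have "\<dots> \<le> rank L I" using assms(1) by (intro rank_mono) auto
    finally show ?thesis .
  qed
  then show ?thesis unfolding le_top_coord_iff[OF assms(2,3)] by simp
qed

lemma fun_upd_in_polymatroid_iff:
  assumes "finite D" "i \<in> D" "x \<in> (D - {i}) \<rightarrow>\<^sub>E UNIV"
  shows "x(i := t) \<in> polymatroid L D \<longleftrightarrow>
    x \<in> polymatroid L (D - {i}) \<and> 0 \<le> t \<and> t \<le> top_coord L D i x"
proof -
  have ext: "x(i := t) \<in> D \<rightarrow>\<^sub>E UNIV" using assms by (auto simp: PiE_iff extensional_def)
  have "(\<forall>A\<subseteq>D. sum (x(i := t)) A \<le> rank L A) \<longleftrightarrow>
      (\<forall>A\<subseteq>D - {i}. sum x A \<le> rank L A) \<and> (\<forall>I. I \<subseteq> D \<and> i \<in> I \<longrightarrow> t \<le> rank L I - sum x (I - {i}))"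
    (is "?a \<longleftrightarrow> ?b \<and> ?c")
  proof (intro iffI conjI)
    assume a: ?a
    show ?b
    proof (intro allI impI)
      fix A assume "A \<subseteq> D - {i}"
      then have "A \<subseteq> D" "i \<notin> A" by auto
      then show "sum x A \<le> rank L A" using a sum_fun_upd_notin[of i A x t] by auto
    qed
    show ?c
    proof (intro allI impI)
      fix I assume I: "I \<subseteq> D \<and> i \<in> I"
      then have "finite I" using assms(1) finite_subset by blast
      then show "t \<le> rank L I - sum x (I - {i})"
        using a I sum_fun_upd_in[of I i x t] by auto
    qed
  next
    assume bc: "?b \<and> ?c"
    show ?a
    proof (intro allI impI)
      fix A assume A: "A \<subseteq> D"
      then have "finite A" using assms(1) finite_subset by blast
      show "sum (x(i := t)) A \<le> rank L A"
      proof (cases "i \<in> A")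
        case True
        have "t \<le> rank L A - sum x (A - {i})" using bc A True by blast
        then show ?thesis using sum_fun_upd_in[OF \<open>finite A\<close> True, of x t] by linarith
      next
        case False
        then show ?thesis using bc A sum_fun_upd_notin[OF False, of x t] by auto
      qed
    qed
  qed
  moreover have "(\<forall>l\<in>D. 0 \<le> (x(i := t)) l) \<longleftrightarrow> (\<forall>l\<in>D - {i}. 0 \<le> x l) \<and> 0 \<le> t"
    using assms(2) by auto
  ultimately show ?thesis
    using assms(3) ext unfolding polymatroid_def le_top_coord_iff[OF assms(1,2)] mem_Collect_eq
    by (simp only: simp_thms) blast
qed

text \<open>The faces with \<open>i \<in> I\<close> form the upper boundary in direction
  \<open>i\<close>: the end of the fibre over \<open>x\<close> lies on the face of \<open>I\<close>
  iff the bound from \<open>I\<close> attains the minimum.\<close>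

lemma face_proj_iff:
  assumes "finite L" "finite D" "i \<in> I" "I \<subseteq> D" "x \<in> (D - {i}) \<rightarrow>\<^sub>E UNIV"
  shows "x \<in> face_proj L D I i \<longleftrightarrow>
    x \<in> polymatroid L (D - {i}) \<and> rank L I - sum x (I - {i}) = top_coord L D i x"
proof -
  have i: "i \<in> D" using assms by auto
  let ?t = "rank L I - sum x (I - {i})"
  have le: "top_coord L D i x \<le> ?t"
    using le_top_coord_iff[OF assms(2) i, of "top_coord L D i x" L x] assms(3,4) by blast
  have "x \<in> face_proj L D I i \<longleftrightarrow> x(i := ?t) \<in> polymatroid L D"
    using assms(5) by (simp add: face_proj_def lift_def)
  also have "\<dots> \<longleftrightarrow> x \<in> polymatroid L (D - {i}) \<and> 0 \<le> ?t \<and> ?t \<le> top_coord L D i x"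
    by (rule fun_upd_in_polymatroid_iff[OF assms(2) i assms(5)])
  also have "\<dots> \<longleftrightarrow> x \<in> polymatroid L (D - {i}) \<and> ?t = top_coord L D i x"
    using le top_coord_nonneg[OF assms(1,2) i, of x] by (metis order.antisym order.refl order.trans)
  finally show ?thesis .
qed

text \<open>Two different sets that both contain \<open>i\<close> differ in another element, so a
  tie between their bounds is a nontrivial linear equation in the remaining coordinates.\<close>

lemma AE_face_proj_unique:
  assumes "finite D" "i \<in> D"
  shows "AE x in PiL (D - {i}). \<forall>I I'. I \<subseteq> D \<and> i \<in> I \<and> I' \<subseteq> D \<and> i \<in> I' \<and> I \<noteq> I' \<longrightarrow>
    rank L I - sum x (I - {i}) \<noteq> rank L I' - sum x (I' - {i})"
proof -
  let ?P = "{(I, I'). I \<subseteq> D \<and> i \<in> I \<and> I' \<subseteq> D \<and> i \<in> I' \<and> I \<noteq> I'}"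
  have "AE x in PiL (D - {i}). rank L I - sum x (I - {i}) \<noteq> rank L I' - sum x (I' - {i})"
    if II: "(I, I') \<in> ?P" for I I'
  proof -
    define \<alpha> where "\<alpha> l = (if l \<in> I then 1 else 0) - (if l \<in> I' then 1 else 0 :: real)" for l
    from II have II: "I \<subseteq> D" "i \<in> I" "I' \<subseteq> D" "i \<in> I'" "I \<noteq> I'" by auto
    obtain l where l: "l \<in> D - {i}" "\<alpha> l \<noteq> 0"
      using II unfolding \<alpha>_def by fastforce
    have fin: "finite (D - {i})" using assms by simp
    have s: "(\<Sum>l\<in>D - {i}. (if l \<in> J then 1 else 0) * x l) = sum x (J - {i})"
      if "J \<subseteq> D" for J and x :: "'n \<Rightarrow> real"
    proof -
      have "(\<Sum>l\<in>D - {i}. (if l \<in> J then 1 else 0) * x l) = (\<Sum>l\<in>D - {i}. if l \<in> J then x l else 0)"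
        by (intro sum.cong) auto
      also have "\<dots> = sum x ((D - {i}) \<inter> J)" using fin by (simp add: sum.inter_restrict)
      also have "(D - {i}) \<inter> J = J - {i}" using that by auto
      finally show ?thesis .
    qed
    have eq: "(\<Sum>l\<in>D - {i}. \<alpha> l * x l) = sum x (I - {i}) - sum x (I' - {i})" for x
      using s[OF II(1), of x] s[OF II(3), of x] by (simp add: \<alpha>_def left_diff_distrib sum_subtractf)
    have "{x \<in> (D - {i}) \<rightarrow>\<^sub>E UNIV. (\<Sum>l\<in>D - {i}. \<alpha> l * x l) = rank L I - rank L I'} \<in> null_sets (PiL (D - {i}))"
      by (rule null_hyperplane_PiL[where A = "D - {i}" and l = l and \<alpha> = \<alpha>, OF fin l])
    then show ?thesis
    proof (rule AE_I', intro subsetI)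
      fix x assume "x \<in> {x \<in> space (PiL (D - {i})).
          \<not> rank L I - sum x (I - {i}) \<noteq> rank L I' - sum x (I' - {i})}"
      then have x: "x \<in> (D - {i}) \<rightarrow>\<^sub>E UNIV" "rank L I - sum x (I - {i}) = rank L I' - sum x (I' - {i})"
        unfolding space_PiL by blast+
      have "(\<Sum>l\<in>D - {i}. \<alpha> l * x l) = rank L I - rank L I'"
        unfolding eq using x(2) by linarith
      with x(1) show "x \<in> {x \<in> (D - {i}) \<rightarrow>\<^sub>E UNIV. (\<Sum>l\<in>D - {i}. \<alpha> l * x l) = rank L I - rank L I'}"
        by blast
    qed
  qed
  moreover have "countable ?P"
  proof -
    have "?P \<subseteq> Pow D \<times> Pow D" by auto
    then show ?thesis using assms(1) by (meson countable_finite finite_Pow_iff finite_SigmaI finite_subset)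
  qed
  ultimately have "AE x in PiL (D - {i}). \<forall>p\<in>?P. rank L (fst p) - sum x (fst p - {i}) \<noteq> rank L (snd p) - sum x (snd p - {i})"
    by (subst AE_ball_countable) auto
  then show ?thesis by (rule AE_mp) (intro AE_I2, auto)
qed

text \<open>The function \<open>g\<close> lets one dissection serve twice: the constant 1 gives the
  deletion relation, and \<open>ennreal\<close> measures the lengths of the fibres. Ties between
  bounds account for the exceptional null set.\<close>

lemma AE_sum_indicator_face_proj:
  fixes g :: "real \<Rightarrow> ennreal"
  assumes "finite L" "finite D" "i \<in> D"
  shows "AE x in PiL (D - {i}). indicator (polymatroid L (D - {i})) x * g (top_coord L D i x)
    = (\<Sum>I\<in>{I. I \<subseteq> D \<and> i \<in> I}. indicator (face_proj L D I i) x * g (lift L I i x i))"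
  using AE_face_proj_unique[OF assms(2,3), of L]
proof (rule AE_mp, intro AE_I2 impI)
  fix x assume x: "x \<in> space (PiL (D - {i}))"
    and u: "\<forall>I I'. I \<subseteq> D \<and> i \<in> I \<and> I' \<subseteq> D \<and> i \<in> I' \<and> I \<noteq> I' \<longrightarrow>
    rank L I - sum x (I - {i}) \<noteq> rank L I' - sum x (I' - {i})"
  have x: "x \<in> (D - {i}) \<rightarrow>\<^sub>E UNIV" using x by (simp add: space_PiL)
  let ?S = "{I. I \<subseteq> D \<and> i \<in> I}"
  have fin: "finite ?S" by (rule finite_Pow_in[OF assms(2)])
  obtain K where K: "K \<subseteq> D" "i \<in> K" "top_coord L D i x = rank L K - sum x (K - {i})"
    using top_coord_attained[OF assms(2,3)] by blast
  have "indicator (face_proj L D I i) x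
      = (if I = K then indicator (polymatroid L (D - {i})) x else 0 :: ennreal)" if "I \<in> ?S" for I
    using face_proj_iff[OF assms(1,2) _ _ x, of I] that K u by (auto simp: indicator_def)
  then have "(\<Sum>I\<in>?S. indicator (face_proj L D I i) x * g (lift L I i x i))
    = (\<Sum>I\<in>?S. if I = K then indicator (polymatroid L (D - {i})) x * g (lift L I i x i) else 0)"
    by (intro sum.cong) auto
  also have "\<dots> = indicator (polymatroid L (D - {i})) x * g (lift L K i x i)"
    using fin K by (simp add: sum.delta)
  also have "lift L K i x i = top_coord L D i x" using K by (simp add: lift_def)
  finally show "indicator (polymatroid L (D - {i})) x * g (top_coord L D i x)
    = (\<Sum>I\<in>?S. indicator (face_proj L D I i) x * g (lift L I i x i))" by simp
qed

lemma lift_coord_measurable [measurable (raw)]: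
  assumes "finite D" "i \<in> I" "I \<subseteq> D" "l \<in> D"
  shows "(\<lambda>x. lift L I i x l) \<in> borel_measurable (PiL (D - {i}))"
  using measurable_compose[OF lift_measurable[OF assms(1-3)] PiL_component_measurable[OF assms(4)]] .

lemma nn_integral_sum_face_proj:
  fixes g :: "real \<Rightarrow> ennreal"
  assumes "finite L" "finite D" "i \<in> D" and [measurable]: "g \<in> borel_measurable borel"
  shows "(\<integral>\<^sup>+x. indicator (polymatroid L (D - {i})) x * g (top_coord L D i x) \<partial>PiL (D - {i}))
    = (\<Sum>I\<in>{I. I \<subseteq> D \<and> i \<in> I}.
        \<integral>\<^sup>+x. indicator (face_proj L D I i) x * g (lift L I i x i) \<partial>PiL (D - {i}))"
proof -
  have "(\<integral>\<^sup>+x. indicator (polymatroid L (D - {i})) x * g (top_coord L D i x) \<partial>PiL (D - {i}))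
    = (\<integral>\<^sup>+x. (\<Sum>I\<in>{I. I \<subseteq> D \<and> i \<in> I}. indicator (face_proj L D I i) x * g (lift L I i x i)) \<partial>PiL (D - {i}))"
    by (rule nn_integral_cong_AE[OF AE_sum_indicator_face_proj[OF assms(1-3)]])
  also have "\<dots> = (\<Sum>I\<in>{I. I \<subseteq> D \<and> i \<in> I}.
        \<integral>\<^sup>+x. indicator (face_proj L D I i) x * g (lift L I i x i) \<partial>PiL (D - {i}))"
  proof (rule nn_integral_sum)
    fix I assume "I \<in> {I. I \<subseteq> D \<and> i \<in> I}"
    then have I: "i \<in> I" "I \<subseteq> D" by auto
    have [measurable]: "face_proj L D I i \<in> sets (PiL (D - {i}))"
      "(\<lambda>x. lift L I i x i) \<in> borel_measurable (PiL (D - {i}))"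
      using face_proj_measurable[OF assms(2) I] lift_coord_measurable[OF assms(2) I assms(3)] by auto
    show "(\<lambda>x. indicator (face_proj L D I i) x * g (lift L I i x i)) \<in> borel_measurable (PiL (D - {i}))"
      by measurable
  qed
  finally show ?thesis .
qed

lemma emeasure_polymatroid_Diff:
  assumes "finite L" "finite D" "i \<in> D"
  shows "emeasure (PiL (D - {i})) (polymatroid L (D - {i}))
    = (\<Sum>I\<in>{I. I \<subseteq> D \<and> i \<in> I}. emeasure (PiL (D - {i})) (face_proj L D I i))"
proof -
  have "emeasure (PiL (D - {i})) (polymatroid L (D - {i}))
    = (\<integral>\<^sup>+x. indicator (polymatroid L (D - {i})) x * 1 \<partial>PiL (D - {i}))"
    using polymatroid_measurable[of "D - {i}" L] assms(2) by simp
  also have "\<dots> = (\<Sum>I\<in>{I. I \<subseteq> D \<and> i \<in> I}. \<integral>\<^sup>+x. indicator (face_proj L D I i) x * 1 \<partial>PiL (D - {i}))"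
    by (rule nn_integral_sum_face_proj[OF assms]) simp
  also have "\<dots> = (\<Sum>I\<in>{I. I \<subseteq> D \<and> i \<in> I}. emeasure (PiL (D - {i})) (face_proj L D I i))"
    using face_proj_measurable[OF assms(2)] by (intro sum.cong) auto
  finally show ?thesis .
qed

text \<open>Fubini in direction \<open>i\<close>: the fibre is the interval from 0 to
  \<open>top_coord\<close>, whose length is coordinate \<open>i\<close> of the point on the face
  above.\<close>

lemma emeasure_polymatroid_insert:
  assumes "finite L" "finite D" "i \<in> D"
  shows "emeasure (PiL D) (polymatroid L D) = (\<Sum>I\<in>{I. I \<subseteq> D \<and> i \<in> I}.
      \<integral>\<^sup>+x. indicator (face_proj L D I i) x * ennreal (lift L I i x i) \<partial>PiL (D - {i}))"
proof -
  have D: "D = insert i (D - {i})" using assms by auto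
  have [measurable]: "polymatroid L D \<in> sets (PiL D)" using polymatroid_measurable[OF assms(2)] .
  have "emeasure (PiL D) (polymatroid L D) = (\<integral>\<^sup>+x. indicator (polymatroid L D) x \<partial>PiL (insert i (D - {i})))"
    using D by simp
  also have "\<dots> = (\<integral>\<^sup>+x. (\<integral>\<^sup>+t. indicator (polymatroid L D) (x(i := t)) \<partial>lborel) \<partial>PiL (D - {i}))"
    using assms D[symmetric] by (intro PiL.product_nn_integral_insert) auto
  also have "\<dots> = (\<integral>\<^sup>+x. indicator (polymatroid L (D - {i})) x * ennreal (top_coord L D i x) \<partial>PiL (D - {i}))"
  proof (rule nn_integral_cong)
    fix x assume "x \<in> space (PiL (D - {i}))"
    then have x: "x \<in> (D - {i}) \<rightarrow>\<^sub>E UNIV" by (simp add: space_PiL)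
    have "(\<integral>\<^sup>+t. indicator (polymatroid L D) (x(i := t)) \<partial>lborel)
      = (\<integral>\<^sup>+t. indicator (polymatroid L (D - {i})) x * indicator {0..top_coord L D i x} t \<partial>lborel)"
      using fun_upd_in_polymatroid_iff[OF assms(2,3) x, of _ L]
      by (intro nn_integral_cong) (auto simp: indicator_def)
    also have "\<dots> = indicator (polymatroid L (D - {i})) x * emeasure lborel {0..top_coord L D i x}"
      by (subst nn_integral_cmult) auto
    also have "\<dots> = indicator (polymatroid L (D - {i})) x * ennreal (top_coord L D i x)"
      using top_coord_nonneg[OF assms, of x] by (auto simp: indicator_def)
    finally show "(\<integral>\<^sup>+t. indicator (polymatroid L D) (x(i := t)) \<partial>lborel)
      = indicator (polymatroid L (D - {i})) x * ennreal (top_coord L D i x)" .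
  qed
  also have "\<dots> = (\<Sum>I\<in>{I. I \<subseteq> D \<and> i \<in> I}.
      \<integral>\<^sup>+x. indicator (face_proj L D I i) x * ennreal (lift L I i x i) \<partial>PiL (D - {i}))"
    by (rule nn_integral_sum_face_proj[OF assms]) simp
  finally show ?thesis .
qed

section \<open>Change of the eliminated coordinate and the volume of the polymatroid\<close>

lemma rank_Ints: "rank L I \<in> \<int>"
  unfolding rank_def by (intro Ints_sum) auto

lemma lift_restrict_lift:
  assumes "finite I" "i \<in> I" "i' \<in> I" "I \<subseteq> D" "x \<in> (D - {i}) \<rightarrow>\<^sub>E UNIV"
  shows "lift L I i' (restrict (lift L I i x) (D - {i'})) = lift L I i x"
proof
  fix l
  have iD: "i \<in> D" using assms by auto
  have ext: "lift L I i x \<in> D \<rightarrow>\<^sub>E UNIV" by (rule lift_extensional[OF iD assms(5)])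
  show "lift L I i' (restrict (lift L I i x) (D - {i'})) l = lift L I i x l"
  proof (cases "l = i'")
    case True
    have "sum (restrict (lift L I i x) (D - {i'})) (I - {i'}) = sum (lift L I i x) (I - {i'})"
      using assms(4) by (intro sum.cong) auto
    also have "\<dots> = sum (lift L I i x) I - lift L I i x i'"
      using sum.remove[OF assms(1,3), of "lift L I i x"] by simp
    finally show ?thesis
      using True sum_lift[OF assms(1,2), of L x] unfolding lift_def[of L I i'] by simp
  next
    case False
    then show ?thesis using PiE_arb[OF ext, of l] by (cases "l \<in> D") (auto simp: lift_def[of L I i'])
  qed
qed

text \<open>The transition between two projections of one face reads its equation as a formula for
  \<open>i'\<close> instead of \<open>i\<close>. Its linear coefficients are 0, 1 or -1 and ranks
  are integers, so it is an affine bijection of the integer points, and integrals over the face do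
  not see the choice.\<close>

lemma nn_integral_lift_shear:
  assumes "finite D" "i \<in> I" "i' \<in> I" "I \<subseteq> D" and F: "F \<in> borel_measurable (PiL D)"
  shows "(\<integral>\<^sup>+x. F (lift L I i x) \<partial>PiL (D - {i})) = (\<integral>\<^sup>+x. F (lift L I i' x) \<partial>PiL (D - {i'}))"
proof -
  have finI: "finite I" using finite_subset[OF assms(4,1)] .
  define \<phi> where "\<phi> i i' x = restrict (lift L I i x) (D - {i'})" for i i' and x :: "'n \<Rightarrow> real"
  have \<phi>U: "\<phi> i i' x \<in> (D - {i'}) \<rightarrow>\<^sub>E UNIV" for i i' x by (auto simp: \<phi>_def)
  have lift\<phi>: "lift L I i' (\<phi> i i' x) = lift L I i x"
    if "i \<in> I" "i' \<in> I" "x \<in> (D - {i}) \<rightarrow>\<^sub>E UNIV" for i i' x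
    unfolding \<phi>_def by (rule lift_restrict_lift[OF finI that(1,2) assms(4) that(3)])
  have inv: "\<phi> i' i (\<phi> i i' x) = x" if "i \<in> I" "i' \<in> I" "x \<in> (D - {i}) \<rightarrow>\<^sub>E UNIV" for i i' x
  proof -
    have "\<phi> i' i (\<phi> i i' x) = restrict (lift L I i x) (D - {i})"
      using lift\<phi>[OF that] by (simp add: \<phi>_def[of i'])
    also have "\<dots> = x"
    proof
      fix l show "restrict (lift L I i x) (D - {i}) l = x l"
        using PiE_arb[OF that(3), of l] by (auto simp: lift_def)
    qed
    finally show ?thesis .
  qed
  have \<phi>Z: "\<phi> i i' x \<in> (D - {i'}) \<rightarrow>\<^sub>E \<int>" if "i \<in> I" "x \<in> (D - {i}) \<rightarrow>\<^sub>E \<int>" for i i' x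
  proof -
    have "x l \<in> \<int>" if "l \<in> D - {i}" for l using \<open>x \<in> (D - {i}) \<rightarrow>\<^sub>E \<int>\<close> that by auto
    moreover from this have "sum x (I - {i}) \<in> \<int>" using assms(4) by (intro Ints_sum) auto
    ultimately show ?thesis using rank_Ints by (auto simp: \<phi>_def lift_def)
  qed
  have toU: "x \<in> A \<rightarrow>\<^sub>E UNIV" if "x \<in> A \<rightarrow>\<^sub>E \<int>" for A :: "'n set" and x :: "'n \<Rightarrow> real" using that by auto
  have meas: "\<phi> i i' \<in> PiL (D - {i}) \<rightarrow>\<^sub>M PiL (D - {i'})"
    unfolding \<phi>_def
    by (rule measurable_compose[OF lift_measurable[OF assms(1,2,4)] measurable_restrict_subset]) auto
  have "distr (PiL (D - {i})) (PiL (D - {i'})) (\<phi> i i') = PiL (D - {i'})"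
  proof (rule distr_unimodular[OF _ _ meas])
    show "\<phi> i i' ` ((D - {i}) \<rightarrow>\<^sub>E UNIV) = (D - {i'}) \<rightarrow>\<^sub>E UNIV"
    proof (intro equalityI subsetI)
      fix y :: "'n \<Rightarrow> real" assume "y \<in> (D - {i'}) \<rightarrow>\<^sub>E UNIV"
      then have "y = \<phi> i i' (\<phi> i' i y)" using inv[OF assms(3,2)] by simp
      then show "y \<in> \<phi> i i' ` ((D - {i}) \<rightarrow>\<^sub>E UNIV)" using \<phi>U by blast
    qed (use \<phi>U in blast)
    show "bij_betw (\<phi> i i') ((D - {i}) \<rightarrow>\<^sub>E \<int>) ((D - {i'}) \<rightarrow>\<^sub>E \<int>)"
    proof (rule bij_betw_byWitness[of _ "\<phi> i' i"])
      show "\<forall>x\<in>(D - {i}) \<rightarrow>\<^sub>E \<int>. \<phi> i' i (\<phi> i i' x) = x"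
        using inv[OF assms(2,3) toU] by blast
      show "\<forall>x\<in>(D - {i'}) \<rightarrow>\<^sub>E \<int>. \<phi> i i' (\<phi> i' i x) = x"
        using inv[OF assms(3,2) toU] by blast
      show "\<phi> i i' ` ((D - {i}) \<rightarrow>\<^sub>E \<int>) \<subseteq> (D - {i'}) \<rightarrow>\<^sub>E \<int>" using \<phi>Z[OF assms(2)] by blast
      show "\<phi> i' i ` ((D - {i'}) \<rightarrow>\<^sub>E \<int>) \<subseteq> (D - {i}) \<rightarrow>\<^sub>E \<int>" using \<phi>Z[OF assms(3)] by blast
    qed
    show "\<phi> i i' (\<lambda>l\<in>D - {i}. x l + y l) l + \<phi> i i' (\<lambda>l\<in>D - {i}. 0) l = \<phi> i i' x l + \<phi> i i' y l"
      if "l \<in> D - {i'}" for x y l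
    proof -
      have sub: "l \<in> I - {i} \<Longrightarrow> l \<in> D - {i}" for l using assms(4) by auto
      have "sum (\<lambda>l\<in>D - {i}. x l + y l) (I - {i}) = (\<Sum>l\<in>I - {i}. x l + y l)"
        using sub by (intro sum.cong) auto
      moreover have "sum (\<lambda>l\<in>D - {i}. 0 :: real) (I - {i}) = (\<Sum>l\<in>I - {i}. 0)"
        using sub by (intro sum.cong) auto
      ultimately show ?thesis
        using that by (cases "l = i") (simp_all add: \<phi>_def lift_def sum.distrib)
    qed
  qed (use assms in auto)
  then have "(\<integral>\<^sup>+x. F (lift L I i' x) \<partial>PiL (D - {i'}))
      = (\<integral>\<^sup>+x. F (lift L I i' x) \<partial>distr (PiL (D - {i})) (PiL (D - {i'})) (\<phi> i i'))" by simp
  also have "\<dots> = (\<integral>\<^sup>+x. F (lift L I i' (\<phi> i i' x)) \<partial>PiL (D - {i}))"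
    using measurable_compose[OF lift_measurable[OF assms(1,3,4)] F]
    by (intro nn_integral_distr[OF meas]) simp
  also have "\<dots> = (\<integral>\<^sup>+x. F (lift L I i x) \<partial>PiL (D - {i}))"
    by (intro nn_integral_cong) (simp add: lift\<phi>[OF assms(2,3)] space_PiL)
  finally show ?thesis by simp
qed

text \<open>Geometrically, the polymatroid is dissected into pyramids with apex 0:
  \<open>rank L I\<close> is the lattice height of the apex over the face of \<open>I\<close>, and
  faces in coordinate hyperplanes contain the apex. The representative \<open>pt I\<close> is fixed
  because the coordinates \<open>i \<in> I\<close> can be added up only in a common chart of the
  face.\<close>

lemma card_mult_emeasure_polymatroid:
  assumes "finite L" "finite D" and pt: "\<And>I. I \<noteq> {} \<Longrightarrow> pt I \<in> I"
  shows "of_nat (card D) * emeasure (PiL D) (polymatroid L D) = (\<Sum>I\<in>{I. I \<subseteq> D \<and> I \<noteq> {}}.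
      ennreal (rank L I) * emeasure (PiL (D - {pt I})) (face_proj L D I (pt I)))"
proof -
  let ?F = "\<lambda>i z. indicator (polymatroid L D) z * ennreal (z i)"
  let ?h = "\<lambda>i I. \<integral>\<^sup>+x. ?F i (lift L I i x) \<partial>PiL (D - {i})"
  let ?S = "{I. I \<subseteq> D \<and> I \<noteq> {}}"
  have finS: "finite ?S" using assms(2) by simp
  have [measurable]: "polymatroid L D \<in> sets (PiL D)" using polymatroid_measurable[OF assms(2)] .
  have F: "?F i \<in> borel_measurable (PiL D)" if "i \<in> D" for i
    using PiL_component_measurable[OF that] by measurable
  have "of_nat (card D) * emeasure (PiL D) (polymatroid L D) = (\<Sum>i\<in>D. emeasure (PiL D) (polymatroid L D))"
    by simp
  also have "\<dots> = (\<Sum>i\<in>D. \<Sum>I | I \<in> ?S \<and> i \<in> I. ?h i I)"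
  proof (rule sum.cong[OF refl])
    fix i assume i: "i \<in> D"
    have "(\<Sum>I\<in>{I. I \<subseteq> D \<and> i \<in> I}.
        \<integral>\<^sup>+x. indicator (face_proj L D I i) x * ennreal (lift L I i x i) \<partial>PiL (D - {i}))
      = (\<Sum>I | I \<in> ?S \<and> i \<in> I. ?h i I)"
      by (intro sum.cong nn_integral_cong) (auto simp: face_proj_def space_PiL indicator_def)
    then show "emeasure (PiL D) (polymatroid L D) = (\<Sum>I | I \<in> ?S \<and> i \<in> I. ?h i I)"
      using emeasure_polymatroid_insert[OF assms(1,2) i] by simp
  qed
  also have "\<dots> = (\<Sum>I\<in>?S. \<Sum>i | i \<in> D \<and> i \<in> I. ?h i I)"
    by (rule sum.swap_restrict[OF assms(2) finS])
  also have "\<dots> = (\<Sum>I\<in>?S. ennreal (rank L I) * emeasure (PiL (D - {pt I})) (face_proj L D I (pt I)))"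
  proof (rule sum.cong[OF refl])
    fix I assume "I \<in> ?S"
    then have I: "I \<subseteq> D" "I \<noteq> {}" by auto
    have finI: "finite I" using finite_subset[OF I(1) assms(2)] .
    let ?p = "pt I"
    have p: "?p \<in> I" using pt I by simp
    have [measurable]: "(\<lambda>x. ?F i (lift L I ?p x)) \<in> borel_measurable (PiL (D - {?p}))" if "i \<in> I" for i
      using measurable_compose[OF lift_measurable[OF assms(2) p I(1)] F] that I by auto
    have "(\<Sum>i | i \<in> D \<and> i \<in> I. ?h i I) = (\<Sum>i\<in>I. \<integral>\<^sup>+x. ?F i (lift L I ?p x) \<partial>PiL (D - {?p}))"
    proof (rule sum.cong)
      fix i assume "i \<in> I"
      then show "?h i I = (\<integral>\<^sup>+x. ?F i (lift L I ?p x) \<partial>PiL (D - {?p}))"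
        using I F by (intro nn_integral_lift_shear[OF assms(2) _ p I(1)]) auto
    qed (use I in auto)
    also have "\<dots> = (\<integral>\<^sup>+x. (\<Sum>i\<in>I. ?F i (lift L I ?p x)) \<partial>PiL (D - {?p}))"
      by (rule nn_integral_sum[symmetric]) measurable
    also have "\<dots> = (\<integral>\<^sup>+x. ennreal (rank L I) * indicator (face_proj L D I ?p) x \<partial>PiL (D - {?p}))"
    proof (rule nn_integral_cong)
      fix x assume x: "x \<in> space (PiL (D - {?p}))"
      show "(\<Sum>i\<in>I. ?F i (lift L I ?p x)) = ennreal (rank L I) * indicator (face_proj L D I ?p) x"
      proof (cases "lift L I ?p x \<in> polymatroid L D")
        case True
        then have "0 \<le> lift L I ?p x i" if "i \<in> I" for i
          using that I by (auto simp: polymatroid_def)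
        then have "(\<Sum>i\<in>I. ennreal (lift L I ?p x i)) = ennreal (sum (lift L I ?p x) I)"
          by (intro sum_ennreal) auto
        then show ?thesis using True x sum_lift[OF finI p] by (simp add: face_proj_def space_PiL)
      next
        case False
        then show ?thesis by (simp add: face_proj_def)
      qed
    qed
    also have "\<dots> = ennreal (rank L I) * emeasure (PiL (D - {?p})) (face_proj L D I ?p)"
      using face_proj_measurable[OF assms(2) p I(1)] by (rule nn_integral_cmult_indicator)
    finally show "(\<Sum>i | i \<in> D \<and> i \<in> I. ?h i I)
        = ennreal (rank L I) * emeasure (PiL (D - {?p})) (face_proj L D I ?p)" .
  qed
  finally show ?thesis .
qed

section \<open>Simultaneous induction for volumes and weights\<close>

lemma sum_weight_nonneg: "0 \<le> (\<Sum>a\<in>S. weight L a)"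
  by (intro sum_nonneg weight_nonneg)

text \<open>Strong induction on \<open>card D\<close>. For a nonempty proper subset \<open>I\<close>
  both factors of the product rule are smaller instances, one of them for a contracted family, which
  is why \<open>L\<close> varies. For \<open>I = D\<close> the product rule says nothing; this face
  is the only unknown in the deletion relation and is found by cancelling a finite amount. Once all
  faces are known, the volume follows after division by \<open>card D\<close>, and
  \<open>D = {}\<close> is a single point.\<close>

lemma emeasure_polymatroid_and_facets:
  assumes "finite L" "finite D"
  shows "emeasure (PiL D) (polymatroid L D) = ennreal (\<Sum>a\<in>full L D. weight L a)
    \<and> (\<forall>i\<in>D. emeasure (PiL (D - {i})) (face_proj L D D i) = ennreal (\<Sum>a\<in>split_at L D D. weight L a))"
  using assms
proof (induction "card D" arbitrary: D L rule: less_induct)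
  case less
  note fin = less.prems
  have proper: "emeasure (PiL (D - {i})) (face_proj L D I i) = ennreal (\<Sum>a\<in>split_at L D I. weight L a)"
    if I: "I \<subseteq> D" "i \<in> I" "I \<noteq> D" for I i
  proof -
    have finI: "finite I" "finite (D - I)" "finite (avoid L I)"
      using fin finite_subset[OF I(1)] finite_subset[OF avoid_subset] by auto
    have "card I < card D" using I fin by (intro psubset_card_mono) auto
    then have 1: "emeasure (PiL (I - {i})) (face_proj L I I i) = ennreal (\<Sum>a\<in>split_at L I I. weight L a)"
      using less.hyps[of I L] fin finI I by auto
    have "card (D - I) < card D" using I fin by (intro psubset_card_mono) auto
    then have 2: "emeasure (PiL (D - I)) (polymatroid (avoid L I) (D - I))
        = ennreal (\<Sum>a\<in>full (avoid L I) (D - I). weight (avoid L I) a)"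
      using less.hyps[of "D - I" "avoid L I"] finI by auto
    have "I \<noteq> {}" using I by auto
    then show ?thesis
      unfolding emeasure_face_proj[OF fin I(2,1)] 1 2 sum_weight_split_at[OF fin I(1) \<open>I \<noteq> {}\<close>]
      by (simp add: ennreal_mult sum_weight_nonneg)
  qed
  have whole: "emeasure (PiL (D - {i})) (face_proj L D D i) = ennreal (\<Sum>a\<in>split_at L D D. weight L a)"
    if i: "i \<in> D" for i
  proof -
    let ?S = "{I. I \<subseteq> D \<and> i \<in> I}"
    let ?r = "\<Sum>I\<in>?S - {D}. \<Sum>a\<in>split_at L D I. weight L a"
    have finS: "finite ?S" by (rule finite_Pow_in[OF fin(2)])
    have D: "D \<in> ?S" using i by simp
    have r0: "0 \<le> ?r" by (intro sum_nonneg weight_nonneg)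
    have "card (D - {i}) < card D" using i fin by (intro psubset_card_mono) auto
    then have "emeasure (PiL (D - {i})) (polymatroid L (D - {i})) = ennreal (\<Sum>a\<in>full L (D - {i}). weight L a)"
      using less.hyps[of "D - {i}" L] fin by auto
    also have "(\<Sum>a\<in>full L (D - {i}). weight L a) = (\<Sum>I\<in>?S. \<Sum>a\<in>split_at L D I. weight L a)"
      unfolding full_Diff_eq_UN_split_at[OF fin i] by (rule sum_UN_split_at[OF fin]) auto
    also have "\<dots> = (\<Sum>a\<in>split_at L D D. weight L a) + ?r"
      by (rule sum.remove[OF finS D])
    finally have 1: "emeasure (PiL (D - {i})) (polymatroid L (D - {i}))
        = ennreal (\<Sum>a\<in>split_at L D D. weight L a) + ennreal ?r"
      using r0 sum_weight_nonneg by (simp add: ennreal_plus)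
    have "emeasure (PiL (D - {i})) (polymatroid L (D - {i}))
        = emeasure (PiL (D - {i})) (face_proj L D D i)
          + (\<Sum>I\<in>?S - {D}. emeasure (PiL (D - {i})) (face_proj L D I i))"
      unfolding emeasure_polymatroid_Diff[OF fin i] by (rule sum.remove[OF finS D])
    also have "(\<Sum>I\<in>?S - {D}. emeasure (PiL (D - {i})) (face_proj L D I i))
        = (\<Sum>I\<in>?S - {D}. ennreal (\<Sum>a\<in>split_at L D I. weight L a))"
      by (intro sum.cong refl proper) auto
    also have "\<dots> = ennreal ?r"
      by (intro sum_ennreal sum_weight_nonneg)
    finally show ?thesis using 1 by (simp add: ennreal_add_left_cancel add.commute[of _ "ennreal ?r"])
  qed
  have "emeasure (PiL D) (polymatroid L D) = ennreal (\<Sum>a\<in>full L D. weight L a)"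
  proof (cases "D = {}")
    case True
    have "full L {} = {\<lambda>_. 0}"
    proof (intro equalityI subsetI)
      fix a assume a: "a \<in> full L {}"
      then have d: "a \<in> drac L {}" by (simp add: full_def)
      have "a j = 0" for j
        using dracD(1)[OF d, of j] dracD(2)[OF d, of "{j}"] by (cases "j \<in> L") auto
      then show "a \<in> {\<lambda>_. 0}" by auto
    qed (auto simp: full_def drac_def)
    moreover have "polymatroid L {} = {\<lambda>_. undefined}" by (auto simp: polymatroid_def)
    ultimately show ?thesis using True by (simp add: weight_def)
  next
    case False
    define pt where "pt I = (SOME i. i \<in> I)" for I :: "'n set"
    have pt: "pt I \<in> I" if "I \<noteq> {}" for I
      unfolding pt_def using that by (simp add: some_in_eq)
    have "of_nat (card D) * emeasure (PiL D) (polymatroid L D) = (\<Sum>I\<in>{I. I \<subseteq> D \<and> I \<noteq> {}}.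
        ennreal (rank L I) * emeasure (PiL (D - {pt I})) (face_proj L D I (pt I)))"
      by (rule card_mult_emeasure_polymatroid[OF fin pt])
    also have "\<dots> = (\<Sum>I\<in>{I. I \<subseteq> D \<and> I \<noteq> {}}. ennreal (rank L I * (\<Sum>a\<in>split_at L D I. weight L a)))"
    proof (rule sum.cong[OF refl])
      fix I assume "I \<in> {I. I \<subseteq> D \<and> I \<noteq> {}}"
      then have I: "I \<subseteq> D" "pt I \<in> I" using pt by auto
      have "emeasure (PiL (D - {pt I})) (face_proj L D I (pt I)) = ennreal (\<Sum>a\<in>split_at L D I. weight L a)"
        using proper[OF I] whole[of "pt I"] I by (cases "I = D") auto
      then show "ennreal (rank L I) * emeasure (PiL (D - {pt I})) (face_proj L D I (pt I))
          = ennreal (rank L I * (\<Sum>a\<in>split_at L D I. weight L a))"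
        by (simp add: ennreal_mult rank_nonneg sum_weight_nonneg)
    qed
    also have "\<dots> = ennreal (real (card D) * (\<Sum>a\<in>full L D. weight L a))"
      unfolding card_mult_sum_weight_full[OF fin False]
      by (intro sum_ennreal mult_nonneg_nonneg rank_nonneg sum_weight_nonneg)
    also have "\<dots> = of_nat (card D) * ennreal (\<Sum>a\<in>full L D. weight L a)"
      by (simp add: ennreal_mult sum_weight_nonneg ennreal_of_nat_eq_real_of_nat)
    finally show ?thesis
      using False fin by (simp add: ennreal_mult_cancel_left)
  qed
  then show ?case using whole by simp
qed

lemma emeasure_face_proj_eq_weight:
  assumes "finite L" "finite D" "i \<in> I" "I \<subseteq> D"
  shows "emeasure (PiL (D - {i})) (face_proj L D I i) = ennreal (\<Sum>a\<in>split_at L D I. weight L a)"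
proof -
  have finI: "finite I" "finite (D - I)" "finite (avoid L I)" "I \<noteq> {}"
    using assms finite_subset[OF assms(4)] finite_subset[OF avoid_subset] by auto
  show ?thesis
    using emeasure_polymatroid_and_facets[OF assms(1) finI(1)]
      emeasure_polymatroid_and_facets[OF finI(3,2)] assms(3)
    by (simp add: emeasure_face_proj[OF assms] sum_weight_split_at[OF assms(1,2,4) finI(4)]
        ennreal_mult sum_weight_nonneg)
qed

end

section \<open>Inequalities for the sum of cross-polytopes\<close>

text \<open>With positive coefficients only, \<open>D\<close> consists of exactly the coordinates in
  which \<open>Q\<close> extends: each nonempty subset of \<open>D\<close> has rank at least 1, and
  the dimension of \<open>Q\<close> is \<open>card D\<close>.\<close>

locale finite_hypergraph = hypergraph N k
  for N :: "'j \<Rightarrow> 'n::finite set" and k :: "'j \<Rightarrow> nat" +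
  fixes L :: "'j set"
  assumes finite_L: "finite L" and k_pos: "\<And>j. j \<in> L \<Longrightarrow> 0 < k j"
begin

definition D :: "'n set" where "D = \<Union>(N ` L)"

definition Q :: "(real ^ 'n) set" where
  "Q = (\<Sum>j\<in>L. (\<lambda>x. real (k j) *\<^sub>R x) ` cross_polytope (N j))"

definition coord_body :: "('n set \<Rightarrow> real) \<Rightarrow> (real ^ 'n) set" where
  "coord_body c = {x. \<forall>A. (\<Sum>i\<in>A. \<bar>x $ i\<bar>) \<le> c A}"

section \<open>The inequalities hold on the Minkowski sum\<close>

lemma convex_coord_body: "convex (coord_body c)"
proof (rule convexI)
  fix x y :: "real ^ 'n" and u v :: real
  assume x: "x \<in> coord_body c" and y: "y \<in> coord_body c" and uv: "0 \<le> u" "0 \<le> v" "u + v = 1"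
  have "(\<Sum>i\<in>A. \<bar>(u *\<^sub>R x + v *\<^sub>R y) $ i\<bar>) \<le> c A" for A
  proof -
    have "(\<Sum>i\<in>A. \<bar>(u *\<^sub>R x + v *\<^sub>R y) $ i\<bar>) \<le> (\<Sum>i\<in>A. u * \<bar>x $ i\<bar> + v * \<bar>y $ i\<bar>)"
      using uv by (intro sum_mono) (auto intro!: order_trans[OF abs_triangle_ineq] simp: abs_mult)
    also have "\<dots> = u * (\<Sum>i\<in>A. \<bar>x $ i\<bar>) + v * (\<Sum>i\<in>A. \<bar>y $ i\<bar>)"
      by (simp add: sum.distrib sum_distrib_left)
    also have "\<dots> \<le> u * c A + v * c A"
      using x y uv by (intro add_mono mult_left_mono) (auto simp: coord_body_def)
    also have "\<dots> = c A" using uv(3) by (simp flip: distrib_right)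
    finally show ?thesis .
  qed
  then show "u *\<^sub>R x + v *\<^sub>R y \<in> coord_body c" by (simp add: coord_body_def)
qed

lemma sum_abs_axis:
  "(\<Sum>i\<in>A. \<bar>axis l (t :: real) $ i\<bar>) = (if l \<in> A then \<bar>t\<bar> else 0)" for l :: 'n
proof -
  have "(\<Sum>i\<in>A. \<bar>axis l t $ i\<bar>) = (\<Sum>i\<in>A. if i = l then \<bar>t\<bar> else 0)"
    by (intro sum.cong) (auto simp: axis_def)
  then show ?thesis by (simp add: sum.delta)
qed

lemma axis_uminus: "- axis i (1 :: real) = axis i (- 1)" for i :: 'n
  by (simp add: vec_eq_iff axis_def)

text \<open>The bound is the rank function of a single hyperedge with coefficient 1;
  \<open>rank L\<close> is the sum of such functions, scaled by the coefficients.\<close>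

lemma cross_polytope_subset:
  "cross_polytope I \<subseteq> coord_body (\<lambda>A. if I \<inter> A = {} then 0 else 1)" for I :: "'n set"
proof (cases "I = {}")
  case True
  then show ?thesis by (simp add: cross_polytope_def coord_body_def)
next
  case False
  have "(\<Union>i\<in>I. {axis i 1, - axis i 1}) \<subseteq> coord_body (\<lambda>A. if I \<inter> A = {} then 0 else 1)"
    unfolding coord_body_def axis_uminus by (auto simp: sum_abs_axis split: if_splits)
  then show ?thesis
    using False convex_coord_body by (simp add: cross_polytope_def hull_minimal)
qed

lemma Q_subset: "Q \<subseteq> coord_body (rank L)"
proof
  fix x assume "x \<in> Q"
  then obtain y where y: "\<And>j. j \<in> L \<Longrightarrow> y j \<in> (\<lambda>x. real (k j) *\<^sub>R x) ` cross_polytope (N j)"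
    and x: "x = sum y L"
    unfolding Q_def set_sum_alt[OF finite_L] by blast
  have yb: "(\<Sum>i\<in>A. \<bar>y j $ i\<bar>) \<le> (if N j \<inter> A = {} then 0 else real (k j))" if "j \<in> L" for j A
  proof -
    obtain z where z: "z \<in> cross_polytope (N j)" "y j = real (k j) *\<^sub>R z" using y[OF \<open>j \<in> L\<close>] by blast
    have "(\<Sum>i\<in>A. \<bar>z $ i\<bar>) \<le> (if N j \<inter> A = {} then 0 else 1)"
      using subsetD[OF cross_polytope_subset z(1)] unfolding coord_body_def by blast
    from mult_left_mono[OF this, of "real (k j)"] show ?thesis
      by (simp add: z(2) abs_mult sum_distrib_left split: if_splits)
  qed
  have "(\<Sum>i\<in>A. \<bar>x $ i\<bar>) \<le> rank L A" for A
  proof -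
    have "(\<Sum>i\<in>A. \<bar>x $ i\<bar>) \<le> (\<Sum>i\<in>A. \<Sum>j\<in>L. \<bar>y j $ i\<bar>)"
      by (intro sum_mono) (simp add: x sum_abs)
    also have "\<dots> = (\<Sum>j\<in>L. \<Sum>i\<in>A. \<bar>y j $ i\<bar>)" by (rule sum.swap)
    also have "\<dots> \<le> (\<Sum>j\<in>L. if N j \<inter> A = {} then 0 else real (k j))"
      by (intro sum_mono yb)
    finally show ?thesis by (simp add: rank_indicator[OF finite_L])
  qed
  then show "x \<in> coord_body (rank L)" by (simp add: coord_body_def)
qed

section \<open>Support functions and the reverse inclusion\<close>

text \<open>Evaluated at the absolute values of a vector, this is the support function of the
  cross-polytope on \<open>S\<close>. The default 0 for the empty set fits the cross-polytope
  \<open>{0}\<close>.\<close>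

definition max_on :: "('n \<Rightarrow> real) \<Rightarrow> 'n set \<Rightarrow> real" where
  "max_on \<beta> S = (if S = {} then 0 else Max (\<beta> ` S))"

lemma max_on_ge: "i \<in> S \<Longrightarrow> \<beta> i \<le> max_on \<beta> S"
  by (auto simp: max_on_def)

lemma max_on_attained:
  assumes "S \<noteq> {}"
  shows "\<exists>i\<in>S. max_on \<beta> S = \<beta> i"
proof -
  have "Max (\<beta> ` S) \<in> \<beta> ` S" using assms by (intro Max_in) auto
  then obtain i where "i \<in> S" "Max (\<beta> ` S) = \<beta> i" by (elim imageE)
  then show ?thesis using assms by (intro bexI[of _ i]) (simp_all add: max_on_def)
qed

text \<open>Layer-cake decomposition of \<open>\<beta>\<close> into indicator functions of its superlevel sets.\<close>
lemma sum_mult_le_max_on: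
  fixes y \<beta> :: "'n \<Rightarrow> real"
  assumes "\<And>A. (\<Sum>i\<in>A. y i) \<le> rank L A" and "\<And>i. 0 \<le> \<beta> i"
  shows "(\<Sum>i\<in>UNIV. \<beta> i * y i) \<le> (\<Sum>j\<in>L. real (k j) * max_on \<beta> (N j))"
  using assms(2)
proof (induction "card {i. \<beta> i \<noteq> 0}" arbitrary: \<beta> rule: less_induct)
  case less
  let ?S = "{i. \<beta> i \<noteq> 0}"
  show ?case
  proof (cases "?S = {}")
    case True
    then have \<beta>0: "\<beta> i = 0" for i by auto
    have "max_on \<beta> S = 0" for S
    proof (cases "S = {}")
      case False
      then show ?thesis using max_on_attained[of S \<beta>] \<beta>0 by auto
    qed (simp add: max_on_def)
    then show ?thesis using \<beta>0 by simp
  next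
    case False
    \<comment> \<open>The thickness of the lowest layer. Removing it takes at least one coordinate
      out of the support, so the induction descends.\<close>
    define t where "t = Min (\<beta> ` ?S)"
    have tS: "t \<in> \<beta> ` ?S" unfolding t_def using False by (intro Min_in) auto
    have t: "t \<le> \<beta> i" if "i \<in> ?S" for i unfolding t_def using that by (intro Min_le) auto
    have t0: "0 < t" using tS less.prems by (auto simp: less_le)
    define \<beta>' where "\<beta>' i = (if i \<in> ?S then \<beta> i - t else 0)" for i
    have \<beta>'0: "0 \<le> \<beta>' i" for i using t by (simp add: \<beta>'_def)
    have \<beta>: "\<beta> i = \<beta>' i + (if i \<in> ?S then t else 0)" for i by (simp add: \<beta>'_def)
    obtain i0 where i0: "i0 \<in> ?S" "t = \<beta> i0" using tS by (elim imageE)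
    have "{i. \<beta>' i \<noteq> 0} \<subset> ?S"
    proof
      show "{i. \<beta>' i \<noteq> 0} \<subseteq> ?S" by (auto simp: \<beta>'_def)
      have "i0 \<notin> {i. \<beta>' i \<noteq> 0}" using i0 by (simp add: \<beta>'_def)
      then show "{i. \<beta>' i \<noteq> 0} \<noteq> ?S" using i0(1) by blast
    qed
    then have "card {i. \<beta>' i \<noteq> 0} < card ?S" by (intro psubset_card_mono) auto
    then have IH: "(\<Sum>i\<in>UNIV. \<beta>' i * y i) \<le> (\<Sum>j\<in>L. real (k j) * max_on \<beta>' (N j))"
      using less.hyps \<beta>'0 by blast
    \<comment> \<open>Putting the layer back raises the maximum over a hyperedge that meets the
      support by at least \<open>t\<close>. In the third case below the remaining maximum is 0,
      attained off the support, while some vertex of the hyperedge lies in the support and has value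
      at least \<open>t\<close>.\<close>
    have mx: "max_on \<beta>' (N j) + (if N j \<inter> ?S = {} then 0 else t) \<le> max_on \<beta> (N j)" for j
    proof (cases "N j = {}")
      case True
      then show ?thesis by (simp add: max_on_def)
    next
      case ne: False
      obtain i where i: "i \<in> N j" "max_on \<beta>' (N j) = \<beta>' i" using max_on_attained[OF ne] by blast
      consider "i \<in> ?S" | "i \<notin> ?S" "N j \<inter> ?S = {}" | i' where "i \<notin> ?S" "i' \<in> N j" "i' \<in> ?S" by blast
      then show ?thesis
      proof cases
        case 1
        then have ne': "N j \<inter> ?S \<noteq> {}" using i(1) by auto
        have "max_on \<beta>' (N j) + t = \<beta> i" using 1 i(2) \<beta>'_def[of i] by simp
        then show ?thesis unfolding if_not_P[OF ne'] using max_on_ge[OF i(1), of \<beta>] by linarith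
      next
        case 2
        then have "max_on \<beta>' (N j) = \<beta> i" using i(2) \<beta>'_def[of i] by simp
        then show ?thesis unfolding if_P[OF 2(2)] using max_on_ge[OF i(1), of \<beta>] by linarith
      next
        case 3
        have ne': "N j \<inter> ?S \<noteq> {}" using 3(2,3) by blast
        have "\<beta>' i = 0" using 3(1) by (simp add: \<beta>'_def)
        then show ?thesis
          unfolding if_not_P[OF ne'] using i(2) max_on_ge[OF 3(2), of \<beta>] t[OF 3(3)] by linarith
      qed
    qed
    have "(\<Sum>i\<in>UNIV. \<beta> i * y i) = (\<Sum>i\<in>UNIV. \<beta>' i * y i + (if i \<in> ?S then t * y i else 0))"
      by (intro sum.cong refl) (subst \<beta>, simp add: distrib_right)
    also have "\<dots> = (\<Sum>i\<in>UNIV. \<beta>' i * y i) + t * (\<Sum>i\<in>?S. y i)"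
      by (simp add: sum.distrib sum_distrib_left sum.inter_restrict[symmetric] flip: sum.inter_filter)
    also have "\<dots> \<le> (\<Sum>j\<in>L. real (k j) * max_on \<beta>' (N j)) + t * rank L ?S"
      using t0 by (intro add_mono IH mult_left_mono assms(1)) auto
    also have "\<dots> = (\<Sum>j\<in>L. real (k j) * (max_on \<beta>' (N j) + (if N j \<inter> ?S = {} then 0 else t)))"
      unfolding rank_indicator[OF finite_L] sum_distrib_left sum.distrib[symmetric]
      by (intro sum.cong) (auto simp: algebra_simps)
    also have "\<dots> \<le> (\<Sum>j\<in>L. real (k j) * max_on \<beta> (N j))"
      by (intro sum_mono mult_left_mono mx) auto
    finally show ?thesis .
  qed
qed

lemma compact_cross_polytope: "compact (cross_polytope I)" for I :: "'n set"
  by (auto simp: cross_polytope_def intro!: finite_imp_compact_convex_hull)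

lemma convex_cross_polytope: "convex (cross_polytope I)" for I :: "'n set"
  by (simp add: cross_polytope_def)

lemma convex_Q: "convex Q"
  unfolding Q_def by (intro convex_set_sum convex_scaling convex_cross_polytope)

lemma compact_set_plus:
  fixes S T :: "(real ^ 'n) set"
  assumes "compact S" "compact T"
  shows "compact (S + T)"
proof -
  have "S + T = (\<lambda>p. fst p + snd p) ` (S \<times> T)" by (force simp: set_plus_def)
  then show ?thesis
    using assms by (auto intro!: compact_continuous_image compact_Times continuous_intros)
qed

lemma compact_Q: "compact Q"
proof -
  have "compact (\<Sum>j\<in>M. (\<lambda>x. real (k j) *\<^sub>R x) ` cross_polytope (N j))" if "finite M" for M
    using that
  proof (induction M rule: finite_induct)
    case (insert j M)
    then show ?case by (simp add: compact_set_plus compact_scaling compact_cross_polytope)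
  qed (simp add: set_zero)
  then show ?thesis unfolding Q_def using finite_L by blast
qed

lemma cross_polytope_support:
  fixes \<alpha> :: "real ^ 'n"
  shows "\<exists>v\<in>cross_polytope I. inner \<alpha> v = max_on (\<lambda>i. \<bar>\<alpha> $ i\<bar>) I"
proof (cases "I = {}")
  case True
  then show ?thesis by (simp add: cross_polytope_def max_on_def)
next
  case False
  then obtain i where i: "i \<in> I" "max_on (\<lambda>i. \<bar>\<alpha> $ i\<bar>) I = \<bar>\<alpha> $ i\<bar>"
    using max_on_attained by meson
  let ?v = "if 0 \<le> \<alpha> $ i then axis i 1 else - axis i 1 :: real ^ 'n"
  have "?v \<in> cross_polytope I"
    using i(1) False by (auto simp: cross_polytope_def intro!: hull_inc)
  moreover have "inner \<alpha> ?v = \<bar>\<alpha> $ i\<bar>" by (simp add: inner_axis)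
  ultimately show ?thesis using i(2) by metis
qed

text \<open>By separation it is enough to compare support functions. That of the Minkowski sum is
  the sum of those of its summands, and the layer-cake estimate bounds each linear functional on
  \<open>coord_body (rank L)\<close> by this very sum.\<close>

lemma Q_eq: "Q = coord_body (rank L)"
proof (intro equalityI Q_subset subsetI)
  fix x :: "real ^ 'n" assume x: "x \<in> coord_body (rank L)"
  show "x \<in> Q"
  proof (rule ccontr)
    assume "x \<notin> Q"
    then obtain a b where ab: "inner a x < b" "\<And>y. y \<in> Q \<Longrightarrow> b < inner a y"
      using separating_hyperplane_closed_point[OF convex_Q compact_imp_closed[OF compact_Q] \<open>x \<notin> Q\<close>]
      by auto
    \<comment> \<open>Separation leaves \<open>Q\<close> on the side of larger values, whereas
      support functions are maxima.\<close>
    define \<alpha> where "\<alpha> = - a"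
    have "\<forall>j. \<exists>v. v \<in> cross_polytope (N j) \<and> inner \<alpha> v = max_on (\<lambda>i. \<bar>\<alpha> $ i\<bar>) (N j)"
      using cross_polytope_support[of _ \<alpha>] by blast
    then obtain v where "\<forall>j. v j \<in> cross_polytope (N j) \<and> inner \<alpha> (v j) = max_on (\<lambda>i. \<bar>\<alpha> $ i\<bar>) (N j)"
      unfolding choice_iff ..
    then have v: "v j \<in> cross_polytope (N j)" "inner \<alpha> (v j) = max_on (\<lambda>i. \<bar>\<alpha> $ i\<bar>) (N j)" for j
      by auto
    have "(\<Sum>j\<in>L. real (k j) *\<^sub>R v j) \<in> Q"
      unfolding Q_def set_sum_alt[OF finite_L] using v(1) by blast
    then have "inner \<alpha> (\<Sum>j\<in>L. real (k j) *\<^sub>R v j) < - b" using ab(2) by (force simp: \<alpha>_def)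
    moreover have "inner \<alpha> (\<Sum>j\<in>L. real (k j) *\<^sub>R v j) = (\<Sum>j\<in>L. real (k j) * max_on (\<lambda>i. \<bar>\<alpha> $ i\<bar>) (N j))"
      by (simp add: inner_sum_right v(2))
    moreover have "(\<Sum>i\<in>UNIV. \<bar>\<alpha> $ i\<bar> * \<bar>x $ i\<bar>) \<le> (\<Sum>j\<in>L. real (k j) * max_on (\<lambda>i. \<bar>\<alpha> $ i\<bar>) (N j))"
      using x by (intro sum_mult_le_max_on) (auto simp: coord_body_def)
    moreover have "inner \<alpha> x \<le> (\<Sum>i\<in>UNIV. \<bar>\<alpha> $ i\<bar> * \<bar>x $ i\<bar>)"
      unfolding inner_vec_def by (intro sum_mono) (simp add: abs_mult[symmetric])
    ultimately show False using ab(1) by (simp add: \<alpha>_def)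
  qed
qed

end

section \<open>Facets\<close>

context finite_hypergraph
begin

definition supp :: "real ^ 'n \<Rightarrow> 'n set" where
  "supp \<epsilon> = {i. \<epsilon> $ i \<noteq> 0}"

text \<open>Candidates for outer facet normals. A bound on
  \<open>\<Sum>i\<in>A. \<bar>x $ i\<bar>\<close> unfolds into linear bounds, one for each choice of
  signs on \<open>A\<close>. The zero vector defines no hyperplane and is left out.\<close>

definition signs :: "(real ^ 'n) set" where
  "signs = {\<epsilon>. (\<forall>i. \<epsilon> $ i \<in> {-1, 0, 1}) \<and> supp \<epsilon> \<subseteq> D \<and> supp \<epsilon> \<noteq> {}}"

definition V :: "(real ^ 'n) set" where
  "V = {x. \<forall>i. i \<notin> D \<longrightarrow> x $ i = 0}"

definition level :: "real ^ 'n \<Rightarrow> real" where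
  "level \<epsilon> = rank L (supp \<epsilon>)"

definition face :: "real ^ 'n \<Rightarrow> (real ^ 'n) set" where
  "face \<epsilon> = Q \<inter> {x. inner \<epsilon> x = level \<epsilon>}"

definition hyp :: "real ^ 'n \<Rightarrow> (real ^ 'n) set" where
  "hyp \<epsilon> = V \<inter> {x. inner \<epsilon> x = level \<epsilon>}"

lemma rank_pos:
  assumes "A \<subseteq> D" "A \<noteq> {}"
  shows "1 \<le> rank L A"
proof -
  obtain i where i: "i \<in> A" using assms(2) by blast
  then have "i \<in> \<Union>(N ` L)" using assms(1) unfolding D_def by blast
  then obtain j where ij: "i \<in> A" "j \<in> L" "i \<in> N j" using i by blast
  have "1 \<le> real (k j)" using k_pos[OF ij(2)] by simp
  also have "real (k j) = (\<Sum>j\<in>{j}. real (k j))" by simp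
  also have "\<dots> \<le> rank L A"
    unfolding rank_def using ij finite_L by (intro sum_mono2) auto
  finally show ?thesis .
qed

lemma level_pos: "\<epsilon> \<in> signs \<Longrightarrow> 0 < level \<epsilon>"
  using rank_pos[of "supp \<epsilon>"] by (simp add: signs_def level_def)

lemma QD: "x \<in> Q \<Longrightarrow> (\<Sum>i\<in>A. \<bar>x $ i\<bar>) \<le> rank L A"
  by (simp add: Q_eq coord_body_def)

lemma Q_subset_V: "Q \<subseteq> V"
proof
  fix x assume x: "x \<in> Q"
  have "x $ i = 0" if "i \<notin> D" for i
  proof -
    have "rank L {i} = 0" using that by (auto simp: rank_def D_def intro!: sum.neutral)
    then show ?thesis using QD[OF x, of "{i}"] by simp
  qed
  then show "x \<in> V" by (simp add: V_def)
qed

lemma signs_cases: "\<epsilon> \<in> signs \<Longrightarrow> i \<in> supp \<epsilon> \<Longrightarrow> \<epsilon> $ i = 1 \<or> \<epsilon> $ i = -1"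
  by (auto simp: signs_def supp_def)

lemma signs_sq: "\<epsilon> \<in> signs \<Longrightarrow> i \<in> supp \<epsilon> \<Longrightarrow> \<epsilon> $ i * \<epsilon> $ i = 1"
  using signs_cases[of \<epsilon> i] by auto

lemma inner_supp: "inner \<epsilon> x = (\<Sum>i\<in>supp \<epsilon>. \<epsilon> $ i * x $ i)"
  unfolding inner_vec_def by (intro sum.mono_neutral_cong_right) (auto simp: supp_def)

lemma inner_le_sum_abs:
  assumes "\<epsilon> \<in> signs"
  shows "inner \<epsilon> x \<le> (\<Sum>i\<in>supp \<epsilon>. \<bar>x $ i\<bar>)"
  unfolding inner_supp
proof (rule sum_mono)
  fix i assume "i \<in> supp \<epsilon>"
  then show "\<epsilon> $ i * x $ i \<le> \<bar>x $ i\<bar>" using signs_cases[OF assms, of i] by auto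
qed

lemma inner_le_level: "\<epsilon> \<in> signs \<Longrightarrow> x \<in> Q \<Longrightarrow> inner \<epsilon> x \<le> level \<epsilon>"
  unfolding level_def using inner_le_sum_abs QD order_trans by blast

lemma axis_in_Q:
  assumes "i \<in> D" "\<bar>t\<bar> \<le> 1"
  shows "axis i t \<in> Q"
  unfolding Q_eq coord_body_def mem_Collect_eq sum_abs_axis
proof
  fix A
  show "(if i \<in> A then \<bar>t\<bar> else 0) \<le> rank L A"
  proof (cases "i \<in> A")
    case True
    then have "1 \<le> rank L {i}" "rank L {i} \<le> rank L A"
      using rank_pos[of "{i}"] rank_mono[OF finite_L, of "{i}" A] assms(1) by auto
    then show ?thesis using True assms(2) by simp
  qed (simp add: rank_nonneg)
qed

lemma zero_in_Q: "0 \<in> Q"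
  by (simp add: Q_eq coord_body_def rank_nonneg)

lemma subspace_V: "subspace V"
  by (auto simp: subspace_def V_def)

lemma affine_hull_Q: "affine hull Q = V"
proof -
  have "affine hull Q = span Q"
    using zero_in_Q by (intro affine_hull_span_0 hull_inc)
  also have "\<dots> = V"
  proof
    show "span Q \<subseteq> V" by (rule span_minimal[OF Q_subset_V subspace_V])
    show "V \<subseteq> span Q"
    proof
      fix x assume x: "x \<in> V"
      have "x = (\<Sum>i\<in>UNIV. x $ i *\<^sub>R axis i 1)"
        using basis_expansion[of x] by (simp add: scalar_mult_eq_scaleR)
      also have "\<dots> \<in> span Q"
      proof (intro span_sum)
        fix i
        show "x $ i *\<^sub>R axis i 1 \<in> span Q"
        proof (cases "i \<in> D")
          case True
          then show ?thesis using axis_in_Q[OF True, of 1] by (intro span_mul span_base) auto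
        next
          case False
          then show ?thesis using x by (simp add: V_def span_zero)
        qed
      qed
      finally show "x \<in> span Q" .
    qed
  qed
  finally show ?thesis .
qed

lemma aff_dim_V: "aff_dim V = int (card D)"
  using aff_dim_subspace[OF subspace_V] dim_substandard_cart[of D, where 'a = real]
  by (simp add: dim_vec_eq V_def)

lemma aff_dim_Q: "aff_dim Q = int (card D)"
  using aff_dim_affine_hull[of Q] by (simp add: affine_hull_Q aff_dim_V)

lemma face_subset_hyp: "face \<epsilon> \<subseteq> hyp \<epsilon>"
  using Q_subset_V by (auto simp: face_def hyp_def)

lemma affine_hyp: "affine (hyp \<epsilon>)"
  unfolding hyp_def by (intro affine_Int subspace_imp_affine subspace_V affine_hyperplane)

lemma axis_in_hyp:
  assumes "\<epsilon> \<in> signs" "i \<in> supp \<epsilon>"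
  shows "axis i (\<epsilon> $ i * level \<epsilon>) \<in> hyp \<epsilon>"
proof -
  have "i \<in> D" using assms by (auto simp: signs_def)
  then have "axis i (\<epsilon> $ i * level \<epsilon>) \<in> V" by (auto simp: V_def axis_def)
  moreover have "inner \<epsilon> (axis i (\<epsilon> $ i * level \<epsilon>)) = level \<epsilon>"
    using signs_sq[OF assms] by (simp add: inner_axis mult.assoc[symmetric])
  ultimately show ?thesis by (simp add: hyp_def)
qed

lemma aff_dim_hyp:
  assumes "\<epsilon> \<in> signs"
  shows "aff_dim (hyp \<epsilon>) = int (card D) - 1"
proof -
  obtain i where "i \<in> supp \<epsilon>" using assms by (auto simp: signs_def)
  then have "V \<inter> {x. inner \<epsilon> x = level \<epsilon>} \<noteq> {}" using axis_in_hyp[OF assms] by (auto simp: hyp_def)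
  moreover have "\<not> V \<subseteq> {x. inner \<epsilon> x = level \<epsilon>}"
  proof
    assume "V \<subseteq> {x. inner \<epsilon> x = level \<epsilon>}"
    then have "inner \<epsilon> 0 = level \<epsilon>" using subspace_0[OF subspace_V] by blast
    then show False using level_pos[OF assms] by simp
  qed
  ultimately show ?thesis
    unfolding hyp_def using aff_dim_affine_Int_hyperplane[OF subspace_imp_affine[OF subspace_V], of \<epsilon> "level \<epsilon>"]
    by (simp add: aff_dim_V)
qed

lemma face_face_of: "\<epsilon> \<in> signs \<Longrightarrow> face \<epsilon> face_of Q"
  unfolding face_def
  by (rule face_of_Int_supporting_hyperplane_le[OF convex_Q inner_le_level])

lemma face_neq_Q:
  assumes "\<epsilon> \<in> signs"
  shows "face \<epsilon> \<noteq> Q"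
proof
  assume "face \<epsilon> = Q"
  then have "0 \<in> face \<epsilon>" using zero_in_Q by simp
  then show False using level_pos[OF assms] by (simp add: face_def)
qed

lemma finite_signs: "finite signs"
proof (rule finite_subset)
  show "signs \<subseteq> vec_lambda ` (UNIV \<rightarrow>\<^sub>E {-1, 0, 1})"
  proof
    fix \<epsilon> assume "\<epsilon> \<in> signs"
    then have "($) \<epsilon> \<in> UNIV \<rightarrow>\<^sub>E {-1, 0, 1}" by (auto simp: signs_def)
    then show "\<epsilon> \<in> vec_lambda ` (UNIV \<rightarrow>\<^sub>E {-1, 0, 1})"
      by (intro image_eqI[of _ _ "($) \<epsilon>"]) (simp_all add: vec_nth_inverse)
  qed
  show "finite (vec_lambda ` (UNIV \<rightarrow>\<^sub>E {-1, 0, 1 :: real}))"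
    by (intro finite_imageI finite_PiE) auto
qed

text \<open>Strict inequalities for finitely many sign vectors define an open set, and within
  \<open>V\<close> they already imply membership in \<open>Q\<close>: the signs of \<open>y\<close>
  on \<open>A\<close> form a sign vector whose inequality bounds the sum over
  \<open>A\<close>.\<close>

lemma strict_imp_rel_interior:
  assumes "x \<in> Q" "\<And>\<epsilon>. \<epsilon> \<in> signs \<Longrightarrow> inner \<epsilon> x < level \<epsilon>"
  shows "x \<in> rel_interior Q"
proof -
  let ?T = "\<Inter>\<epsilon>\<in>signs. {y. inner \<epsilon> y < level \<epsilon>}"
  have "open ?T" using finite_signs by (intro open_INT ballI open_halfspace_lt)
  moreover have "x \<in> ?T \<inter> Q" using assms by blast
  moreover have "?T \<inter> affine hull Q \<subseteq> Q"
  proof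
    fix y assume "y \<in> ?T \<inter> affine hull Q"
    then have y: "\<And>\<epsilon>. \<epsilon> \<in> signs \<Longrightarrow> inner \<epsilon> y < level \<epsilon>" "y \<in> V" by (auto simp: affine_hull_Q)
    have "(\<Sum>i\<in>A. \<bar>y $ i\<bar>) \<le> rank L A" for A
    proof -
      define \<epsilon> where "\<epsilon> = (\<chi> i. if i \<in> A then sgn (y $ i) else 0)"
      have supp: "supp \<epsilon> = {i \<in> A. y $ i \<noteq> 0}" by (auto simp: supp_def \<epsilon>_def sgn_0_0)
      have "(\<Sum>i\<in>A. \<bar>y $ i\<bar>) = (\<Sum>i\<in>supp \<epsilon>. \<bar>y $ i\<bar>)"
        unfolding supp by (intro sum.mono_neutral_right) auto
      also have "\<dots> = inner \<epsilon> y"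
        unfolding inner_supp by (intro sum.cong) (auto simp: supp, simp add: \<epsilon>_def abs_sgn mult.commute)
      also have "\<dots> \<le> level \<epsilon>"
      \<comment> \<open>If \<open>y\<close> vanishes on \<open>A\<close>, the vector of its signs is
        0 and lies outside \<open>signs\<close>; both sides are then 0.\<close>
      proof (cases "supp \<epsilon> = {}")
        case True
        then show ?thesis unfolding inner_supp level_def by simp
      next
        case False
        have "supp \<epsilon> \<subseteq> D" using y(2) by (auto simp: supp V_def)
        moreover have "\<epsilon> $ i \<in> {-1, 0, 1}" for i by (auto simp: \<epsilon>_def sgn_if)
        ultimately have "\<epsilon> \<in> signs" using False by (simp add: signs_def)
        then show ?thesis using y(1) by (simp add: less_imp_le)
      qed
      also have "\<dots> \<le> rank L A" unfolding level_def by (rule rank_mono[OF finite_L]) (auto simp: supp)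
      finally show ?thesis .
    qed
    then show "y \<in> Q" by (simp add: Q_eq coord_body_def)
  qed
  ultimately show ?thesis unfolding mem_rel_interior by blast
qed

text \<open>A sign vector may define a redundant inequality: for the square with hyperedges
  \<open>{1}\<close> and \<open>{2}\<close> and coefficients 1, the normal (1, 1) supports only a
  vertex. The condition on the affine hull keeps the normals of facets.\<close>

definition facet_signs :: "(real ^ 'n) set" where
  "facet_signs = {\<epsilon> \<in> signs. affine hull (face \<epsilon>) = hyp \<epsilon>}"

text \<open>For \<open>i\<close> in the support the hyperplane meets axis \<open>i\<close> at
  \<open>\<epsilon> $ i * level \<epsilon>\<close>. Levels are positive, so these points recover all
  signs. Different normals thus give different facets, and the sum over facets can be
  reindexed.\<close>

lemma hyp_inj:
  assumes "\<epsilon> \<in> signs" "\<epsilon>' \<in> signs" "hyp \<epsilon> = hyp \<epsilon>'"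
  shows "\<epsilon> = \<epsilon>'"
proof -
  have "\<epsilon>' $ i = \<epsilon> $ i" if "\<epsilon> \<in> signs" "\<epsilon>' \<in> signs" "hyp \<epsilon> = hyp \<epsilon>'" "i \<in> supp \<epsilon>" for \<epsilon> \<epsilon>' i
  proof -
    have "axis i (\<epsilon> $ i * level \<epsilon>) \<in> hyp \<epsilon>'"
      using axis_in_hyp[OF that(1,4)] that(3) by simp
    then have "inner \<epsilon>' (axis i (\<epsilon> $ i * level \<epsilon>)) = level \<epsilon>'"
      by (simp add: hyp_def)
    then have *: "\<epsilon>' $ i * (\<epsilon> $ i * level \<epsilon>) = level \<epsilon>'" by (simp add: inner_axis)
    then have "i \<in> supp \<epsilon>'" using level_pos[OF that(2)] by (auto simp: supp_def)
    then show ?thesis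
      using * signs_cases[OF that(1,4)] signs_cases[OF that(2), of i] level_pos[OF that(1)] level_pos[OF that(2)]
      by auto
  qed
  then have *: "\<epsilon>' $ i = \<epsilon> $ i" if "i \<in> supp \<epsilon> \<or> i \<in> supp \<epsilon>'" for i using that assms by metis
  show ?thesis
  proof (rule vec_eq_iff[THEN iffD2], rule allI)
    fix i show "\<epsilon> $ i = \<epsilon>' $ i" using *[of i] by (cases "i \<in> supp \<epsilon> \<or> i \<in> supp \<epsilon>'") (auto simp: supp_def)
  qed
qed

lemma inj_on_face: "inj_on face facet_signs"
proof (rule inj_onI)
  fix \<epsilon> \<epsilon>' assume *: "\<epsilon> \<in> facet_signs" "\<epsilon>' \<in> facet_signs" and eq: "face \<epsilon> = face \<epsilon>'"
  then have "hyp \<epsilon> = hyp \<epsilon>'" unfolding facet_signs_def by force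
  then show "\<epsilon> = \<epsilon>'" using * by (intro hyp_inj) (auto simp: facet_signs_def)
qed

text \<open>A relative interior point of a facet lies outside the relative interior of
  \<open>Q\<close>, so some inequality is tight there. The face of that inequality contains the
  facet and is proper, so the dimensions leave no room for a difference.\<close>

lemma facets_Q: "{F. F facet_of Q} = face ` facet_signs"
proof (intro equalityI subsetI)
  fix F assume "F \<in> {F. F facet_of Q}"
  then have F: "F face_of Q" "F \<noteq> {}" "aff_dim F = aff_dim Q - 1" by (auto simp: facet_of_def)
  have "convex F" using F(1) convex_Q face_of_imp_convex by blast
  then obtain x where x: "x \<in> rel_interior F" using F(2) rel_interior_eq_empty by blast
  have FQ: "F \<subseteq> Q" using F(1) face_of_imp_subset by blast
  have "F \<noteq> Q" using F(3) by auto
  then have "x \<notin> rel_interior Q"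
    using face_of_disjoint_rel_interior[OF F(1)] x rel_interior_subset by blast
  moreover have "x \<in> Q" using x FQ rel_interior_subset by blast
  ultimately obtain \<epsilon> where \<epsilon>: "\<epsilon> \<in> signs" "\<not> inner \<epsilon> x < level \<epsilon>"
    using strict_imp_rel_interior by blast
  then have "x \<in> face \<epsilon>" using inner_le_level[OF \<epsilon>(1) \<open>x \<in> Q\<close>] \<open>x \<in> Q\<close> by (auto simp: face_def)
  then have sub: "F \<subseteq> face \<epsilon>"
    using subset_of_face_of[OF face_face_of[OF \<epsilon>(1)] FQ] x by (auto simp: disjnt_def)
  have faceQ: "face \<epsilon> \<subseteq> Q" by (auto simp: face_def)
  have Fface: "F face_of face \<epsilon>" by (rule face_of_subset[OF F(1) sub faceQ])
  have lt: "aff_dim (face \<epsilon>) < aff_dim Q"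
    by (rule face_of_aff_dim_lt[OF convex_Q face_face_of[OF \<epsilon>(1)] face_neq_Q[OF \<epsilon>(1)]])
  have "convex (face \<epsilon>)" using face_face_of[OF \<epsilon>(1)] face_of_imp_convex by blast
  then have "F = face \<epsilon>"
    using face_of_aff_dim_lt[OF _ Fface] F(3) lt by force
  moreover have "affine hull (face \<epsilon>) = hyp \<epsilon>"
    using aff_dim_eq_full_gen[OF face_subset_hyp[of \<epsilon>]] aff_dim_hyp[OF \<epsilon>(1)] F(3) aff_dim_Q
      \<open>F = face \<epsilon>\<close> hull_same[of affine "hyp \<epsilon>"] affine_hyp by (simp add: affine_hull_eq)
  ultimately show "F \<in> face ` facet_signs" using \<epsilon>(1) by (auto simp: facet_signs_def)
next
  fix F assume "F \<in> face ` facet_signs"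
  then obtain \<epsilon> where \<epsilon>: "\<epsilon> \<in> signs" "affine hull (face \<epsilon>) = hyp \<epsilon>" "F = face \<epsilon>"
    by (auto simp: facet_signs_def)
  obtain i where "i \<in> supp \<epsilon>" using \<epsilon>(1) by (auto simp: signs_def)
  then have "hyp \<epsilon> \<noteq> {}" using axis_in_hyp[OF \<epsilon>(1)] by auto
  then have "face \<epsilon> \<noteq> {}" using \<epsilon>(2) by auto
  moreover have "aff_dim (face \<epsilon>) = aff_dim Q - 1"
    using aff_dim_affine_hull[of "face \<epsilon>"] \<epsilon>(2) aff_dim_hyp[OF \<epsilon>(1)] aff_dim_Q by simp
  ultimately show "F \<in> {F. F facet_of Q}"
    using face_face_of[OF \<epsilon>(1)] \<epsilon>(3) by (simp add: facet_of_def)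
qed

end

section \<open>Lattice volumes of the facets\<close>

lemma measurable_PiL_scale:
  "(\<lambda>x. \<lambda>l\<in>B. s l * x l) \<in> PiL B \<rightarrow>\<^sub>M PiL B" for s :: "'a \<Rightarrow> real"
  by (rule measurable_restrict) (simp add: PiL_component_measurable)

lemma emeasure_PiL_flip:
  fixes s :: "'a \<Rightarrow> real"
  assumes fin: "finite B" and s: "\<And>l. l \<in> B \<Longrightarrow> s l = 1 \<or> s l = -1" and X: "X \<in> sets (PiL B)"
  shows "emeasure (PiL B) {x \<in> B \<rightarrow>\<^sub>E UNIV. (\<lambda>l\<in>B. s l * x l) \<in> X} = emeasure (PiL B) X"
proof -
  let ?\<phi> = "\<lambda>x. \<lambda>l\<in>B. s l * x l"
  have inv: "?\<phi> (?\<phi> x) = x" if "x \<in> B \<rightarrow>\<^sub>E UNIV" for x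
  proof
    fix l show "?\<phi> (?\<phi> x) l = x l" using s[of l] PiE_arb[OF that, of l] by (cases "l \<in> B") auto
  qed
  have "distr (PiL B) (PiL B) ?\<phi> = PiL B"
  proof (rule distr_unimodular[OF fin fin measurable_PiL_scale])
    show "?\<phi> ` (B \<rightarrow>\<^sub>E UNIV) = B \<rightarrow>\<^sub>E UNIV"
    proof (intro equalityI subsetI)
      fix x :: "'a \<Rightarrow> real" assume x: "x \<in> B \<rightarrow>\<^sub>E UNIV"
      show "x \<in> ?\<phi> ` (B \<rightarrow>\<^sub>E UNIV)"
        by (rule image_eqI[where f = "?\<phi>" and x = "?\<phi> x", OF inv[OF x, symmetric]]) auto
    qed auto
    have Z: "?\<phi> x \<in> B \<rightarrow>\<^sub>E \<int>" if "x \<in> B \<rightarrow>\<^sub>E \<int>" for x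
    proof -
      have "s l * x l \<in> \<int>" if "l \<in> B" for l
        using s[OF that] PiE_mem[OF \<open>x \<in> B \<rightarrow>\<^sub>E \<int>\<close> that] by auto
      then show ?thesis by auto
    qed
    have U: "x \<in> B \<rightarrow>\<^sub>E UNIV" if "x \<in> B \<rightarrow>\<^sub>E \<int>" for x :: "'a \<Rightarrow> real" using that by auto
    show "bij_betw ?\<phi> (B \<rightarrow>\<^sub>E \<int>) (B \<rightarrow>\<^sub>E \<int>)"
      by (rule bij_betw_byWitness[of _ ?\<phi>]) (use inv U Z in blast)+
  qed (auto simp: algebra_simps)
  then show ?thesis by (rule emeasure_unimodular[OF _ measurable_PiL_scale X])
qed

lemma measurable_PiL_abs:
  "(\<lambda>x. \<lambda>l\<in>B. if l \<in> M then \<bar>x l\<bar> else x l) \<in> PiL B \<rightarrow>\<^sub>M PiL B"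
  by (rule measurable_restrict) (auto simp: PiL_component_measurable)

text \<open>Each coordinate \<open>m\<close> in \<open>M\<close> doubles the measure: the parts with
  \<open>x m\<close> nonnegative and nonpositive are mirror images. Because \<open>X\<close> has
  nonnegative coordinates in \<open>M\<close>, they overlap only in a coordinate hyperplane.\<close>

lemma emeasure_PiL_abs:
  assumes fin: "finite B" and "M \<subseteq> B" and X: "X \<in> sets (PiL B)"
    and "\<And>x l. x \<in> X \<Longrightarrow> l \<in> M \<Longrightarrow> 0 \<le> x l"
  shows "emeasure (PiL B) {x \<in> B \<rightarrow>\<^sub>E UNIV. (\<lambda>l\<in>B. if l \<in> M then \<bar>x l\<bar> else x l) \<in> X}
    = 2 ^ card M * emeasure (PiL B) X"
  using finite_subset[OF assms(2,1)] assms(2,4)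
proof (induction M rule: finite_induct)
  case empty
  have "{x \<in> B \<rightarrow>\<^sub>E UNIV. (\<lambda>l\<in>B. x l) \<in> X} = X"
    using sets.sets_into_space[OF X] by (auto simp: space_PiL)
  then show ?case by (simp only: empty_iff if_False card.empty power_0 mult_1)
next
  case (insert m M)
  let ?a = "\<lambda>M (x :: 'a \<Rightarrow> real). \<lambda>l\<in>B. if l \<in> M then \<bar>x l\<bar> else x l"
  let ?s = "\<lambda>l. if l = m then -1 else 1 :: real"
  let ?f = "\<lambda>x. \<lambda>l\<in>B. ?s l * x l"
  have m: "m \<in> B" using insert.prems by auto
  define Y where "Y = {x \<in> B \<rightarrow>\<^sub>E UNIV. ?a M x \<in> X}"
  define Y' where "Y' = {x \<in> B \<rightarrow>\<^sub>E UNIV. ?f x \<in> Y}"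
  have Y: "Y \<in> sets (PiL B)"
  proof -
    have "Y = ?a M -` X \<inter> space (PiL B)" by (auto simp: Y_def space_PiL)
    then show ?thesis using measurable_sets[OF measurable_PiL_abs X] by simp
  qed
  have Y': "Y' \<in> sets (PiL B)"
  proof -
    have "Y' = ?f -` Y \<inter> space (PiL B)" by (auto simp: Y'_def space_PiL)
    then show ?thesis using measurable_sets[OF measurable_PiL_scale Y] by simp
  qed
  have IH: "emeasure (PiL B) Y = 2 ^ card M * emeasure (PiL B) X"
    unfolding Y_def using insert.prems by (intro insert.IH) auto
  have eY': "emeasure (PiL B) Y' = emeasure (PiL B) Y"
    unfolding Y'_def by (rule emeasure_PiL_flip[OF fin _ Y]) auto
  have nn: "0 \<le> x m" if "x \<in> Y" for x
  proof -
    have "?a M x \<in> X" using that unfolding Y_def by blast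
    then have "0 \<le> ?a M x m" by (rule insert.prems(2)) simp
    then show ?thesis using insert.hyps m by simp
  qed
  have np: "x m \<le> 0" if "x \<in> Y'" for x
    using nn[of "?f x"] that m by (simp add: Y'_def)
  have pos: "?a (insert m M) x = ?a M x" if "0 \<le> x m" for x
    using that by (auto simp: fun_eq_iff)
  have neg: "?a (insert m M) x = ?a M (?f x)" if "x m \<le> 0" for x
    using that insert.hyps by (auto simp: fun_eq_iff)
  have fE: "?f x \<in> B \<rightarrow>\<^sub>E UNIV" for x by auto
  have "{x \<in> B \<rightarrow>\<^sub>E UNIV. ?a (insert m M) x \<in> X} = Y \<union> Y'"
  proof (intro equalityI subsetI)
    fix x assume x: "x \<in> {x \<in> B \<rightarrow>\<^sub>E UNIV. ?a (insert m M) x \<in> X}"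
    show "x \<in> Y \<union> Y'"
    proof (cases "0 \<le> x m")
      case True
      then show ?thesis using x pos[of x, OF True] by (simp add: Y_def)
    next
      case False
      then have "x m \<le> 0" by simp
      from neg[of x, OF this] show ?thesis using x fE[of x] unfolding Y'_def Y_def by simp
    qed
  next
    fix x assume "x \<in> Y \<union> Y'"
    then show "x \<in> {x \<in> B \<rightarrow>\<^sub>E UNIV. ?a (insert m M) x \<in> X}"
    proof
      assume x: "x \<in> Y"
      then show ?thesis using pos[of x, OF nn[OF x]] by (simp add: Y_def)
    next
      assume x: "x \<in> Y'"
      then show ?thesis using neg[of x, OF np[OF x]] unfolding Y'_def Y_def by simp
    qed
  qed
  moreover have "emeasure (PiL B) (Y \<inter> Y') = 0"
  proof -
    have "{x \<in> B \<rightarrow>\<^sub>E UNIV. (\<Sum>l\<in>B. (if l = m then 1 else 0) * x l) = 0} \<in> null_sets (PiL B)"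
      by (rule null_hyperplane_PiL[where l = m and \<alpha> = "\<lambda>l. if l = m then 1 else 0", OF fin m]) simp
    moreover have "Y \<inter> Y' \<subseteq> {x \<in> B \<rightarrow>\<^sub>E UNIV. (\<Sum>l\<in>B. (if l = m then 1 else 0) * x l) = 0}"
    proof
      fix x assume x: "x \<in> Y \<inter> Y'"
      then have "x m = 0" using nn[of x] np[of x] by auto
      moreover have "(\<Sum>l\<in>B. (if l = m then 1 else 0) * x l) = (\<Sum>l\<in>B. if l = m then x l else 0)"
        by (intro sum.cong) auto
      ultimately show "x \<in> {x \<in> B \<rightarrow>\<^sub>E UNIV. (\<Sum>l\<in>B. (if l = m then 1 else 0) * x l) = 0}"
        using x fin by (simp add: Y_def sum.delta)
    qed
    ultimately show ?thesis using Y Y' by (meson null_sets_subset null_setsD1 sets.Int)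
  qed
  ultimately have "emeasure (PiL B) {x \<in> B \<rightarrow>\<^sub>E UNIV. ?a (insert m M) x \<in> X}
      = emeasure (PiL B) Y + emeasure (PiL B) Y'"
    using emeasure_Un_Int[OF Y Y'] by simp
  also have "\<dots> = 2 ^ card (insert m M) * emeasure (PiL B) X"
    using insert.hyps by (simp add: eY' IH mult_2 distrib_right)
  finally show ?case .
qed

context finite_hypergraph
begin

section \<open>Charts of the supporting hyperplanes\<close>

text \<open>The equation of \<open>hyp \<epsilon>\<close> solved for a coordinate \<open>i\<close>
  of the support. As \<open>\<epsilon> $ i\<close> is 1 or -1, dividing by it is multiplying by it,
  so this chart and its inverse \<open>coords i\<close> preserve integrality.\<close>

definition hyp_pt :: "real ^ 'n \<Rightarrow> 'n \<Rightarrow> ('n \<Rightarrow> real) \<Rightarrow> real ^ 'n" where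
  "hyp_pt \<epsilon> i c = (\<chi> l. if l = i then \<epsilon> $ i * (level \<epsilon> - (\<Sum>l\<in>supp \<epsilon> - {i}. \<epsilon> $ l * c l))
     else if l \<in> D then c l else 0)"

definition coords :: "'n \<Rightarrow> real ^ 'n \<Rightarrow> 'n \<Rightarrow> real" where
  "coords i x = restrict (($) x) (D - {i})"

definition face_coords :: "real ^ 'n \<Rightarrow> 'n \<Rightarrow> ('n \<Rightarrow> real) set" where
  "face_coords \<epsilon> i = {c \<in> (D - {i}) \<rightarrow>\<^sub>E UNIV. hyp_pt \<epsilon> i c \<in> Q}"

lemma supp_subset_D: "\<epsilon> \<in> signs \<Longrightarrow> supp \<epsilon> \<subseteq> D"
  by (simp add: signs_def)

lemma inner_split:
  assumes "i \<in> supp \<epsilon>"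
  shows "inner \<epsilon> x = \<epsilon> $ i * x $ i + (\<Sum>l\<in>supp \<epsilon> - {i}. \<epsilon> $ l * x $ l)"
  unfolding inner_supp using assms by (intro sum.remove) auto

lemma sum_hyp_pt:
  assumes "\<epsilon> \<in> signs"
  shows "(\<Sum>l\<in>supp \<epsilon> - {i}. \<epsilon> $ l * hyp_pt \<epsilon> i c $ l) = (\<Sum>l\<in>supp \<epsilon> - {i}. \<epsilon> $ l * c l)"
  using supp_subset_D[OF assms] by (intro sum.cong) (auto simp: hyp_pt_def)

lemma hyp_pt_in_hyp:
  assumes "\<epsilon> \<in> signs" "i \<in> supp \<epsilon>"
  shows "hyp_pt \<epsilon> i c \<in> hyp \<epsilon>"
proof -
  have "i \<in> D" using supp_subset_D assms by auto
  then have "hyp_pt \<epsilon> i c \<in> V" by (auto simp: V_def hyp_pt_def)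
  moreover have "\<epsilon> $ i * hyp_pt \<epsilon> i c $ i = level \<epsilon> - (\<Sum>l\<in>supp \<epsilon> - {i}. \<epsilon> $ l * c l)"
    using signs_sq[OF assms] by (simp add: hyp_pt_def mult.assoc[symmetric])
  then have "inner \<epsilon> (hyp_pt \<epsilon> i c) = level \<epsilon>"
    unfolding inner_split[OF assms(2)] sum_hyp_pt[OF assms(1)] by simp
  ultimately show ?thesis by (simp add: hyp_def)
qed

lemma coords_hyp_pt:
  assumes "c \<in> (D - {i}) \<rightarrow>\<^sub>E UNIV"
  shows "coords i (hyp_pt \<epsilon> i c) = c"
proof
  fix l show "coords i (hyp_pt \<epsilon> i c) l = c l"
    using PiE_arb[OF assms, of l] by (auto simp: coords_def hyp_pt_def)
qed

lemma hyp_pt_coords: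
  assumes "\<epsilon> \<in> signs" "i \<in> supp \<epsilon>" "x \<in> hyp \<epsilon>"
  shows "hyp_pt \<epsilon> i (coords i x) = x"
proof (rule vec_eq_iff[THEN iffD2], rule allI)
  fix l
  show "hyp_pt \<epsilon> i (coords i x) $ l = x $ l"
  proof (cases "l = i")
    case True
    have "(\<Sum>l\<in>supp \<epsilon> - {i}. \<epsilon> $ l * coords i x l) = (\<Sum>l\<in>supp \<epsilon> - {i}. \<epsilon> $ l * x $ l)"
      using supp_subset_D[OF assms(1)] by (intro sum.cong) (auto simp: coords_def)
    also have "\<dots> = level \<epsilon> - \<epsilon> $ i * x $ i"
      using inner_split[OF assms(2), of x] assms(3) by (simp add: hyp_def)
    finally show ?thesis
      using True signs_sq[OF assms(1,2)] by (simp add: hyp_pt_def mult.assoc[symmetric])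
  next
    case False
    then show ?thesis using assms(3) by (auto simp: hyp_pt_def coords_def hyp_def V_def)
  qed
qed

lemma coords_extensional: "coords i x \<in> (D - {i}) \<rightarrow>\<^sub>E UNIV"
  by (auto simp: coords_def)

lemma bij_betw_hyp_pt:
  assumes "\<epsilon> \<in> signs" "i \<in> supp \<epsilon>"
  shows "bij_betw (hyp_pt \<epsilon> i) ((D - {i}) \<rightarrow>\<^sub>E UNIV) (hyp \<epsilon>)"
proof (rule bij_betw_byWitness[of _ "coords i"])
  show "\<forall>c\<in>(D - {i}) \<rightarrow>\<^sub>E UNIV. coords i (hyp_pt \<epsilon> i c) = c" using coords_hyp_pt by blast
  show "\<forall>x\<in>hyp \<epsilon>. hyp_pt \<epsilon> i (coords i x) = x" using hyp_pt_coords[OF assms] by blast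
  show "hyp_pt \<epsilon> i ` ((D - {i}) \<rightarrow>\<^sub>E UNIV) \<subseteq> hyp \<epsilon>" using hyp_pt_in_hyp[OF assms] by blast
  show "coords i ` hyp \<epsilon> \<subseteq> (D - {i}) \<rightarrow>\<^sub>E UNIV" using coords_extensional by blast
qed

lemma hyp_pt_integer:
  assumes "\<epsilon> \<in> signs" "i \<in> supp \<epsilon>" "c \<in> (D - {i}) \<rightarrow>\<^sub>E \<int>"
  shows "hyp_pt \<epsilon> i c \<in> integer_points"
proof -
  have e: "\<epsilon> $ l \<in> \<int>" for l
  proof -
    have "\<epsilon> $ l \<in> {-1, 0, 1}" using assms(1) unfolding signs_def by blast
    then show ?thesis by auto
  qed
  have c: "c l \<in> \<int>" if "l \<in> D - {i}" for l using assms(3) that by auto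
  have "\<epsilon> $ l * c l \<in> \<int>" if "l \<in> supp \<epsilon> - {i}" for l
    using e c[of l] that supp_subset_D[OF assms(1)] by (intro Ints_mult) auto
  then have "(\<Sum>l\<in>supp \<epsilon> - {i}. \<epsilon> $ l * c l) \<in> \<int>" by (rule Ints_sum)
  then have "\<epsilon> $ i * (level \<epsilon> - (\<Sum>l\<in>supp \<epsilon> - {i}. \<epsilon> $ l * c l)) \<in> \<int>"
    unfolding level_def by (intro Ints_mult e Ints_diff rank_Ints)
  then show ?thesis using c by (simp add: integer_points_def hyp_pt_def)
qed

lemma bij_betw_hyp_pt_Ints:
  assumes "\<epsilon> \<in> signs" "i \<in> supp \<epsilon>"
  shows "bij_betw (hyp_pt \<epsilon> i) ((D - {i}) \<rightarrow>\<^sub>E \<int>) (hyp \<epsilon> \<inter> integer_points)"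
proof (rule bij_betw_byWitness[of _ "coords i"])
  have U: "c \<in> (D - {i}) \<rightarrow>\<^sub>E UNIV" if "c \<in> (D - {i}) \<rightarrow>\<^sub>E \<int>" for c :: "'n \<Rightarrow> real" using that by auto
  show "\<forall>c\<in>(D - {i}) \<rightarrow>\<^sub>E \<int>. coords i (hyp_pt \<epsilon> i c) = c" using coords_hyp_pt U by blast
  show "\<forall>x\<in>hyp \<epsilon> \<inter> integer_points. hyp_pt \<epsilon> i (coords i x) = x" using hyp_pt_coords[OF assms] by blast
  show "hyp_pt \<epsilon> i ` ((D - {i}) \<rightarrow>\<^sub>E \<int>) \<subseteq> hyp \<epsilon> \<inter> integer_points"
    using hyp_pt_in_hyp[OF assms] hyp_pt_integer[OF assms] by blast
  show "coords i ` (hyp \<epsilon> \<inter> integer_points) \<subseteq> (D - {i}) \<rightarrow>\<^sub>E \<int>"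
    by (intro image_subsetI) (simp add: coords_def integer_points_def restrict_PiE_iff del: restrict_apply)
qed

lemma hyp_pt_coord_measurable:
  assumes "\<epsilon> \<in> signs"
  shows "(\<lambda>c. hyp_pt \<epsilon> i c $ l) \<in> borel_measurable (PiL (D - {i}))"
proof -
  have "(\<lambda>c. \<Sum>l\<in>supp \<epsilon> - {i}. \<epsilon> $ l * c l) \<in> borel_measurable (PiL (D - {i}))"
    using supp_subset_D[OF assms]
    by (intro borel_measurable_sum borel_measurable_times borel_measurable_const PiL_component_measurable) auto
  then have "(\<lambda>c. \<epsilon> $ i * (level \<epsilon> - (\<Sum>l\<in>supp \<epsilon> - {i}. \<epsilon> $ l * c l))) \<in> borel_measurable (PiL (D - {i}))"
    by (intro borel_measurable_times borel_measurable_diff borel_measurable_const)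
  then show ?thesis
    using PiL_component_measurable[of l "D - {i}"]
    by (cases "l = i"; cases "l \<in> D") (simp_all add: hyp_pt_def)
qed

lemma face_coords_measurable:
  assumes "\<epsilon> \<in> signs"
  shows "face_coords \<epsilon> i \<in> sets (PiL (D - {i}))"
proof -
  have "face_coords \<epsilon> i = {c \<in> space (PiL (D - {i})). \<forall>A\<in>UNIV. (\<Sum>l\<in>A. \<bar>hyp_pt \<epsilon> i c $ l\<bar>) \<le> rank L A}"
    by (auto simp: face_coords_def Q_eq coord_body_def space_PiL)
  also have "\<dots> \<in> sets (PiL (D - {i}))"
    by (intro sets.sets_Collect_finite_All borel_measurable_le borel_measurable_sum borel_measurable_abs
        hyp_pt_coord_measurable[OF assms]) auto
  finally show ?thesis .
qed

text \<open>\<open>lattice_vol\<close> picks a frame by \<open>SOME\<close>, which is informative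
  only if a frame exists. The chart supplies one: the point over the origin, and the differences to
  the points over the unit vectors, numbered by an enumeration of \<open>D - {i}\<close>.\<close>

lemma lattice_frame_face:
  assumes "\<epsilon> \<in> facet_signs"
  shows "\<exists>p b. lattice_frame (face \<epsilon>) (card D - 1) p b"
proof -
  have \<epsilon>: "\<epsilon> \<in> signs" "affine hull (face \<epsilon>) = hyp \<epsilon>" using assms by (auto simp: facet_signs_def)
  obtain i where i: "i \<in> supp \<epsilon>" using \<epsilon> by (auto simp: signs_def)
  then have iD: "i \<in> D" using supp_subset_D[OF \<epsilon>(1)] by auto
  let ?d = "card D - 1" and ?B = "D - {i}"
  have card: "card ?B = ?d" using iD by simp
  obtain e where e: "bij_betw e {..<?d} ?B"
    using ex_bij_betw_nat_finite[of ?B] card by (auto simp: atLeast0LessThan)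
  define e' where "e' = the_inv_into {..<?d} e"
  have e': "e' m \<in> {..<?d}" "e (e' m) = m" if "m \<in> ?B" for m
    using that e bij_betw_the_inv_into[OF e] unfolding e'_def
    by (auto simp: bij_betw_def f_the_inv_into_f)
  have e'e: "e' (e l) = l" if "l < ?d" for l
    unfolding e'_def using e that by (auto simp: bij_betw_def the_inv_into_f_f)
  define p where "p = hyp_pt \<epsilon> i (\<lambda>_. 0)"
  define b where "b l = hyp_pt \<epsilon> i (\<lambda>m. if m = e l then 1 else 0) - p" for l
  define re where "re c = (\<lambda>m\<in>?B. c (e' m))" for c :: "nat \<Rightarrow> real"
  have delta: "(\<Sum>l<?d. c l * (if m = e l then 1 else 0)) = c (e' m)" if "m \<in> ?B" for c :: "nat \<Rightarrow> real" and m
  proof -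
    have "(\<Sum>l<?d. c l * (if m = e l then 1 else 0)) = (\<Sum>l<?d. if l = e' m then c l else 0)"
      using e' e'e that by (intro sum.cong) auto
    then show ?thesis using e'[OF that] by (simp add: sum.delta)
  qed
  have param: "affine_param ?d p b c = hyp_pt \<epsilon> i (re c)" for c
  proof (rule vec_eq_iff[THEN iffD2], rule allI)
    fix l
    have ap: "affine_param ?d p b c $ l = p $ l + (\<Sum>q<?d. c q * b q $ l)"
      by (simp add: affine_param_def sum_component)
    consider "l = i" | "l \<in> ?B" | "l \<notin> D" by blast
    then show "affine_param ?d p b c $ l = hyp_pt \<epsilon> i (re c) $ l"
    proof cases
      \<comment> \<open>Only the eliminated coordinate involves more than reindexing. It is affine
        in the chart coordinates, and the double sum over basis vectors and support collapses by
        \<open>delta\<close>.\<close>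
      case 1
      have "(\<Sum>q<?d. c q * b q $ l)
          = (\<Sum>q<?d. \<Sum>m\<in>supp \<epsilon> - {i}. - (\<epsilon> $ i * (\<epsilon> $ m * (c q * (if m = e q then 1 else 0)))))"
        using 1 by (intro sum.cong refl)
          (simp add: b_def p_def hyp_pt_def sum_distrib_left sum_negf algebra_simps del: mult_1_right mult_zero_right)
      also have "\<dots> = (\<Sum>m\<in>supp \<epsilon> - {i}. \<Sum>q<?d. - (\<epsilon> $ i * (\<epsilon> $ m * (c q * (if m = e q then 1 else 0)))))"
        by (rule sum.swap)
      also have "\<dots> = (\<Sum>m\<in>supp \<epsilon> - {i}. - (\<epsilon> $ i * (\<epsilon> $ m * re c m)))"
      proof (rule sum.cong[OF refl])
        fix m assume "m \<in> supp \<epsilon> - {i}"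
        then have m: "m \<in> ?B" using supp_subset_D[OF \<epsilon>(1)] by auto
        have "(\<Sum>q<?d. - (\<epsilon> $ i * (\<epsilon> $ m * (c q * (if m = e q then 1 else 0)))))
            = - (\<epsilon> $ i * (\<epsilon> $ m * (\<Sum>q<?d. c q * (if m = e q then 1 else 0))))"
          by (simp only: sum_negf sum_distrib_left)
        then show "(\<Sum>q<?d. - (\<epsilon> $ i * (\<epsilon> $ m * (c q * (if m = e q then 1 else 0)))))
            = - (\<epsilon> $ i * (\<epsilon> $ m * re c m))" using delta[OF m, of c] m by (simp only: re_def restrict_apply if_True)
      qed
      also have "\<dots> = - (\<epsilon> $ i * (\<Sum>m\<in>supp \<epsilon> - {i}. \<epsilon> $ m * re c m))"
        by (simp only: sum_negf sum_distrib_left)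
      finally show ?thesis using 1 unfolding ap by (simp add: p_def hyp_pt_def algebra_simps)
    next
      case 2
      have "(\<Sum>q<?d. c q * b q $ l) = (\<Sum>q<?d. c q * (if l = e q then 1 else 0))"
        using 2 by (intro sum.cong refl) (simp add: b_def p_def hyp_pt_def)
      then show ?thesis using 2 delta[OF 2, of c] unfolding ap by (simp add: p_def hyp_pt_def re_def)
    next
      case 3
      then show ?thesis using iD unfolding ap by (auto simp: p_def b_def hyp_pt_def intro!: sum.neutral)
    qed
  qed
  have re: "bij_betw re ({..<?d} \<rightarrow>\<^sub>E X) (?B \<rightarrow>\<^sub>E X)" for X
  proof (rule bij_betw_byWitness[of _ "\<lambda>x. \<lambda>l\<in>{..<?d}. x (e l)"])
    have eB: "e l \<in> ?B" if "l < ?d" for l using e that by (auto simp: bij_betw_def)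
    show "\<forall>c\<in>{..<?d} \<rightarrow>\<^sub>E X. (\<lambda>l\<in>{..<?d}. re c (e l)) = c"
    proof (intro ballI ext)
      fix c l assume "c \<in> {..<?d} \<rightarrow>\<^sub>E X"
      then show "(\<lambda>l\<in>{..<?d}. re c (e l)) l = c l"
        using e'e[of l] eB[of l] PiE_arb[of c "{..<?d}" "\<lambda>_. X" l] by (cases "l < ?d") (auto simp: re_def)
    qed
    show "\<forall>x\<in>?B \<rightarrow>\<^sub>E X. re (\<lambda>l\<in>{..<?d}. x (e l)) = x"
    proof (intro ballI ext)
      fix x m assume "x \<in> ?B \<rightarrow>\<^sub>E X"
      then show "re (\<lambda>l\<in>{..<?d}. x (e l)) m = x m"
        using e'[of m] PiE_arb[of x ?B "\<lambda>_. X" m] by (cases "m \<in> ?B") (auto simp: re_def)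
    qed
    show "re ` ({..<?d} \<rightarrow>\<^sub>E X) \<subseteq> ?B \<rightarrow>\<^sub>E X"
      by (intro image_subsetI) (use e'(1) in \<open>simp only: re_def restrict_PiE_iff, blast\<close>)
    show "(\<lambda>x. \<lambda>l\<in>{..<?d}. x (e l)) ` (?B \<rightarrow>\<^sub>E X) \<subseteq> {..<?d} \<rightarrow>\<^sub>E X"
      by (intro image_subsetI) (use eB in \<open>simp only: restrict_PiE_iff lessThan_iff, blast\<close>)
  qed
  have "affine_param ?d p b = hyp_pt \<epsilon> i \<circ> re" using param by (simp add: fun_eq_iff)
  then have "lattice_frame (face \<epsilon>) ?d p b"
    unfolding lattice_frame_def \<epsilon>(2)
    using bij_betw_trans[OF re bij_betw_hyp_pt[OF \<epsilon>(1) i]]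
      bij_betw_trans[OF re bij_betw_hyp_pt_Ints[OF \<epsilon>(1) i]] by simp
  then show ?thesis by blast
qed

text \<open>Whatever frame was picked, the frame followed by \<open>coords i\<close> is an affine
  bijection that matches integer points, so it carries the measure of the frame to that of the
  chart. This removes the choice made in \<open>lattice_vol\<close>.\<close>

lemma lattice_vol_face:
  assumes "\<epsilon> \<in> facet_signs" "i \<in> supp \<epsilon>"
  shows "lattice_vol (face \<epsilon>) = measure (PiL (D - {i})) (face_coords \<epsilon> i)"
proof -
  have \<epsilon>: "\<epsilon> \<in> signs" "affine hull (face \<epsilon>) = hyp \<epsilon>" using assms by (auto simp: facet_signs_def)
  note i = assms(2)
  let ?d = "card D - 1" and ?B = "D - {i}"
  have "nat (aff_dim (face \<epsilon>)) = ?d"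
    using aff_dim_affine_hull[of "face \<epsilon>"] aff_dim_hyp[OF \<epsilon>(1)] \<epsilon>(2) by simp
  define pb where "pb = (SOME (p, b). lattice_frame (face \<epsilon>) ?d p b)"
  define p where "p = fst pb"
  define b where "b = snd pb"
  have "case pb of (p, b) \<Rightarrow> lattice_frame (face \<epsilon>) ?d p b"
    unfolding pb_def by (rule someI_ex) (use lattice_frame_face[OF assms(1)] in auto)
  then have frame: "lattice_frame (face \<epsilon>) ?d p b" by (simp add: p_def b_def case_prod_beta')
  have vol: "lattice_vol (face \<epsilon>)
      = measure (PiL {..<?d}) {c \<in> {..<?d} \<rightarrow>\<^sub>E UNIV. affine_param ?d p b c \<in> face \<epsilon>}"
    unfolding lattice_vol_def Let_def \<open>nat (aff_dim (face \<epsilon>)) = ?d\<close> pb_def[symmetric]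
    by (simp add: case_prod_beta' p_def b_def)
  from frame have bijU: "bij_betw (affine_param ?d p b) ({..<?d} \<rightarrow>\<^sub>E UNIV) (hyp \<epsilon>)"
    and bijZ: "bij_betw (affine_param ?d p b) ({..<?d} \<rightarrow>\<^sub>E \<int>) (hyp \<epsilon> \<inter> integer_points)"
    by (simp_all add: lattice_frame_def \<epsilon>(2))
  define \<phi> where "\<phi> c = coords i (affine_param ?d p b c)" for c
  have ap: "affine_param ?d p b c $ l = p $ l + (\<Sum>q<?d. c q * b q $ l)" for c l
    by (simp add: affine_param_def sum_component)
  have cU: "bij_betw (coords i) (hyp \<epsilon>) (?B \<rightarrow>\<^sub>E UNIV)"
  proof (rule bij_betw_byWitness[of _ "hyp_pt \<epsilon> i"])
    show "\<forall>c\<in>?B \<rightarrow>\<^sub>E UNIV. coords i (hyp_pt \<epsilon> i c) = c" using coords_hyp_pt by blast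
    show "\<forall>x\<in>hyp \<epsilon>. hyp_pt \<epsilon> i (coords i x) = x" using hyp_pt_coords[OF \<epsilon>(1) i] by blast
    show "hyp_pt \<epsilon> i ` (?B \<rightarrow>\<^sub>E UNIV) \<subseteq> hyp \<epsilon>" using hyp_pt_in_hyp[OF \<epsilon>(1) i] by blast
    show "coords i ` hyp \<epsilon> \<subseteq> ?B \<rightarrow>\<^sub>E UNIV" using coords_extensional by blast
  qed
  have cZ: "bij_betw (coords i) (hyp \<epsilon> \<inter> integer_points) (?B \<rightarrow>\<^sub>E \<int>)"
  proof (rule bij_betw_subset[OF cU])
    show "hyp \<epsilon> \<inter> integer_points \<subseteq> hyp \<epsilon>" by blast
    show "coords i ` (hyp \<epsilon> \<inter> integer_points) = ?B \<rightarrow>\<^sub>E \<int>"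
    proof (intro equalityI subsetI)
      fix c :: "'n \<Rightarrow> real" assume c: "c \<in> ?B \<rightarrow>\<^sub>E \<int>"
      then have "c = coords i (hyp_pt \<epsilon> i c)" by (intro coords_hyp_pt[symmetric]) auto
      moreover have "hyp_pt \<epsilon> i c \<in> hyp \<epsilon> \<inter> integer_points"
        using hyp_pt_in_hyp[OF \<epsilon>(1) i] hyp_pt_integer[OF \<epsilon>(1) i c] by blast
      ultimately show "c \<in> coords i ` (hyp \<epsilon> \<inter> integer_points)" by (rule image_eqI)
    next
      fix c assume "c \<in> coords i ` (hyp \<epsilon> \<inter> integer_points)"
      then show "c \<in> ?B \<rightarrow>\<^sub>E \<int>"
        by (elim imageE) (simp add: coords_def integer_points_def restrict_PiE_iff del: restrict_apply)
    qed
  qed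
  have meas: "\<phi> \<in> PiL {..<?d} \<rightarrow>\<^sub>M PiL ?B"
    unfolding \<phi>_def coords_def
  proof (rule measurable_restrict)
    fix l
    have "(\<lambda>c. p $ l + (\<Sum>q<?d. c q * b q $ l)) \<in> borel_measurable (PiL {..<?d})"
      by (intro borel_measurable_add borel_measurable_const borel_measurable_sum borel_measurable_times
          PiL_component_measurable)
    then show "(\<lambda>c. affine_param ?d p b c $ l) \<in> PiL {..<?d} \<rightarrow>\<^sub>M lborel"
      by (simp only: ap measurable_lborel1)
  qed
  have distr: "distr (PiL {..<?d}) (PiL ?B) \<phi> = PiL ?B"
  proof (rule distr_unimodular[OF _ _ meas])
    have "\<phi> = coords i \<circ> affine_param ?d p b" by (simp add: \<phi>_def fun_eq_iff)
    then show "\<phi> ` ({..<?d} \<rightarrow>\<^sub>E UNIV) = ?B \<rightarrow>\<^sub>E UNIV"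
      "bij_betw \<phi> ({..<?d} \<rightarrow>\<^sub>E \<int>) (?B \<rightarrow>\<^sub>E \<int>)"
      using bij_betw_imp_surj_on[OF bij_betw_trans[OF bijU cU]] bij_betw_trans[OF bijZ cZ] by auto
    show "\<phi> (\<lambda>q\<in>{..<?d}. x q + y q) l + \<phi> (\<lambda>q\<in>{..<?d}. 0) l = \<phi> x l + \<phi> y l"
      if "l \<in> ?B" for x y l
    proof -
      have "(\<Sum>q<?d. (\<lambda>q\<in>{..<?d}. x q + y q) q * b q $ l) = (\<Sum>q<?d. x q * b q $ l) + (\<Sum>q<?d. y q * b q $ l)"
        unfolding sum.distrib[symmetric] by (intro sum.cong) (auto simp: distrib_right)
      moreover have "(\<Sum>q<?d. (\<lambda>q\<in>{..<?d}. 0) q * b q $ l) = 0" by (intro sum.neutral) auto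
      ultimately show ?thesis using that by (simp only: \<phi>_def coords_def ap restrict_apply if_True)
    qed
  qed auto
  have "{c \<in> {..<?d} \<rightarrow>\<^sub>E UNIV. affine_param ?d p b c \<in> face \<epsilon>}
      = {c \<in> {..<?d} \<rightarrow>\<^sub>E UNIV. \<phi> c \<in> face_coords \<epsilon> i}"
  proof (intro Collect_cong conj_cong refl)
    fix c assume "c \<in> {..<?d} \<rightarrow>\<^sub>E (UNIV :: real set)"
    then have h: "affine_param ?d p b c \<in> hyp \<epsilon>" using bijU by (auto simp: bij_betw_def)
    then have "hyp_pt \<epsilon> i (\<phi> c) = affine_param ?d p b c"
      unfolding \<phi>_def by (rule hyp_pt_coords[OF \<epsilon>(1) i])
    then show "(affine_param ?d p b c \<in> face \<epsilon>) = (\<phi> c \<in> face_coords \<epsilon> i)"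
      using h coords_extensional[of i] by (auto simp: face_coords_def face_def hyp_def \<phi>_def)
  qed
  then show ?thesis
    using emeasure_unimodular[OF distr meas face_coords_measurable[OF \<epsilon>(1)]]
    by (simp add: vol measure_def)
qed

text \<open>If the face does not span \<open>hyp \<epsilon>\<close>, some linear functional is
  constant on the face but not on \<open>hyp \<epsilon>\<close>. In the chart this constancy is a
  nontrivial linear equation, so the face lies in a null set.\<close>

lemma emeasure_face_coords_eq_0:
  assumes "\<epsilon> \<in> signs" "\<epsilon> \<notin> facet_signs" "i \<in> supp \<epsilon>"
  shows "emeasure (PiL (D - {i})) (face_coords \<epsilon> i) = 0"
proof (cases "face \<epsilon> = {}")
  case True
  have "hyp_pt \<epsilon> i c \<notin> Q" for c
    using True hyp_pt_in_hyp[OF assms(1,3), of c] by (auto simp: face_def hyp_def)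
  then show ?thesis by (simp add: face_coords_def)
next
  case False
  then obtain w where w: "w \<in> face \<epsilon>" by auto
  let ?B = "D - {i}" and ?A = "affine hull (face \<epsilon>)"
  have sub: "?A \<subseteq> hyp \<epsilon>" by (rule hull_minimal[where S = affine, OF face_subset_hyp affine_hyp])
  have wA: "w \<in> ?A" using w by (rule hull_inc)
  obtain y where y: "y \<in> hyp \<epsilon>" "y \<notin> ?A" using sub assms(1,2) by (auto simp: facet_signs_def)
  define U where "U = (\<lambda>v. v - w) ` ?A"
  have "subspace U"
    using affine_diffs_subspace_subtract[OF affine_affine_hull wA] by (simp add: U_def)
  then have spanU: "span U = U" by (simp add: span_eq_iff)
  \<comment> \<open>\<open>z\<close> is the component of \<open>y - w\<close> orthogonal to the
    direction space of the face: its functional is constant on the face and takes another value at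
    \<open>y\<close>.\<close>
  obtain u z where uz: "u \<in> span U" "\<And>v. v \<in> span U \<Longrightarrow> orthogonal z v" "y - w = u + z"
    using orthogonal_subspace_decomp_exists[of U "y - w"] by blast
  have orth: "inner z v = inner z w" if "v \<in> ?A" for v
  proof -
    have "v - w \<in> span U" unfolding U_def by (intro span_base imageI that)
    from uz(2)[OF this] show ?thesis by (simp add: orthogonal_def inner_diff_right)
  qed
  have "z \<noteq> 0"
  proof
    assume "z = 0"
    then have "y - w \<in> U" using uz by (simp add: spanU)
    then show False using y(2) by (auto simp: U_def)
  qed
  have "inner z (y - w) = inner z z"
    using uz(2)[OF uz(1)] by (simp add: uz(3) inner_add_right orthogonal_def)
  moreover have "inner z z \<noteq> 0" using \<open>z \<noteq> 0\<close> by simp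
  ultimately have zy: "inner z y \<noteq> inner z w" unfolding inner_diff_right by linarith
  \<comment> \<open>The functional of \<open>z\<close> after coordinate \<open>i\<close> has been
    substituted from the chart: \<open>\<alpha>\<close> holds its coefficients and
    \<open>\<beta>\<close> its constant term.\<close>
  define \<alpha> where "\<alpha> l = z $ l - (if l \<in> supp \<epsilon> then z $ i * \<epsilon> $ i * \<epsilon> $ l else 0)" for l
  define \<beta> where "\<beta> = z $ i * \<epsilon> $ i * level \<epsilon>"
  have iD: "i \<in> D" using supp_subset_D assms by auto
  have zpt: "inner z (hyp_pt \<epsilon> i c) = \<beta> + (\<Sum>l\<in>?B. \<alpha> l * c l)" for c
  proof -
    have "inner z (hyp_pt \<epsilon> i c) = (\<Sum>l\<in>D. z $ l * hyp_pt \<epsilon> i c $ l)"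
      unfolding inner_vec_def using iD by (intro sum.mono_neutral_cong_right) (auto simp: hyp_pt_def)
    also have "\<dots> = z $ i * hyp_pt \<epsilon> i c $ i + (\<Sum>l\<in>?B. z $ l * hyp_pt \<epsilon> i c $ l)"
      using iD by (intro sum.remove) auto
    also have "(\<Sum>l\<in>?B. z $ l * hyp_pt \<epsilon> i c $ l) = (\<Sum>l\<in>?B. z $ l * c l)"
      by (intro sum.cong) (auto simp: hyp_pt_def)
    also have "z $ i * hyp_pt \<epsilon> i c $ i
        = \<beta> - (\<Sum>l\<in>supp \<epsilon> - {i}. z $ i * \<epsilon> $ i * \<epsilon> $ l * c l)"
      by (simp add: hyp_pt_def \<beta>_def right_diff_distrib sum_distrib_left mult.assoc)
    also have "(\<Sum>l\<in>supp \<epsilon> - {i}. z $ i * \<epsilon> $ i * \<epsilon> $ l * c l)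
        = (\<Sum>l\<in>?B. (if l \<in> supp \<epsilon> then z $ i * \<epsilon> $ i * \<epsilon> $ l else 0) * c l)"
      using supp_subset_D[OF assms(1)] by (intro sum.mono_neutral_cong_left) auto
    finally show ?thesis by (simp add: \<alpha>_def left_diff_distrib sum_subtractf)
  qed
  obtain l where l: "l \<in> ?B" "\<alpha> l \<noteq> 0"
  proof (rule ccontr)
    assume "\<not> thesis"
    then have "\<alpha> l = 0" if "l \<in> ?B" for l using that \<open>\<And>l. l \<in> ?B \<Longrightarrow> \<alpha> l \<noteq> 0 \<Longrightarrow> thesis\<close> by blast
    then have "inner z (hyp_pt \<epsilon> i c) = \<beta>" for c by (simp add: zpt)
    then have "inner z v = \<beta>" if "v \<in> hyp \<epsilon>" for v
      using hyp_pt_coords[OF assms(1,3) that] by metis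
    then show False using zy y(1) wA sub by auto
  qed
  have "{c \<in> ?B \<rightarrow>\<^sub>E UNIV. (\<Sum>l\<in>?B. \<alpha> l * c l) = inner z w - \<beta>} \<in> null_sets (PiL ?B)"
    by (rule null_hyperplane_PiL[where l = l and \<alpha> = \<alpha>, OF _ l]) simp
  moreover have "face_coords \<epsilon> i \<subseteq> {c \<in> ?B \<rightarrow>\<^sub>E UNIV. (\<Sum>l\<in>?B. \<alpha> l * c l) = inner z w - \<beta>}"
  proof
    fix c assume c: "c \<in> face_coords \<epsilon> i"
    then have "hyp_pt \<epsilon> i c \<in> face \<epsilon>"
      using hyp_pt_in_hyp[OF assms(1,3), of c] by (auto simp: face_coords_def face_def hyp_def)
    then have "inner z (hyp_pt \<epsilon> i c) = inner z w" by (intro orth hull_inc)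
    then show "c \<in> {c \<in> ?B \<rightarrow>\<^sub>E UNIV. (\<Sum>l\<in>?B. \<alpha> l * c l) = inner z w - \<beta>}"
      using c by (simp add: zpt face_coords_def)
  qed
  ultimately show ?thesis
    using null_sets_subset[OF _ face_coords_measurable[OF assms(1)]] by blast
qed

text \<open>On the support the signs of a point of the face are forced to agree with \<epsilon>, and
  one reflection makes these coordinates nonnegative. Off the support the signs are free, and each
  such coordinate contributes a factor 2.\<close>

lemma emeasure_face_coords:
  assumes "\<epsilon> \<in> signs" "i \<in> supp \<epsilon>"
  shows "emeasure (PiL (D - {i})) (face_coords \<epsilon> i)
    = 2 ^ card (D - supp \<epsilon>) * emeasure (PiL (D - {i})) (face_proj L D (supp \<epsilon>) i)"
proof -
  let ?B = "D - {i}" and ?I = "supp \<epsilon>"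
  let ?X = "face_proj L D ?I i"
  have I: "?I \<subseteq> D" by (rule supp_subset_D[OF assms(1)])
  have iD: "i \<in> D" using I assms by auto
  have finB: "finite ?B" "finite D" "finite ?I" by auto
  have X: "?X \<in> sets (PiL ?B)" by (rule face_proj_measurable[OF finB(2) assms(2) I])
  let ?s = "\<lambda>l. if l \<in> ?I then \<epsilon> $ l else 1"
  let ?a = "\<lambda>x. \<lambda>l\<in>?B. if l \<in> D - ?I then \<bar>x l\<bar> else x l"
  let ?f = "\<lambda>x. \<lambda>l\<in>?B. ?s l * x l"
  define Y where "Y = {x \<in> ?B \<rightarrow>\<^sub>E UNIV. ?a x \<in> ?X}"
  have Ym: "Y \<in> sets (PiL ?B)"
  proof -
    have "Y = ?a -` ?X \<inter> space (PiL ?B)" unfolding Y_def space_PiL by blast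
    then show ?thesis by (simp only: measurable_sets[OF measurable_PiL_abs X])
  qed
  have eY: "emeasure (PiL ?B) Y = 2 ^ card (D - ?I) * emeasure (PiL ?B) ?X"
    unfolding Y_def
  proof (rule emeasure_PiL_abs[OF finB(1) _ X])
    show "D - ?I \<subseteq> ?B" using assms(2) by auto
    fix x l assume x: "x \<in> ?X" and l: "l \<in> D - ?I"
    have "0 \<le> lift L ?I i x l" using x l by (auto simp: face_proj_def polymatroid_def)
    moreover have "l \<noteq> i" using l assms(2) by auto
    ultimately show "0 \<le> x l" by (simp add: lift_def)
  qed
  have "face_coords \<epsilon> i = {x \<in> ?B \<rightarrow>\<^sub>E UNIV. ?f x \<in> Y}"
  proof -
    have "hyp_pt \<epsilon> i c \<in> Q \<longleftrightarrow> ?a (?f c) \<in> ?X" if c: "c \<in> ?B \<rightarrow>\<^sub>E UNIV" for c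
    proof -
      let ?x = "hyp_pt \<epsilon> i c" and ?z = "lift L ?I i (?a (?f c))"
      have sI: "(\<Sum>l\<in>?I - {i}. ?a (?f c) l) = (\<Sum>l\<in>?I - {i}. \<epsilon> $ l * c l)"
        using I by (intro sum.cong) auto
      have zi: "?z i = level \<epsilon> - (\<Sum>l\<in>?I - {i}. \<epsilon> $ l * c l)"
        by (simp only: lift_def fun_upd_same sI level_def)
      have zx: "\<bar>?x $ l\<bar> = \<bar>?z l\<bar>" if "l \<in> D" for l
      proof (cases "l = i")
        case True
        then show ?thesis using zi signs_cases[OF assms] by (auto simp: hyp_pt_def abs_mult)
      next
        case False
        then show ?thesis using that signs_cases[OF assms(1), of l]
          by (auto simp: hyp_pt_def lift_def abs_mult)
      qed
      have zE: "?z \<in> D \<rightarrow>\<^sub>E UNIV" by (rule lift_extensional[OF iD]) auto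
      have aE: "?a (?f c) \<in> ?B \<rightarrow>\<^sub>E UNIV" by auto
      have sumx: "(\<Sum>l\<in>A. \<bar>?x $ l\<bar>) = (\<Sum>l\<in>A \<inter> D. \<bar>?z l\<bar>)" for A
      proof -
        have "(\<Sum>l\<in>A. \<bar>?x $ l\<bar>) = (\<Sum>l\<in>A \<inter> D. \<bar>?x $ l\<bar>)"
          using iD by (intro sum.mono_neutral_right) (auto simp: hyp_pt_def)
        then show ?thesis using zx by simp
      qed
      have "?x \<in> Q \<longleftrightarrow> ?z \<in> polymatroid L D"
      proof
        assume x: "?x \<in> Q"
        have le: "(\<Sum>l\<in>A. \<bar>?z l\<bar>) \<le> rank L A" if "A \<subseteq> D" for A
          using QD[OF x, of A] sumx[of A] that by (simp add: Int_absorb2)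
        have nn: "0 \<le> ?z l" if l: "l \<in> D" for l
        proof (cases "l \<in> ?I")
          case True
          \<comment> \<open>The entries on the support add up to the rank and their absolute values
            to at most the rank, so none of them is negative.\<close>
          have "(\<Sum>m\<in>?I. \<bar>?z m\<bar> - ?z m) \<le> 0"
            using le[OF I] sum_lift[OF finB(3) assms(2), of L "?a (?f c)"] by (simp add: sum_subtractf)
          then have "\<bar>?z l\<bar> - ?z l \<le> 0"
            using member_le_sum[OF True, of "\<lambda>m. \<bar>?z m\<bar> - ?z m"] finB(3) by fastforce
          then show ?thesis by linarith
        next
          case False
          then show ?thesis using l assms(2) by (auto simp: lift_def)
        qed
        have "sum ?z A \<le> rank L A" if "A \<subseteq> D" for A
          using le[OF that] sum_mono[of A ?z "\<lambda>l. \<bar>?z l\<bar>"] by (meson abs_ge_self order_trans)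
        then show "?z \<in> polymatroid L D" using zE nn unfolding polymatroid_def by blast
      next
        assume z: "?z \<in> polymatroid L D"
        have "(\<Sum>l\<in>A. \<bar>?x $ l\<bar>) \<le> rank L A" for A
        proof -
          have "(\<Sum>l\<in>A \<inter> D. \<bar>?z l\<bar>) = sum ?z (A \<inter> D)"
            using z by (intro sum.cong) (auto simp: polymatroid_def)
          also have "\<dots> \<le> rank L (A \<inter> D)" using z unfolding polymatroid_def by blast
          also have "\<dots> \<le> rank L A" by (rule rank_mono[OF finite_L]) auto
          finally show ?thesis using sumx by simp
        qed
        then show "?x \<in> Q" by (simp add: Q_eq coord_body_def)
      qed
      then show ?thesis using aE unfolding face_proj_def by blast
    qed
    then show ?thesis unfolding face_coords_def Y_def by fastforce
  qed
  moreover have "emeasure (PiL ?B) {x \<in> ?B \<rightarrow>\<^sub>E UNIV. ?f x \<in> Y} = emeasure (PiL ?B) Y"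
    using signs_cases[OF assms(1)] by (intro emeasure_PiL_flip[OF finB(1) _ Ym]) auto
  ultimately show ?thesis using eY by simp
qed

end

section \<open>The surface volume\<close>

context finite_hypergraph
begin

lemma card_signs_with_supp:
  assumes "I \<subseteq> D" "I \<noteq> {}"
  shows "card {\<epsilon> \<in> signs. supp \<epsilon> = I} = 2 ^ card I"
proof -
  let ?v = "\<lambda>A. (\<chi> i. if i \<in> A then 1 else if i \<in> I then -1 else 0) :: real ^ 'n"
  have "bij_betw ?v (Pow I) {\<epsilon> \<in> signs. supp \<epsilon> = I}"
  proof (rule bij_betw_byWitness[of _ "\<lambda>\<epsilon>. {i. \<epsilon> $ i = 1}"])
    show "\<forall>A\<in>Pow I. {i. ?v A $ i = 1} = A" by auto
    show "\<forall>\<epsilon>\<in>{\<epsilon> \<in> signs. supp \<epsilon> = I}. ?v {i. \<epsilon> $ i = 1} = \<epsilon>"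
    proof
      fix \<epsilon> assume \<epsilon>: "\<epsilon> \<in> {\<epsilon> \<in> signs. supp \<epsilon> = I}"
      have "?v {i. \<epsilon> $ i = 1} $ i = \<epsilon> $ i" for i
        using \<epsilon> signs_cases[of \<epsilon> i] by (cases "i \<in> I") (auto simp: supp_def)
      then show "?v {i. \<epsilon> $ i = 1} = \<epsilon>" by (simp only: vec_eq_iff simp_thms)
    qed
    show "?v ` Pow I \<subseteq> {\<epsilon> \<in> signs. supp \<epsilon> = I}"
    proof (intro image_subsetI CollectI conjI)
      fix A assume A: "A \<in> Pow I"
      show s: "supp (?v A) = I" using A by (auto simp: supp_def)
      have "?v A $ i \<in> {-1, 0, 1}" for i by simp
      then show "?v A \<in> signs" unfolding signs_def mem_Collect_eq s using assms by blast
    qed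
    show "(\<lambda>\<epsilon>. {i. \<epsilon> $ i = 1}) ` {\<epsilon> \<in> signs. supp \<epsilon> = I} \<subseteq> Pow I" by (auto simp: supp_def)
  qed
  then have "card (Pow I) = card {\<epsilon> \<in> signs. supp \<epsilon> = I}" by (rule bij_betw_same_card)
  then show ?thesis by (simp add: card_Pow)
qed

lemma measure_face_coords:
  assumes "\<epsilon> \<in> signs" "i \<in> supp \<epsilon>"
  shows "measure (PiL (D - {i})) (face_coords \<epsilon> i)
    = 2 ^ card (D - supp \<epsilon>) * (\<Sum>a\<in>split_at L D (supp \<epsilon>). weight L a)"
proof -
  have "emeasure (PiL (D - {i})) (face_coords \<epsilon> i)
      = 2 ^ card (D - supp \<epsilon>) * ennreal (\<Sum>a\<in>split_at L D (supp \<epsilon>). weight L a)"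
    unfolding emeasure_face_coords[OF assms]
    using emeasure_face_proj_eq_weight[OF finite_L _ assms(2) supp_subset_D[OF assms(1)]] by simp
  also have "\<dots> = ennreal (2 ^ card (D - supp \<epsilon>) * (\<Sum>a\<in>split_at L D (supp \<epsilon>). weight L a))"
    by (simp add: ennreal_mult sum_weight_nonneg flip: ennreal_power ennreal_numeral)
  finally show ?thesis
    by (intro measure_eq_emeasure_eq_ennreal mult_nonneg_nonneg sum_weight_nonneg) auto
qed

text \<open>A support \<open>I\<close> has \<open>2 ^ card I\<close> normals, each contributing
  \<open>2 ^ card (D - I)\<close> times the weights of \<open>I\<close>. The product of the two
  powers is the same for all \<open>I\<close>, so the sum over \<open>I\<close> reassembles
  \<open>near_full L D\<close>.\<close>

lemma surface_vol_Q: "surface_vol Q = 2 ^ card D * (\<Sum>a\<in>near_full L D. weight L a)"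
proof -
  define pt where "pt \<epsilon> = (SOME i. i \<in> supp \<epsilon>)" for \<epsilon>
  have pt: "pt \<epsilon> \<in> supp \<epsilon>" if "\<epsilon> \<in> signs" for \<epsilon>
    unfolding pt_def using that by (simp add: some_in_eq signs_def)
  let ?m = "\<lambda>\<epsilon>. measure (PiL (D - {pt \<epsilon>})) (face_coords \<epsilon> (pt \<epsilon>))"
  let ?W = "\<lambda>I. \<Sum>a\<in>split_at L D I. weight L a"
  let ?S = "{I. I \<subseteq> D \<and> I \<noteq> {}}"
  have "surface_vol Q = (\<Sum>\<epsilon>\<in>facet_signs. lattice_vol (face \<epsilon>))"
    unfolding surface_vol_def facets_Q by (simp add: sum.reindex[OF inj_on_face])
  also have "\<dots> = (\<Sum>\<epsilon>\<in>facet_signs. ?m \<epsilon>)"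
    using pt by (intro sum.cong lattice_vol_face refl) (auto simp: facet_signs_def)
  \<comment> \<open>Chart measures have to replace \<open>lattice_vol\<close> before the sum is
    extended: a face of smaller dimension may have positive \<open>lattice_vol\<close>, taken in its
    own dimension, but its chart measure is 0.\<close>
  also have "\<dots> = (\<Sum>\<epsilon>\<in>signs. ?m \<epsilon>)"
    using finite_signs emeasure_face_coords_eq_0 pt
    by (intro sum.mono_neutral_left) (auto simp: facet_signs_def measure_def)
  also have "\<dots> = (\<Sum>\<epsilon>\<in>signs. 2 ^ card (D - supp \<epsilon>) * ?W (supp \<epsilon>))"
    using pt by (intro sum.cong measure_face_coords refl)
  also have "\<dots> = (\<Sum>I\<in>?S. \<Sum>\<epsilon>\<in>{\<epsilon> \<in> signs. supp \<epsilon> = I}. 2 ^ card (D - supp \<epsilon>) * ?W (supp \<epsilon>))"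
    using finite_signs by (intro sum.group[symmetric]) (auto simp: signs_def)
  also have "\<dots> = (\<Sum>I\<in>?S. 2 ^ card D * ?W I)"
  proof (rule sum.cong[OF refl])
    fix I assume "I \<in> ?S"
    then have I: "I \<subseteq> D" "I \<noteq> {}" by auto
    have "card I + card (D - I) = card D"
      using I card_Diff_subset[of I D] card_mono[of D I] by simp
    then have c: "(2 :: real) ^ card I * 2 ^ card (D - I) = 2 ^ card D" by (simp flip: power_add)
    have "(\<Sum>\<epsilon>\<in>{\<epsilon> \<in> signs. supp \<epsilon> = I}. 2 ^ card (D - supp \<epsilon>) * ?W (supp \<epsilon>))
        = (\<Sum>\<epsilon>\<in>{\<epsilon> \<in> signs. supp \<epsilon> = I}. 2 ^ card (D - I) * ?W I)"
      by (intro sum.cong) auto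
    also have "\<dots> = 2 ^ card I * (2 ^ card (D - I) * ?W I)"
      by (simp add: card_signs_with_supp[OF I])
    finally show "(\<Sum>\<epsilon>\<in>{\<epsilon> \<in> signs. supp \<epsilon> = I}. 2 ^ card (D - supp \<epsilon>) * ?W (supp \<epsilon>)) = 2 ^ card D * ?W I"
      using c by (simp add: mult.assoc[symmetric])
  qed
  also have "\<dots> = 2 ^ card D * (\<Sum>I\<in>?S. ?W I)" by (simp add: sum_distrib_left)
  also have "(\<Sum>I\<in>?S. ?W I) = (\<Sum>a\<in>near_full L D. weight L a)"
    unfolding near_full_eq_UN_split_at[OF finite_L finite]
    by (rule sum_UN_split_at[OF finite_L finite, symmetric]) auto
  finally show ?thesis .
qed

end

section \<open>Passage from the graph to the hypergraph of positive coefficients\<close>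

text \<open>A summand with coefficient 0 shrinks to the point 0, the neutral element of Minkowski
  addition; cross-polytopes are nonempty even for an empty neighbourhood.\<close>

lemma Q_poly_eq_support:
  fixes G :: "(nat \<times> 'n::finite) set"
  shows "Q_poly m G k
    = (\<Sum>j\<in>{j \<in> {1..m}. 0 < k j}. (\<lambda>x. real (k j) *\<^sub>R x) ` cross_polytope (nbhd G j))"
  unfolding Q_poly_def
proof (rule sum.mono_neutral_right)
  show "\<forall>j\<in>{1..m} - {j \<in> {1..m}. 0 < k j}. (\<lambda>x. real (k j) *\<^sub>R x) ` cross_polytope (nbhd G j) = 0"
  proof
    fix j assume "j \<in> {1..m} - {j \<in> {1..m}. 0 < k j}"
    then have "k j = 0" by auto
    moreover have "cross_polytope (nbhd G j) \<noteq> {}" by (auto simp: cross_polytope_def)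
    ultimately show "(\<lambda>x. real (k j) *\<^sub>R x) ` cross_polytope (nbhd G j) = 0" by (auto simp: set_zero)
  qed
qed auto

lemma finite_draconian_seqs:
  fixes G :: "(nat \<times> 'n::finite) set"
  shows "finite (draconian_seqs m G)"
proof (rule finite_subset)
  show "draconian_seqs m G \<subseteq> {1..m} \<rightarrow>\<^sub>E {..card (UNIV :: 'n set)}"
  proof
    fix a assume a: "a \<in> draconian_seqs m G"
    have "a j \<le> card (UNIV :: 'n set)" if "j \<in> {1..m}" for j
    proof -
      have "(\<Sum>j\<in>{j}. a j) \<le> card (\<Union>j\<in>{j}. nbhd G j)"
        using a that unfolding draconian_seqs_def by blast
      also have "\<dots> \<le> card (UNIV :: 'n set)" by (intro card_mono) auto
      finally show ?thesis by simp
    qed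
    then show "a \<in> {1..m} \<rightarrow>\<^sub>E {..card (UNIV :: 'n set)}"
      using a by (auto simp: draconian_seqs_def PiE_iff)
  qed
  show "finite ({1..m} \<rightarrow>\<^sub>E {..card (UNIV :: 'n set)})" by (intro finite_PiE) auto
qed

theorem corollary4p18:
  fixes m d :: nat
    and G :: "(nat \<times> 'n::finite) set"
    and k :: "nat \<Rightarrow> nat"
  assumes "G \<subseteq> {1..m} \<times> UNIV"
    and "aff_dim (Q_poly m G k) = int d"
  shows "surface_vol (Q_poly m G k) =
    2 ^ d * (\<Sum>a\<in>{a \<in> draconian_seqs m G. int (\<Sum>j\<in>{1..m}. a j) = int d - 1}.
               (\<Prod>j\<in>{1..m}. real (k j) ^ a j) / (\<Prod>j\<in>{1..m}. fact (a j)))"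
proof -
  define L where "L = {j \<in> {1..m}. 0 < k j}"
  interpret finite_hypergraph "nbhd G" k L
    by unfold_locales (auto simp: L_def)
  have Q: "Q_poly m G k = Q" unfolding Q_poly_eq_support Q_def L_def[symmetric] ..
  have d: "card D = d" using assms(2) aff_dim_Q by (simp add: Q)
  \<comment> \<open>Over the integers \<open>d = 0\<close> leaves no sequence, in accordance with a
    point having no facets; truncated subtraction would admit the zero sequence.\<close>
  let ?S = "{a \<in> draconian_seqs m G. int (\<Sum>j\<in>{1..m}. a j) = int d - 1}"
  \<comment> \<open>A nonzero entry at a vanishing coefficient makes the weight 0. For the remaining
    sequences the convention \<open>0 ^ 0 = 1\<close> turns the factors off \<open>L\<close> into
    1.\<close>
  let ?S' = "{a \<in> ?S. \<forall>j\<in>{1..m} - L. a j = 0}"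
  let ?w = "\<lambda>a. \<Prod>j\<in>{1..m}. real (k j) ^ a j / fact (a j)"
  have LM: "L \<subseteq> {1..m}" by (auto simp: L_def)
  have "(\<Sum>a\<in>?S. (\<Prod>j\<in>{1..m}. real (k j) ^ a j) / (\<Prod>j\<in>{1..m}. fact (a j))) = (\<Sum>a\<in>?S. ?w a)"
    by (simp add: prod_dividef)
  also have "\<dots> = (\<Sum>a\<in>?S'. ?w a)"
  proof (rule sum.mono_neutral_right)
    show "finite ?S" by (rule finite_subset[OF _ finite_draconian_seqs[of m G]]) blast
    show "\<forall>a\<in>?S - ?S'. ?w a = 0"
    proof
      fix a assume "a \<in> ?S - ?S'"
      then obtain j where j: "j \<in> {1..m} - L" "a j \<noteq> 0" by auto
      then have "real (k j) ^ a j / fact (a j) = 0" by (auto simp: L_def)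
      then show "?w a = 0" using j by (intro prod_zero) auto
    qed
  qed auto
  also have "\<dots> = (\<Sum>a\<in>near_full L D. weight L a)"
  \<comment> \<open>The two encodings differ in their default values: \<open>undefined\<close> off
    \<open>{1..m}\<close> on one side, 0 off \<open>L\<close> on the other.\<close>
  proof (rule sum.reindex_bij_witness[where i = "\<lambda>b. restrict b {1..m}"
        and j = "\<lambda>a j. if j \<in> L then a j else 0"])
    fix a assume a: "a \<in> ?S'"
    let ?b = "\<lambda>j. if j \<in> L then a j else 0"
    have ext: "a j = undefined" if "j \<notin> {1..m}" for j
      using a PiE_arb[of a "{1..m}" "\<lambda>_. UNIV" j] that by (auto simp: draconian_seqs_def)
    have z: "a j = 0" if "j \<in> {1..m}" "j \<notin> L" for j using a that by auto
    show "restrict ?b {1..m} = a"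
    proof
      fix j show "restrict ?b {1..m} j = a j"
        using ext[of j] z[of j] by (cases "j \<in> {1..m}") auto
    qed
    have "sum ?b L = (\<Sum>j\<in>{1..m}. a j)"
      using z LM by (intro sum.mono_neutral_cong_left) auto
    moreover have "int (\<Sum>j\<in>{1..m}. a j) = int d - 1" using a by blast
    ultimately have "sum ?b L + 1 = card D" using d by linarith
    moreover have "sum ?b J \<le> card (D \<inter> \<Union>(nbhd G ` J))" if J: "J \<subseteq> L" for J
    proof (cases "J = {}")
      case False
      have "J \<subseteq> {1..m}" using J LM by blast
      then have "sum a J \<le> card (\<Union>(nbhd G ` J))"
        using a False unfolding draconian_seqs_def by blast
      moreover have "D \<inter> \<Union>(nbhd G ` J) = \<Union>(nbhd G ` J)" using J by (auto simp: D_def)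
      moreover have "sum ?b J = sum a J" using J by (intro sum.cong) auto
      ultimately show ?thesis by simp
    qed simp
    ultimately show "?b \<in> near_full L D" by (simp add: near_full_def drac_def)
    have "?w a = (\<Prod>j\<in>L. real (k j) ^ a j / fact (a j))"
      using z LM by (intro prod.mono_neutral_right) auto
    also have "\<dots> = weight L ?b" unfolding weight_def by (intro prod.cong) auto
    finally show "weight L ?b = ?w a" by simp
  next
    fix b assume b: "b \<in> near_full L D"
    then have dr: "b \<in> drac L D" and s: "sum b L + 1 = card D" by (auto simp: near_full_def)
    have z: "b j = 0" if "j \<notin> L" for j by (rule dracD(1)[OF dr that])
    show "(\<lambda>j. if j \<in> L then restrict b {1..m} j else 0) = b"
    proof
      fix j show "(if j \<in> L then restrict b {1..m} j else 0) = b j" using z[of j] LM by auto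
    qed
    \<comment> \<open>Indices outside \<open>L\<close> add nothing to the sum and can only enlarge
      the neighbourhood, so the inequalities for subsets of \<open>L\<close> imply all the
      others.\<close>
    have "sum (restrict b {1..m}) J \<le> card (\<Union>(nbhd G ` J))" if J: "J \<subseteq> {1..m}" for J
    proof -
      have "finite J" using J finite_subset by blast
      have "sum (restrict b {1..m}) J = sum b (J \<inter> L)"
        using J z \<open>finite J\<close> by (intro sum.mono_neutral_cong_right) auto
      also have "\<dots> \<le> card (D \<inter> \<Union>(nbhd G ` (J \<inter> L)))" by (rule dracD(2)[OF dr]) auto
      also have "\<dots> \<le> card (\<Union>(nbhd G ` J))" by (intro card_mono) auto
      finally show ?thesis .
    qed
    then have "restrict b {1..m} \<in> draconian_seqs m G"
      unfolding draconian_seqs_def by (simp add: restrict_PiE_iff del: restrict_apply)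
    moreover have "(\<Sum>j\<in>{1..m}. restrict b {1..m} j) = sum b L"
      using z LM by (intro sum.mono_neutral_cong_right) auto
    then have "int (\<Sum>j\<in>{1..m}. restrict b {1..m} j) = int d - 1" using s d by linarith
    moreover have "\<forall>j\<in>{1..m} - L. restrict b {1..m} j = 0" using z by auto
    ultimately show "restrict b {1..m} \<in> ?S'" by blast
  qed
  finally show ?thesis unfolding Q surface_vol_Q d by simp
qed

end
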